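(* Let $(E,\mathcal P)$ be a random locally convex module over $K$ with base $(\Omega,\mathcal F,P)$ such that $E$ has the countable concatenation property. Then $(E,\mathcal T_c)$ is $L^0$-pre-barreled if and only if $\mathcal T_c=\beta(E,E^*_c)$.
   Context: $(\Omega,\mathcal F,P)$ is a probability space and $K=\mathbb R$ or $\mathbb C$. $L^0(\mathcal F,K)$ is the algebra of (a.s.-equality) equivalence classes of $K$-valued $\mathcal F$-measurable random variables; $L^0(\mathcal F)=L^0(\mathcal F,\mathbb R)$ with the a.s. order; $L^0_+(\mathcal F)$ and $L^0_{++}(\mathcal F)$ are its elements that are $\ge0$, respectively $>0$, a.s. on $\Omega$. $\tilde I_A$ is the class of the indicator of $A\in\mathcal F$; $\bigvee$ is the (essential) supremum. An $L^0$-seminorm on an $L^0(\mathcal F,K)$-module $E$ is a map $\|\cdot\|:E\to L^0_+(\mathcal F)$ with $\|\xi x\|=|\xi|\|x\|$, $\|x+y\|\le\|x\|+\|y\|$. A random locally convex module over $K$ with base $(\Omega,\mathcal F,P)$ is a pair $(E,\mathcal P)$ with $E$ an $L^0(\mathcal F,K)$-module and $\mathcal P$ a family of $L^0$-seminorms with $\bigvee\{\|x\|:\|\cdot\|\in\mathcal P\}=0$ iff $x=\theta$. The locally $L^0$-convex topology induced by a family $\mathcal P$ of $L^0$-seminorms, denoted $\mathcal T_c$, has local base at $\theta$ consisting of $\{x:\bigvee_{\|\cdot\|\in\mathcal Q}\|x\|\le\varepsilon\}$, $\mathcal Q\subset\mathcal P$ finite, $\varepsilon\in L^0_{++}(\mathcal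 F)$; $L^0(\mathcal F,K)$ carries the $\mathcal T_c$ induced by $|\cdot|$. $E^*_c$ is the module of continuous module homomorphisms from $(E,\mathcal T_c)$ to $(L^0(\mathcal F,K),\mathcal T_c)$. For subsets $A,B$ of an $L^0(\mathcal F,K)$-module, $A$ is $L^0$-absorbed by $B$ if there is $\xi\in L^0_{++}(\mathcal F)$ with $\eta A\subset B$ for all $\eta\in L^0(\mathcal F,K)$, $|\eta|\le\xi$; $B$ is $L^0$-absorbent if it $L^0$-absorbs every element; $L^0$-balanced if $\eta B\subset B$ whenever $|\eta|\le1$; $L^0$-convex if $\xi x+(1-\xi)y\in B$ for $x,y\in B$, $\xi\in L^0_+(\mathcal F)$, $0\le\xi\le1$. An $L^0$-barrel is an $L^0$-balanced, $L^0$-absorbent, $L^0$-convex and closed set. A subset $G$ of $E$ (possibly $G=E$) has the countable concatenation property if for every sequence $\{x_n\}$ in $G$ and countable partition $\{A_n\}$ of $\Omega$ into sets of $\mathcal F$ there is $x\in G$ with $\tilde I_{A_n}x=\tilde I_{A_n}x_n$ for all $n$. $(E,\mathcal T_c)$ is $L^0$-pre-barreled if every $L^0$-barrel with the countable concatenation property is a neighborhood of $\theta$. $\sigma_c(E^*_c,E)$ is the locally $L^0$-convex topology on $E^*_c$ induced by the $L^0$-seminorms $g\mapsto|g(x)|$, $x\in E$; a set is bounded for a locally $L^0$-convex topology if it is $L^0$-absorbed by every neighborhood of $\theta$. $\beta(E,E^*_c)$ is the locally $L^0$-convex topology on $E$ induced by the $L^0$-seminorms $\|x\|_A=\bigvee\{|g(x)|:g\in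 A\}$, $A$ ranging over all $\sigma_c(E^*_c,E)$-bounded subsets of $E^*_c$. *)

theory Defs
  imports "HOL-Probability.Probability" "HOL-Algebra.Module" "HOL-Algebra.Lattice"
begin

section \<open>The algebra of random variables modulo almost sure equality\<close>

definition ae_rel :: "'w measure \<Rightarrow> (('w \<Rightarrow> 'k::topological_space) \<times> ('w \<Rightarrow> 'k)) set" where
  "ae_rel P = {(f, g). f \<in> borel_measurable P \<and> g \<in> borel_measurable P \<and> (AE w in P. f w = g w)}"

definition ae_class :: "'w measure \<Rightarrow> ('w \<Rightarrow> 'k::topological_space) \<Rightarrow> ('w \<Rightarrow> 'k) set" where
  "ae_class P f = ae_rel P `` {f}"

text \<open>An arbitrarily chosen representative; everything below depends on it only up to almost sure
  equality.\<close>

definition rep :: "('w \<Rightarrow> 'k) set \<Rightarrow> 'w \<Rightarrow> 'k" where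
  "rep X = (SOME f. f \<in> X)"

text \<open>The record type of modules extends that of rings, so the same object serves as the ring of
  scalars and as a module over itself.\<close>

definition L0 :: "'w measure \<Rightarrow> (('w \<Rightarrow> 'k::real_normed_field) set, ('w \<Rightarrow> 'k) set) module" where
  "L0 P = \<lparr>carrier = borel_measurable P // ae_rel P,
           mult = (\<lambda>X Y. ae_class P (\<lambda>w. rep X w * rep Y w)),
           one = ae_class P (\<lambda>w. 1),
           zero = ae_class P (\<lambda>w. 0),
           add = (\<lambda>X Y. ae_class P (\<lambda>w. rep X w + rep Y w)),
           smult = (\<lambda>X Y. ae_class P (\<lambda>w. rep X w * rep Y w))\<rparr>"

definition L0_abs :: "'w measure \<Rightarrow> ('w \<Rightarrow> 'k::real_normed_field) set \<Rightarrow> ('w \<Rightarrow> real) set" where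
  "L0_abs P X = ae_class P (\<lambda>w. norm (rep X w))"

definition L0_of_real :: "'w measure \<Rightarrow> ('w \<Rightarrow> real) set \<Rightarrow> ('w \<Rightarrow> 'k::real_normed_field) set" where
  "L0_of_real P X = ae_class P (\<lambda>w. of_real (rep X w))"

definition L0_ind :: "'w measure \<Rightarrow> 'w set \<Rightarrow> ('w \<Rightarrow> 'k::real_normed_field) set" where
  "L0_ind P A = ae_class P (indicator A)"

definition L0_le :: "'w measure \<Rightarrow> ('w \<Rightarrow> real) set \<Rightarrow> ('w \<Rightarrow> real) set \<Rightarrow> bool" where
  "L0_le P X Y \<longleftrightarrow> (AE w in P. rep X w \<le> rep Y w)"

definition L0_pos :: "'w measure \<Rightarrow> ('w \<Rightarrow> real) set set" where
  "L0_pos P = {X \<in> carrier (L0 P). AE w in P. 0 < rep X w}"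

text \<open>The nonnegative cone as an ordered set. Suprema are taken in it, so that the supremum of the
  empty set is the zero class.\<close>

definition L0_plus :: "'w measure \<Rightarrow> ('w \<Rightarrow> real) set gorder" where
  "L0_plus P = \<lparr>carrier = {X \<in> carrier (L0 P). AE w in P. 0 \<le> rep X w}, eq = (=), le = L0_le P\<rparr>"


section \<open>Random locally convex modules\<close>

definition L0_seminorm ::
    "'w measure \<Rightarrow> (('w \<Rightarrow> 'k::real_normed_field) set, 'e) module \<Rightarrow> ('e \<Rightarrow> ('w \<Rightarrow> real) set) \<Rightarrow> bool" where
  "L0_seminorm P E N \<longleftrightarrow>
     (\<forall>x\<in>carrier E. N x \<in> carrier (L0_plus P)) \<and>
     (\<forall>\<xi>\<in>carrier (L0 P). \<forall>x\<in>carrier E. N (\<xi> \<odot>\<^bsub>E\<^esub> x) = L0_abs P \<xi> \<otimes>\<^bsub>L0 P\<^esub> N x) \<and>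
     (\<forall>x\<in>carrier E. \<forall>y\<in>carrier E. L0_le P (N (x \<oplus>\<^bsub>E\<^esub> y)) (N x \<oplus>\<^bsub>L0 P\<^esub> N y))"

text \<open>The supremum of all seminorms at a point may take the value infinity, so it need not exist in
  the cone. It is zero iff the zero class is the least upper bound in the cone.\<close>

definition random_locally_convex_module ::
    "'w measure \<Rightarrow> (('w \<Rightarrow> 'k::real_normed_field) set, 'e) module \<Rightarrow>
      ('e \<Rightarrow> ('w \<Rightarrow> real) set) set \<Rightarrow> bool" where
  "random_locally_convex_module P E \<N> \<longleftrightarrow>
     Module.module (L0 P) E \<and>
     (\<forall>N\<in>\<N>. L0_seminorm P E N) \<and>
     (\<forall>x\<in>carrier E.
        least (L0_plus P) \<zero>\<^bsub>L0 P\<^esub> (Upper (L0_plus P) {N x | N. N \<in> \<N>}) \<longleftrightarrow> x = \<zero>\<^bsub>E\<^esub>)"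

definition base_nbhd ::
    "'w measure \<Rightarrow> (('w \<Rightarrow> 'k::real_normed_field) set, 'e) module \<Rightarrow>
      ('e \<Rightarrow> ('w \<Rightarrow> real) set) set \<Rightarrow> ('w \<Rightarrow> real) set \<Rightarrow> 'e set" where
  "base_nbhd P E Q \<epsilon> = {x \<in> carrier E. L0_le P (\<Squnion>\<^bsub>L0_plus P\<^esub> {N x | N. N \<in> Q}) \<epsilon>}"

text \<open>The translation invariant topology with the sets above as local base at zero.\<close>

definition locally_L0_convex_topology ::
    "'w measure \<Rightarrow> (('w \<Rightarrow> 'k::real_normed_field) set, 'e) module \<Rightarrow>
      ('e \<Rightarrow> ('w \<Rightarrow> real) set) set \<Rightarrow> 'e topology" where
  "locally_L0_convex_topology P E \<N> = topology (\<lambda>U. U \<subseteq> carrier E \<and>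
     (\<forall>x\<in>U. \<exists>Q \<epsilon>. finite Q \<and> Q \<subseteq> \<N> \<and> \<epsilon> \<in> L0_pos P \<and>
        (\<lambda>y. x \<oplus>\<^bsub>E\<^esub> y) ` base_nbhd P E Q \<epsilon> \<subseteq> U))"

definition nbhd_zero :: "('s, 'e) module \<Rightarrow> 'e topology \<Rightarrow> 'e set \<Rightarrow> bool" where
  "nbhd_zero E T U \<longleftrightarrow> U \<subseteq> topspace T \<and> (\<exists>V. openin T V \<and> \<zero>\<^bsub>E\<^esub> \<in> V \<and> V \<subseteq> U)"


section \<open>Barrels\<close>

definition L0_absorbed ::
    "'w measure \<Rightarrow> (('w \<Rightarrow> 'k::real_normed_field) set, 'e) module \<Rightarrow> 'e set \<Rightarrow> 'e set \<Rightarrow> bool" where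
  "L0_absorbed P E A B \<longleftrightarrow>
     (\<exists>\<xi>\<in>L0_pos P. \<forall>\<eta>\<in>carrier (L0 P). L0_le P (L0_abs P \<eta>) \<xi> \<longrightarrow> (\<lambda>x. \<eta> \<odot>\<^bsub>E\<^esub> x) ` A \<subseteq> B)"

definition L0_absorbent ::
    "'w measure \<Rightarrow> (('w \<Rightarrow> 'k::real_normed_field) set, 'e) module \<Rightarrow> 'e set \<Rightarrow> bool" where
  "L0_absorbent P E B \<longleftrightarrow> (\<forall>x\<in>carrier E. L0_absorbed P E {x} B)"

definition L0_balanced ::
    "'w measure \<Rightarrow> (('w \<Rightarrow> 'k::real_normed_field) set, 'e) module \<Rightarrow> 'e set \<Rightarrow> bool" where
  "L0_balanced P E B \<longleftrightarrow>
     (\<forall>\<eta>\<in>carrier (L0 P). L0_le P (L0_abs P \<eta>) \<one>\<^bsub>L0 P\<^esub> \<longrightarrow> (\<lambda>x. \<eta> \<odot>\<^bsub>E\<^esub> x) ` B \<subseteq> B)"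

definition L0_convex ::
    "'w measure \<Rightarrow> (('w \<Rightarrow> 'k::real_normed_field) set, 'e) module \<Rightarrow> 'e set \<Rightarrow> bool" where
  "L0_convex P E B \<longleftrightarrow>
     (\<forall>x\<in>B. \<forall>y\<in>B. \<forall>\<xi>\<in>carrier (L0_plus P). L0_le P \<xi> \<one>\<^bsub>L0 P\<^esub> \<longrightarrow>
        L0_of_real P \<xi> \<odot>\<^bsub>E\<^esub> x \<oplus>\<^bsub>E\<^esub> L0_of_real P (\<one>\<^bsub>L0 P\<^esub> \<ominus>\<^bsub>L0 P\<^esub> \<xi>) \<odot>\<^bsub>E\<^esub> y \<in> B)"

definition L0_barrel ::
    "'w measure \<Rightarrow> (('w \<Rightarrow> 'k::real_normed_field) set, 'e) module \<Rightarrow> 'e topology \<Rightarrow> 'e set \<Rightarrow> bool" where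
  "L0_barrel P E T B \<longleftrightarrow>
     B \<subseteq> carrier E \<and> L0_balanced P E B \<and> L0_absorbent P E B \<and> L0_convex P E B \<and> closedin T B"

text \<open>Members of the partition may be empty, so finite partitions are covered as well.\<close>

definition countable_concatenation ::
    "'w measure \<Rightarrow> (('w \<Rightarrow> 'k::real_normed_field) set, 'e) module \<Rightarrow> 'e set \<Rightarrow> bool" where
  "countable_concatenation P E G \<longleftrightarrow>
     (\<forall>(x :: nat \<Rightarrow> 'e) A. range x \<subseteq> G \<and> range A \<subseteq> sets P \<and> disjoint_family A \<and> (\<Union>n. A n) = space P \<longrightarrow>
        (\<exists>y\<in>G. \<forall>n. L0_ind P (A n) \<odot>\<^bsub>E\<^esub> y = L0_ind P (A n) \<odot>\<^bsub>E\<^esub> x n))"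

definition L0_pre_barreled ::
    "'w measure \<Rightarrow> (('w \<Rightarrow> 'k::real_normed_field) set, 'e) module \<Rightarrow> 'e topology \<Rightarrow> bool" where
  "L0_pre_barreled P E T \<longleftrightarrow>
     (\<forall>B. L0_barrel P E T B \<and> countable_concatenation P E B \<longrightarrow> nbhd_zero E T B)"


section \<open>The dual module and its topologies\<close>

text \<open>Functionals are made extensional so that equality in the dual is equality on the carrier. The
  record type forces ring fields that a module does not use; they are left unspecified.\<close>

definition dual_module ::
    "'w measure \<Rightarrow> (('w \<Rightarrow> 'k::real_normed_field) set, 'e) module \<Rightarrow>
      ('e \<Rightarrow> ('w \<Rightarrow> real) set) set \<Rightarrow> (('w \<Rightarrow> 'k) set, 'e \<Rightarrow> ('w \<Rightarrow> 'k) set) module" where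
  "dual_module P E \<N> =
     \<lparr>carrier = {g \<in> carrier E \<rightarrow>\<^sub>E carrier (L0 P).
        (\<forall>x\<in>carrier E. \<forall>y\<in>carrier E. g (x \<oplus>\<^bsub>E\<^esub> y) = g x \<oplus>\<^bsub>L0 P\<^esub> g y) \<and>
        (\<forall>\<xi>\<in>carrier (L0 P). \<forall>x\<in>carrier E. g (\<xi> \<odot>\<^bsub>E\<^esub> x) = \<xi> \<otimes>\<^bsub>L0 P\<^esub> g x) \<and>
        continuous_map (locally_L0_convex_topology P E \<N>)
          (locally_L0_convex_topology P (L0 P) {L0_abs P}) g},
      mult = undefined,
      one = undefined,
      zero = (\<lambda>x\<in>carrier E. \<zero>\<^bsub>L0 P\<^esub>),
      add = (\<lambda>g h. \<lambda>x\<in>carrier E. g x \<oplus>\<^bsub>L0 P\<^esub> h x),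
      smult = (\<lambda>\<xi> g. \<lambda>x\<in>carrier E. \<xi> \<otimes>\<^bsub>L0 P\<^esub> g x)\<rparr>"

definition weak_star_topology ::
    "'w measure \<Rightarrow> (('w \<Rightarrow> 'k::real_normed_field) set, 'e) module \<Rightarrow>
      ('e \<Rightarrow> ('w \<Rightarrow> real) set) set \<Rightarrow> ('e \<Rightarrow> ('w \<Rightarrow> 'k) set) topology" where
  "weak_star_topology P E \<N> =
     locally_L0_convex_topology P (dual_module P E \<N>) {\<lambda>g. L0_abs P (g x) | x. x \<in> carrier E}"

definition L0_bounded ::
    "'w measure \<Rightarrow> (('w \<Rightarrow> 'k::real_normed_field) set, 'e) module \<Rightarrow> 'e topology \<Rightarrow> 'e set \<Rightarrow> bool" where
  "L0_bounded P E T A \<longleftrightarrow> A \<subseteq> carrier E \<and> (\<forall>U. nbhd_zero E T U \<longrightarrow> L0_absorbed P E A U)"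

definition strong_topology ::
    "'w measure \<Rightarrow> (('w \<Rightarrow> 'k::real_normed_field) set, 'e) module \<Rightarrow>
      ('e \<Rightarrow> ('w \<Rightarrow> real) set) set \<Rightarrow> 'e topology" where
  "strong_topology P E \<N> = locally_L0_convex_topology P E
     {\<lambda>x. \<Squnion>\<^bsub>L0_plus P\<^esub> {L0_abs P (g x) | g. g \<in> A} | A.
        L0_bounded P (dual_module P E \<N>) (weak_star_topology P E \<N>) A}"

end

theory Submission
  imports Defs
begin

text \<open>
  Both implications rest on the bipolar theorem and the Hahn--Banach theorem for random modules, where
  scalars and inequalities are those of random variables up to null sets.

  Pre-barreled modules carry the strong topology: for a pointwise bounded set \<open>A\<close> of functionals,
  \<open>{y. |g y| \<le> e for all g in A}\<close> is a barrel with the countable concatenation property, hence a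
  neighborhood of zero. Conversely each seminorm is, by Hahn--Banach, the supremum of the functionals that
  it dominates.

  If the topology is the strong one, a barrel \<open>B\<close> contains the strong neighborhood
  \<open>{y. |g y| \<le> 1 for all g in B\<degree>}\<close>, provided that \<open>B\<degree>\<degree> \<subseteq> B\<close>. For a point \<open>x\<close> outside
  \<open>B\<close> take a seminorm \<open>n\<close> with \<open>n (x - b) \<le> 2\<close> for no \<open>b\<close> in \<open>B\<close>, and the seminorm
  \<open>p x = ess inf {l + n (x - l b) | l \<ge> 0, b \<in> B}\<close>. It is at most \<open>1\<close> on \<open>B\<close> and at most \<open>n\<close>
  everywhere, so a functional \<open>g\<close> dominated by \<open>p\<close> with \<open>|g x| = p x\<close> is continuous and lies in the
  polar of \<open>B\<close>. By countable concatenation the infimum is almost attained by a single pair \<open>(l, b)\<close>;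
  therefore \<open>p x \<le> 1\<close> would produce a \<open>b\<close> with \<open>n (x - b) \<le> 2\<close>.
\<close>

section \<open>Random variables modulo almost sure equality\<close>

text \<open>A barrel may have no interior known in advance, so a functional dominated by its own
  Minkowski gauge need not be continuous. The term \<open>n (x - l b)\<close> in the infimum repairs
  this by forcing \<open>p \<le> n\<close>. The obstacle is that the order on random variables is
  partial. That \<open>n (x - b) \<le> 2\<close> fails means failure on a set of positive measure
  which varies with \<open>b\<close>, whereas \<open>p x \<le> 1\<close> only speaks of near
  minimizers that vary with the sample point. A contradiction needs one \<open>b\<close> that works
  almost everywhere at once; it is glued from countably many near minimizers along a measurable
  partition, and this is where concatenation in \<open>B\<close> enters. Concatenation in
  \<open>E\<close> serves the opposite implication, where it passes to polars. The bound
  \<open>2\<close> is \<open>1 + 1\<close>. From \<open>p x \<le> 1\<close> one gets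
  \<open>l \<le> 1 + d\<close> and \<open>n (x - l b) \<le> 1 + d\<close> with a small random
  \<open>d\<close>. Shrinking by \<open>1 / (1 + d)\<close> brings the coefficient down to at most
  one and the seminorm to at most \<open>1\<close>, but adds an error of at most
  \<open>d * n x\<close>, which is again at most \<open>1\<close> when \<open>d\<close> is chosen
  against \<open>n x\<close>.\<close>

lemma equiv_ae_rel: "equiv (borel_measurable P) (ae_rel P)"
  unfolding equiv_def refl_on_def sym_def trans_def ae_rel_def
  by (auto elim: eventually_mono eventually_elim2)

lemma carrier_L0: "carrier (L0 P) = borel_measurable P // ae_rel P"
  by (simp add: L0_def)

lemma ae_class_closed [simp, intro]:
  "f \<in> borel_measurable P \<Longrightarrow> ae_class P f \<in> carrier (L0 P)"
  by (simp add: carrier_L0 ae_class_def quotientI)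

lemma rep_mem: "X \<in> carrier (L0 P) \<Longrightarrow> rep X \<in> X"
  unfolding rep_def carrier_L0
  by (metis equiv_Eps_in equiv_ae_rel)

lemma rep_measurable [intro]:
  "X \<in> carrier (L0 P) \<Longrightarrow> rep X \<in> borel_measurable P"
  using rep_mem in_quotient_imp_subset[OF equiv_ae_rel] unfolding carrier_L0 by blast

lemma ae_class_eq_iff:
  assumes "f \<in> borel_measurable P" "g \<in> borel_measurable P"
  shows "ae_class P f = ae_class P g \<longleftrightarrow> (AE w in P. f w = g w)"
  using assms unfolding ae_class_def eq_equiv_class_iff[OF equiv_ae_rel assms]
  by (simp add: ae_rel_def)

lemma ae_class_eqI:
  "f \<in> borel_measurable P \<Longrightarrow> g \<in> borel_measurable P \<Longrightarrow> AE w in P. f w = g w \<Longrightarrow>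
   ae_class P f = ae_class P g"
  by (simp add: ae_class_eq_iff)

lemma ae_class_rep [simp]: "X \<in> carrier (L0 P) \<Longrightarrow> ae_class P (rep X) = X"
proof -
  assume X: "X \<in> carrier (L0 P)"
  then obtain f where "X = ae_rel P `` {f}" unfolding carrier_L0 by (blast elim: quotientE)
  moreover from this have "(f, rep X) \<in> ae_rel P" using rep_mem[OF X] by simp
  ultimately show ?thesis
    unfolding ae_class_def using equiv_class_eq[OF equiv_ae_rel] by metis
qed

lemma rep_ae_class:
  fixes f :: "'w \<Rightarrow> 'k::real_normed_field"
  shows "f \<in> borel_measurable P \<Longrightarrow> AE w in P. rep (ae_class P f) w = f w"
  using ae_class_eq_iff[OF rep_measurable[OF ae_class_closed], of f P f]
    ae_class_rep[OF ae_class_closed, of f P] by simp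

lemma L0_eqI:
  "X \<in> carrier (L0 P) \<Longrightarrow> Y \<in> carrier (L0 P) \<Longrightarrow> AE w in P. rep X w = rep Y w \<Longrightarrow> X = Y"
  using ae_class_eq_iff[OF rep_measurable rep_measurable, of X P Y] by simp

section \<open>Arithmetic of classes through representatives\<close>

context
  fixes P :: "'w measure"
    and f g :: "'w \<Rightarrow> 'k::{real_normed_field, second_countable_topology}"
  assumes fg [measurable]: "f \<in> borel_measurable P" "g \<in> borel_measurable P"
begin

lemma ae_class_add: "ae_class P f \<oplus>\<^bsub>L0 P\<^esub> ae_class P g = ae_class P (\<lambda>w. f w + g w)"
proof -
  have [measurable]: "rep (ae_class P f) \<in> borel_measurable P" "rep (ae_class P g) \<in> borel_measurable P"
    using fg by auto
  have "AE w in P. rep (ae_class P f) w + rep (ae_class P g) w = f w + g w"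
    using rep_ae_class[OF fg(1)] rep_ae_class[OF fg(2)] by eventually_elim simp
  then show ?thesis by (simp add: L0_def ae_class_eq_iff)
qed

lemma ae_class_mult: "ae_class P f \<otimes>\<^bsub>L0 P\<^esub> ae_class P g = ae_class P (\<lambda>w. f w * g w)"
proof -
  have [measurable]: "rep (ae_class P f) \<in> borel_measurable P" "rep (ae_class P g) \<in> borel_measurable P"
    using fg by auto
  have "AE w in P. rep (ae_class P f) w * rep (ae_class P g) w = f w * g w"
    using rep_ae_class[OF fg(1)] rep_ae_class[OF fg(2)] by eventually_elim simp
  then show ?thesis by (simp add: L0_def ae_class_eq_iff)
qed

end

lemma ae_class_abs:
  fixes f :: "'w \<Rightarrow> 'k::{real_normed_field, second_countable_topology}"
  assumes f [measurable]: "f \<in> borel_measurable P"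
  shows "L0_abs P (ae_class P f) = ae_class P (\<lambda>w. norm (f w))"
proof -
  have [measurable]: "rep (ae_class P f) \<in> borel_measurable P"
    using f by auto
  have "AE w in P. norm (rep (ae_class P f) w) = norm (f w)"
    using rep_ae_class[OF f] by eventually_elim simp
  then show ?thesis by (simp add: L0_abs_def ae_class_eq_iff)
qed

lemma ae_class_of_real:
  assumes [measurable]: "f \<in> borel_measurable P"
  shows "L0_of_real P (ae_class P f) = ae_class P (\<lambda>w. of_real (f w))"
proof -
  have [measurable]: "rep (ae_class P f) \<in> borel_measurable P"
    using assms by auto
  have "AE w in P. of_real (rep (ae_class P f) w) = of_real (f w)"
    using rep_ae_class[OF assms] by eventually_elim simp
  then show ?thesis by (simp add: L0_of_real_def ae_class_eq_iff)
qed

lemma one_L0: "\<one>\<^bsub>L0 P\<^esub> = ae_class P (\<lambda>w. 1)"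
  and zero_L0: "\<zero>\<^bsub>L0 P\<^esub> = ae_class P (\<lambda>w. 0)"
  by (simp_all add: L0_def)

lemma L0_obtain:
  assumes "X \<in> carrier (L0 P)"
  obtains f where "f \<in> borel_measurable P" "X = ae_class P f"
  using that[OF rep_measurable[OF assms]] ae_class_rep[OF assms] by simp

text \<open>The module hypothesis gives ring laws only for the scalars of \<open>E\<close>.
  Differences of real classes, as in the definition of convexity, and the topology of the scalars
  rest on the additive group established here for general value types.\<close>

lemma abelian_group_L0:
  "abelian_group (L0 P :: (('w \<Rightarrow> 'k::{real_normed_field, second_countable_topology}) set, _) module)"
proof (rule abelian_groupI)
  fix X Y Z :: "('w \<Rightarrow> 'k) set" assume "X \<in> carrier (L0 P)" "Y \<in> carrier (L0 P)" "Z \<in> carrier (L0 P)"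
  then obtain f g h where [measurable]: "f \<in> borel_measurable P" "g \<in> borel_measurable P"
      "h \<in> borel_measurable P" and eq: "X = ae_class P f" "Y = ae_class P g" "Z = ae_class P h"
    by (metis L0_obtain)
  show "X \<oplus>\<^bsub>L0 P\<^esub> Y \<in> carrier (L0 P)" "X \<oplus>\<^bsub>L0 P\<^esub> Y = Y \<oplus>\<^bsub>L0 P\<^esub> X"
    "X \<oplus>\<^bsub>L0 P\<^esub> Y \<oplus>\<^bsub>L0 P\<^esub> Z = X \<oplus>\<^bsub>L0 P\<^esub> (Y \<oplus>\<^bsub>L0 P\<^esub> Z)"
    by (simp_all add: eq ae_class_add algebra_simps)
next
  fix X :: "('w \<Rightarrow> 'k) set" assume "X \<in> carrier (L0 P)"
  then obtain f where [measurable]: "f \<in> borel_measurable P" and eq: "X = ae_class P f"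
    by (metis L0_obtain)
  show "\<zero>\<^bsub>L0 P\<^esub> \<oplus>\<^bsub>L0 P\<^esub> X = X"
    by (simp add: eq ae_class_add zero_L0)
  show "\<exists>Y\<in>carrier (L0 P). Y \<oplus>\<^bsub>L0 P\<^esub> X = \<zero>\<^bsub>L0 P\<^esub>"
    by (rule bexI[of _ "ae_class P (\<lambda>w. - f w)"]) (simp_all add: eq ae_class_add zero_L0)
qed (simp add: zero_L0)

lemma ae_class_minus:
  fixes f g :: "'w \<Rightarrow> 'k::{real_normed_field, second_countable_topology}"
  assumes [measurable]: "f \<in> borel_measurable P" "g \<in> borel_measurable P"
  shows "ae_class P f \<ominus>\<^bsub>L0 P\<^esub> ae_class P g = ae_class P (\<lambda>w. f w - g w)"
proof -
  interpret G: abelian_group "L0 P :: (('w \<Rightarrow> 'k) set, _) module" by (rule abelian_group_L0)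
  have "\<ominus>\<^bsub>L0 P\<^esub> ae_class P g = ae_class P (\<lambda>w. - g w)"
    by (rule G.minus_equality) (simp_all add: ae_class_add zero_L0)
  then show ?thesis
    by (simp add: a_minus_def ae_class_add)
qed

section \<open>Order and positivity of real classes\<close>

lemma L0_le_class:
  assumes "f \<in> borel_measurable P" "g \<in> borel_measurable P"
  shows "L0_le P (ae_class P f) (ae_class P g) \<longleftrightarrow> (AE w in P. f w \<le> g w)"
  unfolding L0_le_def using rep_ae_class[OF assms(1)] rep_ae_class[OF assms(2)]
  by (intro eventually_subst, eventually_elim) simp

lemma L0_pos_class:
  assumes "f \<in> borel_measurable P"
  shows "ae_class P f \<in> L0_pos P \<longleftrightarrow> (AE w in P. 0 < f w)"
proof -
  have "(AE w in P. 0 < rep (ae_class P f) w) \<longleftrightarrow> (AE w in P. 0 < f w)"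
    using rep_ae_class[OF assms] by (intro eventually_subst, eventually_elim) simp
  then show ?thesis using assms by (simp add: L0_pos_def)
qed

text \<open>Redefining a representative as \<open>1\<close> on the null set where it fails to be
  positive makes it positive everywhere, so that later one can divide by radii without exceptional
  sets.\<close>

lemma L0_pos_obtain:
  assumes "X \<in> L0_pos P"
  obtains f where "f \<in> borel_measurable P" "\<And>w. 0 < f w" "X = ae_class P f"
proof -
  have X: "X \<in> carrier (L0 P)" "AE w in P. 0 < rep X w"
    using assms by (auto simp: L0_pos_def)
  have [measurable]: "rep X \<in> borel_measurable P" using X by auto
  define f where "f = (\<lambda>w. if 0 < rep X w then rep X w else 1)"
  have f: "f \<in> borel_measurable P" unfolding f_def by measurable
  have "ae_class P (rep X) = ae_class P f"
    by (rule ae_class_eqI) (use X f in \<open>auto simp: f_def\<close>)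
  then have "X = ae_class P f" unfolding ae_class_rep[OF X(1)] .
  moreover have "0 < f w" for w by (simp add: f_def)
  ultimately show thesis using f that by blast
qed

lemma carrier_L0_plus:
  "X \<in> carrier (L0_plus P) \<longleftrightarrow> X \<in> carrier (L0 P) \<and> (AE w in P. 0 \<le> rep X w)"
  by (simp add: L0_plus_def)

lemma L0_plus_class:
  assumes "f \<in> borel_measurable P"
  shows "ae_class P f \<in> carrier (L0_plus P) \<longleftrightarrow> (AE w in P. 0 \<le> f w)"
proof -
  have "(AE w in P. 0 \<le> rep (ae_class P f) w) \<longleftrightarrow> (AE w in P. 0 \<le> f w)"
    using rep_ae_class[OF assms] by (intro eventually_subst, eventually_elim) simp
  then show ?thesis using assms by (simp add: carrier_L0_plus)
qed

lemma L0_pos_plus: "X \<in> L0_pos P \<Longrightarrow> X \<in> carrier (L0_plus P)"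
  unfolding L0_pos_def carrier_L0_plus by (auto elim: eventually_mono)

lemma L0_le_trans: "L0_le P X Y \<Longrightarrow> L0_le P Y Z \<Longrightarrow> L0_le P X Z"
  unfolding L0_le_def by (auto elim: eventually_elim2)

lemma L0_abs_closed:
  fixes X :: "('w \<Rightarrow> 'k::{real_normed_field, second_countable_topology}) set"
  assumes "X \<in> carrier (L0 P)"
  shows "L0_abs P X \<in> carrier (L0_plus P)"
proof -
  obtain f where [measurable]: "f \<in> borel_measurable P" and eq: "X = ae_class P f"
    using assms by (metis L0_obtain)
  show ?thesis by (simp add: eq ae_class_abs L0_plus_class)
qed


section \<open>Essential infima\<close>

text \<open>The sequence minimises the integral of the infimum of \<open>arctan \<circ> s n\<close>; the arctangent only
  serves to make everything integrable.\<close>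
lemma (in finite_measure) essinf_sequence:
  fixes F :: "('a \<Rightarrow> real) set"
  assumes F: "F \<subseteq> borel_measurable M" "F \<noteq> {}"
  shows "\<exists>s :: nat \<Rightarrow> 'a \<Rightarrow> real. range s \<subseteq> F \<and> (\<forall>f\<in>F. AE w in M. \<forall>e>0. \<exists>n. s n w < f w + e)"
proof -
  define J where "J s w = (INF n. arctan (s n w))" for s :: "nat \<Rightarrow> 'a \<Rightarrow> real" and w
  define I where "I s = integral\<^sup>L M (J s)" for s
  define S where "S = {s :: nat \<Rightarrow> 'a \<Rightarrow> real. range s \<subseteq> F}"
  have bdd: "bdd_below (range (\<lambda>n. arctan (s n w)))" for s :: "nat \<Rightarrow> 'a \<Rightarrow> real" and w
    using arctan_lbound by (intro bdd_belowI2[of _ "-(pi/2)"]) (auto intro: less_imp_le)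
  have J_le: "J s w \<le> arctan (s n w)" for s w n
    unfolding J_def by (rule cINF_lower[OF bdd]) simp
  have J_ge: "c \<le> J s w" if "\<And>n. c \<le> arctan (s n w)" for s w c
    unfolding J_def using that by (intro cINF_greatest) auto
  have J_meas [measurable]: "J s \<in> borel_measurable M" if "s \<in> S" for s
  proof -
    have [measurable]: "s n \<in> borel_measurable M" for n using that F by (auto simp: S_def)
    show ?thesis unfolding J_def using bdd by measurable
  qed
  have J_bound: "\<bar>J s w\<bar> \<le> pi/2" for s w
  proof -
    have "-(pi/2) \<le> J s w" by (rule J_ge) (use arctan_lbound in \<open>auto intro: less_imp_le\<close>)
    moreover have "J s w \<le> pi/2" using J_le[of s w 0] arctan_ubound[of "s 0 w"] by linarith
    ultimately show ?thesis by linarith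
  qed
  have J_int: "integrable M (J s)" if "s \<in> S" for s
    by (rule integrable_const_bound[of _ "pi/2"]) (use J_bound that in auto)
  have S_ne: "S \<noteq> {}"
  proof -
    obtain f where "f \<in> F" using F by auto
    then have "(\<lambda>_. f) \<in> S" by (auto simp: S_def)
    then show ?thesis by auto
  qed
  define m where "m = Inf (I ` S)"
  have I_bdd: "bdd_below (I ` S)"
  proof (rule bdd_belowI2)
    fix s assume "s \<in> S"
    have "integral\<^sup>L M (\<lambda>_. -(pi/2)) \<le> I s"
      unfolding I_def
    proof (rule integral_mono)
      show "- (pi / 2) \<le> J s w" for w using J_bound[of s w] by linarith
    qed (use J_int \<open>s \<in> S\<close> in auto)
    then show "integral\<^sup>L M (\<lambda>_. -(pi/2)) \<le> I s" .
  qed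
  have m_le: "m \<le> I s" if "s \<in> S" for s
    unfolding m_def using that I_bdd by (intro cINF_lower)
  have "\<exists>s\<in>S. I s < m + 1 / Suc k" for k
  proof -
    have "Inf (I ` S) < m + 1 / Suc k" by (simp add: m_def)
    then show ?thesis using cINF_less_iff[OF S_ne I_bdd] by blast
  qed
  then obtain t where t: "\<And>k. t k \<in> S" "\<And>k. I (t k) < m + 1 / Suc k" by metis
  \<comment> \<open>One sequence enumerates the terms of all the minimizing sequences
    \<open>t k\<close>, so its infimum lies below each of theirs and its integral equals
    \<open>m\<close>.\<close>
  define s where "s i = t (fst (prod_decode i)) (snd (prod_decode i))" for i
  have sS: "s \<in> S" using t(1) unfolding s_def S_def by auto
  have "I s \<le> I (t k)" for k
    unfolding I_def
  proof (rule integral_mono)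
    fix w
    show "J s w \<le> J (t k) w"
    proof (rule J_ge)
      fix n show "J s w \<le> arctan (t k n w)"
        using J_le[of s w "prod_encode (k, n)"] by (simp add: s_def)
    qed
  qed (use J_int sS t in auto)
  then have Is_lt: "I s < m + 1 / Suc k" for k
    using t(2)[of k] by (rule le_less_trans)
  have Is: "I s \<le> m"
  proof (rule field_le_epsilon)
    fix e :: real assume "0 < e"
    then obtain k where "1 / Suc k < e" using nat_approx_posE by blast
    then show "I s \<le> m + e" using Is_lt[of k] by linarith
  qed
  have "AE w in M. \<forall>e>0. \<exists>n. s n w < f w + e" if f: "f \<in> F" for f
  proof -
    \<comment> \<open>Putting \<open>f\<close> in front can only lower \<open>J s\<close>, but the
      integral is already minimal. Hence the two infima agree almost surely, which forces
      \<open>J s w \<le> arctan (f w)\<close>.\<close>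
    define s' where "s' = case_nat f s"
    have s'S: "s' \<in> S" using f sS unfolding S_def s'_def by (auto split: nat.splits dest: range_subsetD)
    have le: "J s' w \<le> J s w" for w
    proof (rule J_ge)
      fix n show "J s' w \<le> arctan (s n w)" using J_le[of s' w "Suc n"] by (simp add: s'_def)
    qed
    have "AE w in M. 0 = J s w - J s' w"
    proof -
      have i: "integrable M (\<lambda>w. J s w - J s' w)" using J_int sS s'S by auto
      have "integral\<^sup>L M (\<lambda>w. J s w - J s' w) = I s - I s'"
        unfolding I_def using J_int sS s'S by simp
      moreover have "0 \<le> integral\<^sup>L M (\<lambda>w. J s w - J s' w)"
        by (rule integral_nonneg_AE) (use le in auto)
      ultimately have "integral\<^sup>L M (\<lambda>w. J s w - J s' w) = 0"
        using Is m_le[OF s'S] by linarith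
      then have "AE w in M. J s w - J s' w = 0"
        using integral_nonneg_eq_0_iff_AE[OF i] le by simp
      then show ?thesis by eventually_elim simp
    qed
    then show ?thesis
    proof eventually_elim
      case (elim w)
      show "\<forall>e>0. \<exists>n. s n w < f w + e"
      proof (intro allI impI)
        fix e :: real assume "0 < e"
        then have "arctan (f w) < arctan (f w + e)" by (simp add: arctan_less_iff)
        moreover have "J s w \<le> arctan (f w)" using elim J_le[of s' w 0] by (simp add: s'_def)
        ultimately have "(INF n. arctan (s n w)) < arctan (f w + e)" unfolding J_def by linarith
        then obtain n where "arctan (s n w) < arctan (f w + e)"
          using cINF_less_iff[OF _ bdd] by blast
        then show "\<exists>n. s n w < f w + e" by (auto simp: arctan_less_iff)
      qed
    qed
  qed
  with sS show ?thesis by (auto simp: S_def)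
qed

lemma (in finite_measure) essinf_exists:
  fixes F :: "('a \<Rightarrow> real) set"
  assumes F: "F \<subseteq> borel_measurable M" "F \<noteq> {}"
    and h: "h \<in> borel_measurable M" "\<And>f. f \<in> F \<Longrightarrow> AE w in M. h w \<le> f w"
  shows "\<exists>q s. q \<in> borel_measurable M \<and> (\<forall>f\<in>F. AE w in M. q w \<le> f w) \<and>
    range s \<subseteq> F \<and> (AE w in M. \<forall>e>0. \<exists>n::nat. s n w < q w + e)"
proof -
  obtain s :: "nat \<Rightarrow> 'a \<Rightarrow> real" where s: "range s \<subseteq> F"
      and sf: "\<And>f. f \<in> F \<Longrightarrow> AE w in M. \<forall>e>0. \<exists>n. s n w < f w + e"
    using essinf_sequence[OF F] by blast
  have sn: "s n \<in> F" for n using s by auto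
  have [measurable]: "s n \<in> borel_measurable M" for n using sn F by auto
  note h(1)[measurable]
  \<comment> \<open>The maximum with \<open>h\<close> changes the terms only on a null set and
    bounds them below at every point, so that the infimum is meaningful everywhere.\<close>
  define q where "q w = (INF n. max (s n w) (h w))" for w
  have bdd: "bdd_below (range (\<lambda>n. max (s n w) (h w)))" for w
    by (rule bdd_belowI2[of _ "h w"]) simp
  have q: "q \<in> borel_measurable M" unfolding q_def using bdd by measurable
  have ae: "AE w in M. \<forall>n. h w \<le> s n w"
    using h(2)[OF sn] by (simp add: AE_all_countable)
  have ql: "AE w in M. q w \<le> f w" if "f \<in> F" for f
    using ae sf[OF that]
  proof eventually_elim
    case (elim w)
    show ?case
    proof (rule field_le_epsilon)
      fix e :: real assume "0 < e"
      then obtain n where "s n w < f w + e" using elim by blast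
      moreover have "q w \<le> max (s n w) (h w)" unfolding q_def by (rule cINF_lower[OF bdd]) simp
      ultimately show "q w \<le> f w + e" using elim(1)[rule_format, of n] by (simp add: max_def)
    qed
  qed
  have "AE w in M. \<forall>e>0. \<exists>n. s n w < q w + e"
    using ae
  proof eventually_elim
    case (elim w)
    show ?case
    proof (intro allI impI)
      fix e :: real assume "0 < e"
      then have "(INF n. max (s n w) (h w)) < q w + e" by (simp add: q_def)
      then obtain n where "max (s n w) (h w) < q w + e"
        using cINF_less_iff[OF _ bdd] by blast
      then show "\<exists>n. s n w < q w + e" by auto
    qed
  qed
  with q ql s show ?thesis by (intro exI[of _ q] exI[of _ s]) blast
qed

text \<open>The values of \<open>s\<close> come arbitrarily close to \<open>q\<close> from above, so
  a lower bound of the countably many \<open>s n\<close> is a lower bound of \<open>q\<close>, at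
  the cost of a single null set.\<close>

lemma (in finite_measure) essinf_greatest:
  assumes "AE w in M. \<forall>e>0. \<exists>n::nat. s n w < (q w :: real) + e" "\<And>n. AE w in M. h w \<le> s n w"
  shows "AE w in M. h w \<le> q w"
proof -
  have "AE w in M. \<forall>n. h w \<le> s n w" using assms(2) by (simp add: AE_all_countable)
  with assms(1) show ?thesis
  proof eventually_elim
    case (elim w)
    show ?case
      by (rule field_le_epsilon) (metis elim less_imp_le order_trans)
  qed
qed

text \<open>The zero function in the family \<open>F\<close> below makes the construction cover the empty set \<open>S\<close>.\<close>
lemma (in finite_measure) L0_plus_least:
  assumes S: "S \<subseteq> carrier (L0_plus M)"
    and U: "U \<in> carrier (L0_plus M)" "\<And>X. X \<in> S \<Longrightarrow> L0_le M X U"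
  obtains Y where "least (L0_plus M) Y (Upper (L0_plus M) S)"
proof -
  define F where "F = (\<lambda>X w. - rep X w) ` S \<union> {\<lambda>w. 0}"
  have [measurable]: "rep X \<in> borel_measurable M" if "X \<in> S" for X
    using S that carrier_L0_plus rep_measurable by blast
  have [measurable]: "rep U \<in> borel_measurable M" using U carrier_L0_plus rep_measurable by blast
  have F: "F \<subseteq> borel_measurable M" "F \<noteq> {}" by (auto simp: F_def)
  have lower: "AE w in M. - rep U w \<le> f w" if "f \<in> F" for f
  proof -
    have "AE w in M. - rep U w \<le> - rep X w" if "X \<in> S" for X
      using U(2)[OF that] unfolding L0_le_def by simp
    moreover have "AE w in M. - rep U w \<le> 0" using U(1) by (simp add: carrier_L0_plus)
    ultimately show ?thesis using that unfolding F_def by blast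
  qed
  have hm: "(\<lambda>w. - rep U w) \<in> borel_measurable M" by measurable
  obtain q s where q [measurable]: "q \<in> borel_measurable M" and qF: "\<And>f. f \<in> F \<Longrightarrow> AE w in M. q w \<le> f w"
      and s: "range s \<subseteq> F" "AE w in M. \<forall>e>0. \<exists>n::nat. s n w < q w + e"
    using essinf_exists[OF F hm lower] by blast
  define Y where "Y = ae_class M (\<lambda>w. - q w)"
  have rY: "AE w in M. rep Y w = - q w" unfolding Y_def by (rule rep_ae_class) simp
  have Y: "Y \<in> carrier (L0_plus M)"
    unfolding Y_def by (subst L0_plus_class) (use qF[of "\<lambda>w. 0"] in \<open>auto simp: F_def\<close>)
  show thesis
  proof (rule that, rule least_UpperI)
    fix X assume X: "X \<in> S"
    then have "AE w in M. q w \<le> - rep X w" by (intro qF) (auto simp: F_def)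
    then have "AE w in M. rep X w \<le> rep Y w" using rY by eventually_elim simp
    then show "X \<sqsubseteq>\<^bsub>L0_plus M\<^esub> Y" by (simp add: L0_plus_def L0_le_def)
  next
    fix Z assume Z: "Z \<in> Upper (L0_plus M) S"
    then have Zc: "AE w in M. 0 \<le> rep Z w" and ZX: "\<And>X. X \<in> S \<Longrightarrow> AE w in M. rep X w \<le> rep Z w"
      using S by (auto simp: Upper_def L0_plus_def L0_le_def)
    have "AE w in M. - rep Z w \<le> f w" if "f \<in> F" for f
    proof -
      have "AE w in M. - rep Z w \<le> - rep X w" if "X \<in> S" for X using ZX[OF that] by simp
      moreover have "AE w in M. - rep Z w \<le> 0" using Zc by simp
      ultimately show ?thesis using that unfolding F_def by blast
    qed
    then have "AE w in M. - rep Z w \<le> s n w" for n using range_subsetD[OF s(1), of n] by blast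
    then have "AE w in M. - rep Z w \<le> q w" by (rule essinf_greatest[OF s(2)])
    then have "AE w in M. rep Y w \<le> rep Z w" using rY by eventually_elim simp
    then show "Y \<sqsubseteq>\<^bsub>L0_plus M\<^esub> Z" by (simp add: L0_plus_def L0_le_def)
  qed (use S Y in auto)
qed

text \<open>The supremum operator is a mere choice of a least upper bound and says something only
  when one exists. The bound \<open>U\<close> inside the cone secures this.\<close>

lemma (in finite_measure) L0_plus_sup:
  assumes S: "S \<subseteq> carrier (L0_plus M)"
    and U: "U \<in> carrier (L0_plus M)" "\<And>X. X \<in> S \<Longrightarrow> L0_le M X U"
  shows "\<Squnion>\<^bsub>L0_plus M\<^esub> S \<in> carrier (L0_plus M)"
    and "Z \<in> carrier (L0_plus M) \<Longrightarrow> L0_le M (\<Squnion>\<^bsub>L0_plus M\<^esub> S) Z \<longleftrightarrow> (\<forall>X\<in>S. L0_le M X Z)"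
proof -
  have least: "least (L0_plus M) (\<Squnion>\<^bsub>L0_plus M\<^esub> S) (Upper (L0_plus M) S)"
    unfolding sup_def using L0_plus_least[OF assms] by (metis someI)
  then show "\<Squnion>\<^bsub>L0_plus M\<^esub> S \<in> carrier (L0_plus M)"
    by (rule least_closed)
  have le: "x \<sqsubseteq>\<^bsub>L0_plus M\<^esub> y \<longleftrightarrow> L0_le M x y" for x y by (simp add: L0_plus_def)
  show "L0_le M (\<Squnion>\<^bsub>L0_plus M\<^esub> S) Z \<longleftrightarrow> (\<forall>X\<in>S. L0_le M X Z)" if Z: "Z \<in> carrier (L0_plus M)"
  proof
    assume "L0_le M (\<Squnion>\<^bsub>L0_plus M\<^esub> S) Z"
    moreover have "L0_le M X (\<Squnion>\<^bsub>L0_plus M\<^esub> S)" if "X \<in> S" for X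
      using least S that unfolding least_def Upper_def le by blast
    ultimately show "\<forall>X\<in>S. L0_le M X Z" by (metis L0_le_trans)
  next
    assume "\<forall>X\<in>S. L0_le M X Z"
    then have "Z \<in> Upper (L0_plus M) S" using Z by (auto simp: Upper_def le)
    then show "L0_le M (\<Squnion>\<^bsub>L0_plus M\<^esub> S) Z"
      using least unfolding least_def le by blast
  qed
qed


section \<open>Locally L0-convex topologies\<close>

lemma L0_pos_min:
  assumes "X \<in> L0_pos P" "Y \<in> L0_pos P"
  obtains Z where "Z \<in> L0_pos P" "L0_le P Z X" "L0_le P Z Y"
proof -
  obtain f where f [measurable]: "f \<in> borel_measurable P" and f': "\<And>w. 0 < f w" "X = ae_class P f"
    using L0_pos_obtain[OF assms(1)] by blast
  obtain g where g [measurable]: "g \<in> borel_measurable P" and g': "\<And>w. 0 < g w" "Y = ae_class P g"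
    using L0_pos_obtain[OF assms(2)] by blast
  show thesis
    by (rule that[of "ae_class P (\<lambda>w. min (f w) (g w))"])
      (simp_all add: L0_pos_class L0_le_class f' g')
qed

text \<open>Intersections are handled by the union of the two finite families and a common smaller
  radius. Monotonicity of the base sets is a premise because it depends on the suprema behind them
  being genuine, which is established later for seminorms with values in the cone.\<close>

lemma istopology_base_nbhd:
  "istopology (\<lambda>U. U \<subseteq> carrier E \<and>
     (\<forall>x\<in>U. \<exists>Q \<epsilon>. finite Q \<and> Q \<subseteq> \<N> \<and> \<epsilon> \<in> L0_pos P \<and> (\<lambda>y. x \<oplus>\<^bsub>E\<^esub> y) ` base_nbhd P E Q \<epsilon> \<subseteq> U))"
  if mono: "\<And>Q Q' \<epsilon> \<epsilon>'. finite Q' \<Longrightarrow> Q \<subseteq> Q' \<Longrightarrow> Q' \<subseteq> \<N> \<Longrightarrow> \<epsilon> \<in> L0_pos P \<Longrightarrow> \<epsilon>' \<in> L0_pos P \<Longrightarrow>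
    L0_le P \<epsilon>' \<epsilon> \<Longrightarrow> base_nbhd P E Q' \<epsilon>' \<subseteq> base_nbhd P E Q \<epsilon>"
  unfolding istopology_def
proof (intro conjI allI impI, goal_cases)
  case (1 U V)
  then show ?case by blast
next
  case (2 U V)
  show ?case
  proof
    fix x assume "x \<in> U \<inter> V"
    then obtain Q1 \<epsilon>1 Q2 \<epsilon>2 where
      1: "finite Q1" "Q1 \<subseteq> \<N>" "\<epsilon>1 \<in> L0_pos P" "(\<lambda>y. x \<oplus>\<^bsub>E\<^esub> y) ` base_nbhd P E Q1 \<epsilon>1 \<subseteq> U" and
      2: "finite Q2" "Q2 \<subseteq> \<N>" "\<epsilon>2 \<in> L0_pos P" "(\<lambda>y. x \<oplus>\<^bsub>E\<^esub> y) ` base_nbhd P E Q2 \<epsilon>2 \<subseteq> V"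
      using 2 by (meson IntE)
    obtain \<epsilon> where \<epsilon>: "\<epsilon> \<in> L0_pos P" "L0_le P \<epsilon> \<epsilon>1" "L0_le P \<epsilon> \<epsilon>2"
      using L0_pos_min[OF 1(3) 2(3)] by blast
    have "base_nbhd P E (Q1 \<union> Q2) \<epsilon> \<subseteq> base_nbhd P E Q1 \<epsilon>1 \<inter> base_nbhd P E Q2 \<epsilon>2"
      using mono[of "Q1 \<union> Q2" Q1 \<epsilon>1 \<epsilon>] mono[of "Q1 \<union> Q2" Q2 \<epsilon>2 \<epsilon>] 1 2 \<epsilon> by simp
    then show "\<exists>Q \<epsilon>. finite Q \<and> Q \<subseteq> \<N> \<and> \<epsilon> \<in> L0_pos P \<and>
        (\<lambda>y. x \<oplus>\<^bsub>E\<^esub> y) ` base_nbhd P E Q \<epsilon> \<subseteq> U \<inter> V"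
      using 1 2 \<epsilon> by (intro exI[of _ "Q1 \<union> Q2"] exI[of _ \<epsilon>]) blast
  qed
next
  case (3 \<K>)
  then show ?case by blast
next
  case (4 \<K>)
  show ?case
  proof
    fix x assume "x \<in> \<Union> \<K>"
    then obtain U where U: "U \<in> \<K>" "x \<in> U" by blast
    with 4 obtain Q \<epsilon> where "finite Q" "Q \<subseteq> \<N>" "\<epsilon> \<in> L0_pos P" "(\<lambda>y. x \<oplus>\<^bsub>E\<^esub> y) ` base_nbhd P E Q \<epsilon> \<subseteq> U"
      by meson
    with U show "\<exists>Q \<epsilon>. finite Q \<and> Q \<subseteq> \<N> \<and> \<epsilon> \<in> L0_pos P \<and> (\<lambda>y. x \<oplus>\<^bsub>E\<^esub> y) ` base_nbhd P E Q \<epsilon> \<subseteq> \<Union> \<K>"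
      by blast
  qed
qed

text \<open>The part of the module structure that determines the topology. Neither the dual module nor the
  base ring has to be known to be a module in order to use it.\<close>
locale seminorm_topology = prob_space P for P :: "'w measure" +
  fixes E :: "(('w \<Rightarrow> 'k::real_normed_field) set, 'e) module"
    and \<N> :: "('e \<Rightarrow> ('w \<Rightarrow> real) set) set"
  assumes add_closed: "x \<in> carrier E \<Longrightarrow> y \<in> carrier E \<Longrightarrow> x \<oplus>\<^bsub>E\<^esub> y \<in> carrier E"
    and zero_closed: "\<zero>\<^bsub>E\<^esub> \<in> carrier E"
    and zero_add: "x \<in> carrier E \<Longrightarrow> \<zero>\<^bsub>E\<^esub> \<oplus>\<^bsub>E\<^esub> x = x"
    and seminorm_closed: "N \<in> \<N> \<Longrightarrow> x \<in> carrier E \<Longrightarrow> N x \<in> carrier (L0_plus P)"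
    and seminorm_zero: "N \<in> \<N> \<Longrightarrow> AE w in P. rep (N \<zero>\<^bsub>E\<^esub>) w \<le> 0"
    and seminorm_triangle: "N \<in> \<N> \<Longrightarrow> x \<in> carrier E \<Longrightarrow> y \<in> carrier E \<Longrightarrow>
      AE w in P. rep (N (x \<oplus>\<^bsub>E\<^esub> y)) w \<le> rep (N x) w + rep (N y) w"
begin

abbreviation "\<T> \<equiv> locally_L0_convex_topology P E \<N>"

lemma rep_seminorm_measurable:
  "N \<in> \<N> \<Longrightarrow> x \<in> carrier E \<Longrightarrow> rep (N x) \<in> borel_measurable P"
  using seminorm_closed carrier_L0_plus rep_measurable by blast

text \<open>The sum of the finitely many nonnegative values is an upper bound in the cone. Hence the
  supremum in the definition is genuine and can be tested one seminorm at a time, also for empty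
  \<open>Q\<close>.\<close>

lemma base_nbhd_iff:
  assumes Q: "finite Q" "Q \<subseteq> \<N>" and \<epsilon>: "\<epsilon> \<in> L0_pos P"
  shows "x \<in> base_nbhd P E Q \<epsilon> \<longleftrightarrow> x \<in> carrier E \<and> (\<forall>N\<in>Q. L0_le P (N x) \<epsilon>)"
proof (cases "x \<in> carrier E")
  case x: True
  have c: "{N x | N. N \<in> Q} \<subseteq> carrier (L0_plus P)" using seminorm_closed Q x by blast
  have m: "(\<lambda>w. \<Sum>N\<in>Q. rep (N x) w) \<in> borel_measurable P"
    using rep_seminorm_measurable x Q by (intro borel_measurable_sum) blast
  have "AE w in P. \<forall>N\<in>Q. 0 \<le> rep (N x) w"
    using c by (intro AE_finite_allI[OF Q(1)]) (auto simp: carrier_L0_plus)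
  then have 0: "AE w in P. 0 \<le> (\<Sum>N\<in>Q. rep (N x) w) \<and> (\<forall>N\<in>Q. rep (N x) w \<le> (\<Sum>N\<in>Q. rep (N x) w))"
    by eventually_elim (use Q in \<open>auto intro!: sum_nonneg member_le_sum\<close>)
  have U: "ae_class P (\<lambda>w. \<Sum>N\<in>Q. rep (N x) w) \<in> carrier (L0_plus P)"
    using 0 by (subst L0_plus_class[OF m]) (auto elim: eventually_mono)
  have bound: "L0_le P X (ae_class P (\<lambda>w. \<Sum>N\<in>Q. rep (N x) w))" if "X \<in> {N x | N. N \<in> Q}" for X
  proof -
    obtain N where N: "N \<in> Q" "X = N x" using \<open>X \<in> _\<close> by blast
    show ?thesis
      unfolding L0_le_def N(2) using rep_ae_class[OF m] 0
      by eventually_elim (use N in auto)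
  qed
  show ?thesis
    unfolding base_nbhd_def
    using L0_plus_sup(2)[OF c U bound L0_pos_plus[OF \<epsilon>]] x by auto
qed (simp add: base_nbhd_def)

lemma base_nbhd_class_iff:
  assumes "finite Q" "Q \<subseteq> \<N>" "e \<in> borel_measurable P" "\<And>w. 0 < e w"
  shows "x \<in> base_nbhd P E Q (ae_class P e) \<longleftrightarrow>
    x \<in> carrier E \<and> (\<forall>N\<in>Q. AE w in P. rep (N x) w \<le> e w)"
proof -
  have \<epsilon>: "ae_class P e \<in> L0_pos P" using assms by (simp add: L0_pos_class)
  have "L0_le P (N x) (ae_class P e) \<longleftrightarrow> (AE w in P. rep (N x) w \<le> e w)" for N
    unfolding L0_le_def using rep_ae_class[OF assms(3)]
    by (intro eventually_subst, eventually_elim) simp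
  then show ?thesis using base_nbhd_iff[OF assms(1,2) \<epsilon>] by simp
qed

lemma openin_base:
  "openin \<T> U \<longleftrightarrow> U \<subseteq> carrier E \<and>
     (\<forall>x\<in>U. \<exists>Q \<epsilon>. finite Q \<and> Q \<subseteq> \<N> \<and> \<epsilon> \<in> L0_pos P \<and> (\<lambda>y. x \<oplus>\<^bsub>E\<^esub> y) ` base_nbhd P E Q \<epsilon> \<subseteq> U)"
  unfolding locally_L0_convex_topology_def
proof (subst topology_inverse'[OF istopology_base_nbhd])
  fix Q Q' \<epsilon> \<epsilon>'
  assume *: "finite Q'" "Q \<subseteq> Q'" "Q' \<subseteq> \<N>" "\<epsilon> \<in> L0_pos P" "\<epsilon>' \<in> L0_pos P" "L0_le P \<epsilon>' \<epsilon>"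
  then have "finite Q" "Q \<subseteq> \<N>" using finite_subset by auto
  with * show "base_nbhd P E Q' \<epsilon>' \<subseteq> base_nbhd P E Q \<epsilon>"
    by (simp add: base_nbhd_iff subset_iff) (blast intro: L0_le_trans)
qed simp

text \<open>Taking the radius as an everywhere positive function and the seminorms through
  representatives gives the form in which open sets are handled from here on.\<close>

lemma openin_iff:
  "openin \<T> U \<longleftrightarrow> U \<subseteq> carrier E \<and>
     (\<forall>x\<in>U. \<exists>Q e. finite Q \<and> Q \<subseteq> \<N> \<and> e \<in> borel_measurable P \<and> (\<forall>w. 0 < e w) \<and>
       (\<forall>y\<in>carrier E. (\<forall>N\<in>Q. AE w in P. rep (N y) w \<le> e w) \<longrightarrow> x \<oplus>\<^bsub>E\<^esub> y \<in> U))"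
proof -
  have "(\<exists>Q \<epsilon>. finite Q \<and> Q \<subseteq> \<N> \<and> \<epsilon> \<in> L0_pos P \<and> (\<lambda>y. x \<oplus>\<^bsub>E\<^esub> y) ` base_nbhd P E Q \<epsilon> \<subseteq> U) \<longleftrightarrow>
    (\<exists>Q e. finite Q \<and> Q \<subseteq> \<N> \<and> e \<in> borel_measurable P \<and> (\<forall>w. 0 < e w) \<and>
       (\<forall>y\<in>carrier E. (\<forall>N\<in>Q. AE w in P. rep (N y) w \<le> e w) \<longrightarrow> x \<oplus>\<^bsub>E\<^esub> y \<in> U))" (is "?L \<longleftrightarrow> ?R") for x
  proof
    assume ?L
    then obtain Q \<epsilon> where Q: "finite Q" "Q \<subseteq> \<N>" "\<epsilon> \<in> L0_pos P"
      "(\<lambda>y. x \<oplus>\<^bsub>E\<^esub> y) ` base_nbhd P E Q \<epsilon> \<subseteq> U" by blast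
    obtain e where e: "e \<in> borel_measurable P" "\<And>w. 0 < e w" "\<epsilon> = ae_class P e"
      using L0_pos_obtain[OF Q(3)] by blast
    show ?R
      using Q(1,2) e(1,2) Q(4) base_nbhd_class_iff[OF Q(1,2) e(1,2)] unfolding e(3)
      by (intro exI[of _ Q] exI[of _ e]) blast
  next
    assume ?R
    then obtain Q e where Q: "finite Q" "Q \<subseteq> \<N>" and e: "e \<in> borel_measurable P" "\<And>w. 0 < e w"
      and U: "\<And>y. y \<in> carrier E \<Longrightarrow> (\<forall>N\<in>Q. AE w in P. rep (N y) w \<le> e w) \<Longrightarrow> x \<oplus>\<^bsub>E\<^esub> y \<in> U" by blast
    have "ae_class P e \<in> L0_pos P" using e by (simp add: L0_pos_class)
    then show ?L
      using Q U base_nbhd_class_iff[OF Q e]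
      by (intro exI[of _ Q] exI[of _ "ae_class P e"]) blast
  qed
  then show ?thesis unfolding openin_base by simp
qed

lemma topspace_eq: "topspace \<T> = carrier E"
proof -
  have "openin \<T> (carrier E)"
    unfolding openin_iff using add_closed
    by (auto intro!: exI[of _ "{}"] exI[of _ "\<lambda>w. 1"])
  moreover have "topspace \<T> \<subseteq> carrier E"
    using openin_topspace[of \<T>] unfolding openin_base by blast
  ultimately show ?thesis using openin_subset by blast
qed

lemma nbhd_zero_iff:
  "nbhd_zero E \<T> U \<longleftrightarrow> U \<subseteq> carrier E \<and>
     (\<exists>Q e. finite Q \<and> Q \<subseteq> \<N> \<and> e \<in> borel_measurable P \<and> (\<forall>w. 0 < e w) \<and>
       (\<forall>y\<in>carrier E. (\<forall>N\<in>Q. AE w in P. rep (N y) w \<le> e w) \<longrightarrow> y \<in> U))" (is "?L \<longleftrightarrow> ?R")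
proof
  assume ?L
  then obtain V where V: "U \<subseteq> carrier E" "openin \<T> V" "\<zero>\<^bsub>E\<^esub> \<in> V" "V \<subseteq> U"
    unfolding nbhd_zero_def topspace_eq by blast
  then obtain Q e where Q: "finite Q \<and> Q \<subseteq> \<N> \<and> e \<in> borel_measurable P \<and> (\<forall>w. 0 < e w)"
       "\<And>y. y \<in> carrier E \<Longrightarrow> (\<forall>N\<in>Q. AE w in P. rep (N y) w \<le> e w) \<Longrightarrow> \<zero>\<^bsub>E\<^esub> \<oplus>\<^bsub>E\<^esub> y \<in> V"
    using openin_iff[THEN iffD1, OF V(2), THEN conjunct2, THEN bspec, OF V(3)] by auto
  have "\<forall>y\<in>carrier E. (\<forall>N\<in>Q. AE w in P. rep (N y) w \<le> e w) \<longrightarrow> y \<in> U"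
    using Q(2) zero_add V(4) by fastforce
  with Q(1) V(1) show ?R by blast
next
  assume ?R
  then obtain Q e where U: "U \<subseteq> carrier E" and Q: "finite Q" "Q \<subseteq> \<N>"
      and e [measurable]: "e \<in> borel_measurable P" and e0: "\<And>w. 0 < e w"
      and QU: "\<And>y. y \<in> carrier E \<Longrightarrow> (\<forall>N\<in>Q. AE w in P. rep (N y) w \<le> e w) \<Longrightarrow> y \<in> U" by blast
  \<comment> \<open>The basic set need not be open itself, but its points with a positive slack
    \<open>d\<close> form an open set: a shift by \<open>y\<close> with
    \<open>N y \<le> d / 2\<close> spends half of the slack and keeps the other half.\<close>
  define V where "V = {x \<in> carrier E. \<exists>d. d \<in> borel_measurable P \<and> (\<forall>w. 0 < d w) \<and>
    (\<forall>N\<in>Q. AE w in P. rep (N x) w + d w \<le> e w)}"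
  have "\<zero>\<^bsub>E\<^esub> \<in> V"
  proof -
    have "AE w in P. rep (N \<zero>\<^bsub>E\<^esub>) w + e w \<le> e w" if "N \<in> Q" for N
      using seminorm_zero[of N] that Q by auto
    then show ?thesis unfolding V_def using e e0 zero_closed by blast
  qed
  moreover have "V \<subseteq> U"
  proof
    fix x assume "x \<in> V"
    then obtain d where d: "x \<in> carrier E" "\<And>w. (0::real) < d w"
        "\<And>N. N \<in> Q \<Longrightarrow> AE w in P. rep (N x) w + d w \<le> e w"
      unfolding V_def by blast
    have "AE w in P. rep (N x) w \<le> e w" if "N \<in> Q" for N
      using d(3)[OF that]
    proof eventually_elim
      case (elim w) then show ?case using d(2)[of w] by linarith
    qed
    then show "x \<in> U" using QU d(1) by blast
  qed
  moreover have "openin \<T> V"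
    unfolding openin_iff
  proof (intro conjI ballI)
    show "V \<subseteq> carrier E" by (auto simp: V_def)
    fix x assume "x \<in> V"
    then obtain d where x: "x \<in> carrier E" and d [measurable]: "d \<in> borel_measurable P"
        and d0: "\<And>w. 0 < d w" and dN: "\<And>N. N \<in> Q \<Longrightarrow> AE w in P. rep (N x) w + d w \<le> e w"
      unfolding V_def by blast
    have "x \<oplus>\<^bsub>E\<^esub> y \<in> V" if y: "y \<in> carrier E" "\<forall>N\<in>Q. AE w in P. rep (N y) w \<le> d w / 2" for y
    proof -
      have "AE w in P. rep (N (x \<oplus>\<^bsub>E\<^esub> y)) w + d w / 2 \<le> e w" if N: "N \<in> Q" for N
      proof -
        have "N \<in> \<N>" using N Q by blast
        from seminorm_triangle[OF this x y(1)] dN[OF N] y(2)[rule_format, OF N]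
        show ?thesis
        proof eventually_elim
          case (elim w) then show ?case by linarith
        qed
      qed
      moreover have "(\<lambda>w. d w / 2) \<in> borel_measurable P" "\<forall>w. 0 < d w / 2" using d0 by auto
      ultimately show ?thesis unfolding V_def using add_closed[OF x y(1)] by blast
    qed
    then show "\<exists>Q e. finite Q \<and> Q \<subseteq> \<N> \<and> e \<in> borel_measurable P \<and> (\<forall>w. 0 < e w) \<and>
       (\<forall>y\<in>carrier E. (\<forall>N\<in>Q. AE w in P. rep (N y) w \<le> e w) \<longrightarrow> x \<oplus>\<^bsub>E\<^esub> y \<in> V)"
      using Q d0 by (intro exI[of _ Q] exI[of _ "\<lambda>w. d w / 2"]) auto
  qed
  ultimately show ?L unfolding nbhd_zero_def topspace_eq using U by blast
qed

end


section \<open>The Hahn--Banach theorem for random modules\<close>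

locale random_module = prob_space P + Module.module "L0 P" E
  for P :: "'w measure"
    and E :: "(('w \<Rightarrow> 'k::{real_normed_field, second_countable_topology}) set, 'e) module"
begin

text \<open>Scalars are handled through measurable representatives, so that all estimates become pointwise
  estimates holding almost surely.\<close>

definition act :: "('w \<Rightarrow> 'k) \<Rightarrow> 'e \<Rightarrow> 'e" where
  "act f x = ae_class P f \<odot>\<^bsub>E\<^esub> x"

abbreviation ract :: "('w \<Rightarrow> real) \<Rightarrow> 'e \<Rightarrow> 'e" where
  "ract f \<equiv> act (\<lambda>w. of_real (f w))"

lemma act_closed [simp, intro]:
  "f \<in> borel_measurable P \<Longrightarrow> x \<in> carrier E \<Longrightarrow> act f x \<in> carrier E"
  by (simp add: act_def)

lemma act_cong:
  "f \<in> borel_measurable P \<Longrightarrow> g \<in> borel_measurable P \<Longrightarrow> AE w in P. f w = g w \<Longrightarrow> act f x = act g x"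
  unfolding act_def using ae_class_eqI[of f P g] by simp

lemma act_add_left:
  "f \<in> borel_measurable P \<Longrightarrow> g \<in> borel_measurable P \<Longrightarrow> x \<in> carrier E \<Longrightarrow>
   act (\<lambda>w. f w + g w) x = act f x \<oplus>\<^bsub>E\<^esub> act g x"
  unfolding act_def by (simp add: ae_class_add[symmetric] smult_l_distr)

lemma act_add_right:
  "f \<in> borel_measurable P \<Longrightarrow> x \<in> carrier E \<Longrightarrow> y \<in> carrier E \<Longrightarrow>
   act f (x \<oplus>\<^bsub>E\<^esub> y) = act f x \<oplus>\<^bsub>E\<^esub> act f y"
  unfolding act_def by (simp add: smult_r_distr)

lemma act_act:
  "f \<in> borel_measurable P \<Longrightarrow> g \<in> borel_measurable P \<Longrightarrow> x \<in> carrier E \<Longrightarrow>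
   act f (act g x) = act (\<lambda>w. f w * g w) x"
  unfolding act_def by (simp add: ae_class_mult[symmetric] smult_assoc1)

lemma act_one [simp]: "x \<in> carrier E \<Longrightarrow> act (\<lambda>w. 1) x = x"
  using smult_one[of x] by (simp add: act_def one_L0)

lemma act_zero [simp]: "x \<in> carrier E \<Longrightarrow> act (\<lambda>w. 0) x = \<zero>\<^bsub>E\<^esub>"
  using smult_l_null[of x] by (simp add: act_def zero_L0)

text \<open>Values are functions instead of classes, and each law has a null set that depends on its
  arguments. Laws are therefore combined for finitely or countably many arguments at a time.\<close>

definition seminorm_fun :: "('e \<Rightarrow> 'w \<Rightarrow> real) \<Rightarrow> bool" where
  "seminorm_fun n \<longleftrightarrow> (\<forall>x\<in>carrier E. n x \<in> borel_measurable P) \<and>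
     (\<forall>x\<in>carrier E. AE w in P. 0 \<le> n x w) \<and>
     (\<forall>f\<in>borel_measurable P. \<forall>x\<in>carrier E. AE w in P. n (act f x) w = norm (f w) * n x w) \<and>
     (\<forall>x\<in>carrier E. \<forall>y\<in>carrier E. AE w in P. n (x \<oplus>\<^bsub>E\<^esub> y) w \<le> n x w + n y w)"

definition linear_fun :: "('e \<Rightarrow> 'w \<Rightarrow> 'k) \<Rightarrow> bool" where
  "linear_fun g \<longleftrightarrow> (\<forall>x\<in>carrier E. g x \<in> borel_measurable P) \<and>
     (\<forall>f\<in>borel_measurable P. \<forall>x\<in>carrier E. AE w in P. g (act f x) w = f w * g x w) \<and>
     (\<forall>x\<in>carrier E. \<forall>y\<in>carrier E. AE w in P. g (x \<oplus>\<^bsub>E\<^esub> y) w = g x w + g y w)"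

text \<open>Homogeneity is demanded for real random factors, which is what the extension argument
  yields over the complex numbers as well.\<close>

definition real_linear_fun :: "('e \<Rightarrow> 'w \<Rightarrow> real) \<Rightarrow> bool" where
  "real_linear_fun u \<longleftrightarrow> (\<forall>x\<in>carrier E. u x \<in> borel_measurable P) \<and>
     (\<forall>r\<in>borel_measurable P. \<forall>x\<in>carrier E. AE w in P. u (ract r x) w = r w * u x w) \<and>
     (\<forall>x\<in>carrier E. \<forall>y\<in>carrier E. AE w in P. u (x \<oplus>\<^bsub>E\<^esub> y) w = u x w + u y w)"

lemma seminorm_funD:
  assumes "seminorm_fun n"
  shows "x \<in> carrier E \<Longrightarrow> n x \<in> borel_measurable P"
    and "x \<in> carrier E \<Longrightarrow> AE w in P. 0 \<le> n x w"
    and "f \<in> borel_measurable P \<Longrightarrow> x \<in> carrier E \<Longrightarrow> AE w in P. n (act f x) w = norm (f w) * n x w"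
    and "x \<in> carrier E \<Longrightarrow> y \<in> carrier E \<Longrightarrow> AE w in P. n (x \<oplus>\<^bsub>E\<^esub> y) w \<le> n x w + n y w"
  using assms by (auto simp: seminorm_fun_def)

lemma linear_funD:
  assumes "linear_fun g"
  shows "x \<in> carrier E \<Longrightarrow> g x \<in> borel_measurable P"
    and "f \<in> borel_measurable P \<Longrightarrow> x \<in> carrier E \<Longrightarrow> AE w in P. g (act f x) w = f w * g x w"
    and "x \<in> carrier E \<Longrightarrow> y \<in> carrier E \<Longrightarrow> AE w in P. g (x \<oplus>\<^bsub>E\<^esub> y) w = g x w + g y w"
  using assms by (auto simp: linear_fun_def)

lemma real_linear_funD:
  assumes "real_linear_fun u"
  shows "x \<in> carrier E \<Longrightarrow> u x \<in> borel_measurable P"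
    and "r \<in> borel_measurable P \<Longrightarrow> x \<in> carrier E \<Longrightarrow> AE w in P. u (ract r x) w = r w * u x w"
    and "x \<in> carrier E \<Longrightarrow> y \<in> carrier E \<Longrightarrow> AE w in P. u (x \<oplus>\<^bsub>E\<^esub> y) w = u x w + u y w"
  using assms by (auto simp: real_linear_fun_def)

lemma seminorm_fun_zero: "seminorm_fun n \<Longrightarrow> AE w in P. n \<zero>\<^bsub>E\<^esub> w = 0"
  using seminorm_funD(3)[of n "\<lambda>w. 0" "\<zero>\<^bsub>E\<^esub>"] by simp

lemma of_real_measurable [measurable]:
  "r \<in> borel_measurable P \<Longrightarrow> (\<lambda>w. of_real (r w) :: 'k) \<in> borel_measurable P"
  by (rule measurable_compose[of _ _ borel], assumption, rule borel_measurable_continuous_onI)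
    (intro continuous_intros)

text \<open>Lets one replace \<open>\<zeta> x + s y\<close> by \<open>\<zeta> (x + r y)\<close> on the set where \<open>s = \<zeta> r\<close>.\<close>
lemma seminorm_fun_combine:
  assumes n: "seminorm_fun n" and [measurable]: "z \<in> borel_measurable P" "r \<in> borel_measurable P" "s \<in> borel_measurable P"
    and x: "x \<in> carrier E" and y: "y \<in> carrier E"
  shows "AE w in P. n (ract z x \<oplus>\<^bsub>E\<^esub> ract s y) w \<le> \<bar>z w\<bar> * n (x \<oplus>\<^bsub>E\<^esub> ract r y) w + \<bar>s w - z w * r w\<bar> * n y w"
proof -
  let ?a = "ract z (x \<oplus>\<^bsub>E\<^esub> ract r y)" and ?b = "ract (\<lambda>w. s w - z w * r w) y"
  have s: "ract s y = ract (\<lambda>w. z w * r w) y \<oplus>\<^bsub>E\<^esub> ?b"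
    using y by (subst act_add_left[symmetric]) (simp_all flip: of_real_add of_real_mult)
  have eq: "ract z x \<oplus>\<^bsub>E\<^esub> ract s y = ?a \<oplus>\<^bsub>E\<^esub> ?b"
    unfolding s using x y by (simp add: act_add_right act_act M.a_assoc)
  have a: "AE w in P. n ?a w = norm (of_real (z w) :: 'k) * n (x \<oplus>\<^bsub>E\<^esub> ract r y) w"
    by (rule seminorm_funD(3)[OF n]) (use x y in simp_all)
  have b: "AE w in P. n ?b w = norm (of_real (s w - z w * r w) :: 'k) * n y w"
    by (rule seminorm_funD(3)[OF n]) (use x y in \<open>simp_all\<close>)
  have "AE w in P. n (?a \<oplus>\<^bsub>E\<^esub> ?b) w \<le> n ?a w + n ?b w"
    by (rule seminorm_funD(4)[OF n]) (use x y in \<open>simp_all\<close>)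
  with a b show ?thesis
    unfolding eq by eventually_elim (simp only: norm_of_real)
qed

text \<open>The domain of a partial functional is not recorded separately: a partial functional is an additive
  and homogeneous relation between points and measurable functions. Domination by \<open>p\<close> makes it
  single valued up to almost sure equality.\<close>
definition dominated_relations :: "('e \<Rightarrow> 'w \<Rightarrow> real) \<Rightarrow> 'e \<Rightarrow> ('e \<times> ('w \<Rightarrow> real)) set set" where
  "dominated_relations p x0 = {G. G \<subseteq> carrier E \<times> borel_measurable P \<and> (x0, p x0) \<in> G \<and>
     (\<forall>x f y g. (x, f) \<in> G \<longrightarrow> (y, g) \<in> G \<longrightarrow> (x \<oplus>\<^bsub>E\<^esub> y, \<lambda>w. f w + g w) \<in> G) \<and>
     (\<forall>r x f. r \<in> borel_measurable P \<longrightarrow> (x, f) \<in> G \<longrightarrow> (ract r x, \<lambda>w. r w * f w) \<in> G) \<and>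
     (\<forall>x f. (x, f) \<in> G \<longrightarrow> (AE w in P. f w \<le> p x w))}"

lemma dominated_relationsD:
  assumes "G \<in> dominated_relations p x0"
  shows "(x, f) \<in> G \<Longrightarrow> x \<in> carrier E" "(x, f) \<in> G \<Longrightarrow> f \<in> borel_measurable P" "(x0, p x0) \<in> G"
    "(x, f) \<in> G \<Longrightarrow> (y, g) \<in> G \<Longrightarrow> (x \<oplus>\<^bsub>E\<^esub> y, \<lambda>w. f w + g w) \<in> G"
    "r \<in> borel_measurable P \<Longrightarrow> (x, f) \<in> G \<Longrightarrow> (ract r x, \<lambda>w. r w * f w) \<in> G"
    "(x, f) \<in> G \<Longrightarrow> AE w in P. f w \<le> p x w"
  using assms unfolding dominated_relations_def by blast+

text \<open>On multiples of \<open>x0\<close> domination reads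
  \<open>r * p x0 \<le> \<bar>r\<bar> * p x0 = p (r x0)\<close>. The multiplier \<open>r\<close>
  need not be determined by the point, which a relation tolerates.\<close>

lemma dominated_relations_init:
  assumes p: "seminorm_fun p" and x0: "x0 \<in> carrier E"
  shows "{(ract r x0, \<lambda>w. r w * p x0 w) | r. r \<in> borel_measurable P} \<in> dominated_relations p x0"
  unfolding dominated_relations_def
proof (intro CollectI conjI allI impI, goal_cases)
  case 1
  then show ?case using seminorm_funD(1)[OF p x0] x0 by auto
next
  case 2
  then show ?case using x0 by (auto intro!: exI[of _ "\<lambda>w. 1"])
next
  case (3 x f y g)
  then obtain r s where [measurable]: "r \<in> borel_measurable P" "s \<in> borel_measurable P"
    and eq: "x = ract r x0" "f = (\<lambda>w. r w * p x0 w)" "y = ract s x0" "g = (\<lambda>w. s w * p x0 w)" by blast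
  show ?case
    using x0 by (auto intro!: exI[of _ "\<lambda>w. r w + s w"] simp: eq act_add_left distrib_right)
next
  case (4 s x f)
  then obtain r where [measurable]: "r \<in> borel_measurable P" "s \<in> borel_measurable P"
    and eq: "x = ract r x0" "f = (\<lambda>w. r w * p x0 w)" by blast
  show ?case
    using x0 by (auto intro!: exI[of _ "\<lambda>w. s w * r w"] simp: eq act_act mult.assoc)
next
  case (5 x f)
  then obtain r where r [measurable]: "r \<in> borel_measurable P"
    and eq: "x = ract r x0" "f = (\<lambda>w. r w * p x0 w)" by blast
  have m: "(\<lambda>w. of_real (r w) :: 'k) \<in> borel_measurable P" by measurable
  show ?case
    unfolding eq using seminorm_funD(2)[OF p x0] seminorm_funD(3)[OF p m x0]
    by eventually_elim (simp add: mult_right_mono)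
qed

lemma dominated_relations_Union:
  assumes "\<C> \<noteq> {}" "subset.chain (dominated_relations p x0) \<C>"
  shows "\<Union>\<C> \<in> dominated_relations p x0"
proof -
  have C: "G \<in> dominated_relations p x0" if "G \<in> \<C>" for G
    using assms that by (auto simp: subset.chain_def)
  show ?thesis
    unfolding dominated_relations_def
  proof (intro CollectI conjI allI impI, goal_cases)
    case 1
    then show ?case using dominated_relationsD(1,2)[OF C] by force
  next
    case 2
    then show ?case using dominated_relationsD(3)[OF C] assms(1) by blast
  next
    case (3 x f y g)
    then obtain G H where GH: "G \<in> \<C>" "H \<in> \<C>" "(x, f) \<in> G" "(y, g) \<in> H" by blast
    then have "G \<subseteq> H \<or> H \<subseteq> G" using assms(2) by (auto simp: subset.chain_def)
    then show ?case
      using GH dominated_relationsD(4)[OF C] by blast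
  next
    case (4 r x f)
    then show ?case using dominated_relationsD(5)[OF C] by blast
  next
    case (5 x f)
    then show ?case using dominated_relationsD(6)[OF C] by blast
  qed
qed

text \<open>The one-step extension: the value \<open>c\<close> at \<open>y\<close> must lie between
  all \<open>f' - p (m' - y)\<close> and all \<open>p (m + y) - f\<close>. These bounds are
  compatible by subadditivity, and the essential infimum of the upper ones serves.\<close>

lemma dominated_relations_extend:
  assumes p: "seminorm_fun p" and G: "G \<in> dominated_relations p x0" and y: "y \<in> carrier E"
  obtains H c where "H \<in> dominated_relations p x0" "G \<subseteq> H" "(y, c) \<in> H"
proof -
  note GD = dominated_relationsD[OF G]
  note pm = seminorm_funD(1)[OF p]
  have one [measurable]: "(\<lambda>w. 1::real) \<in> borel_measurable P" "(\<lambda>w. -1::real) \<in> borel_measurable P"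
    "(\<lambda>w. 0::real) \<in> borel_measurable P" by simp_all
  let ?my = "ract (\<lambda>w. -1) y"
  have my: "?my \<in> carrier E" using y by simp
  have cancel: "y \<oplus>\<^bsub>E\<^esub> ?my = \<zero>\<^bsub>E\<^esub>"
    using act_add_left[of "\<lambda>w. 1" "\<lambda>w. -1" y] y by simp
  define F where "F = {\<lambda>w. p (m \<oplus>\<^bsub>E\<^esub> y) w - f w | m f. (m, f) \<in> G}"
  have F: "F \<subseteq> borel_measurable P" "F \<noteq> {}"
    unfolding F_def using GD(1,2,3) pm y by auto
  have sep: "AE w in P. f' w - p (m' \<oplus>\<^bsub>E\<^esub> ?my) w \<le> p (m \<oplus>\<^bsub>E\<^esub> y) w - f w"
    if "(m, f) \<in> G" "(m', f') \<in> G" for m f m' f'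
  proof -
    have c: "m \<in> carrier E" "m' \<in> carrier E" using GD(1) that by auto
    have "(m \<oplus>\<^bsub>E\<^esub> y) \<oplus>\<^bsub>E\<^esub> (m' \<oplus>\<^bsub>E\<^esub> ?my) = (m \<oplus>\<^bsub>E\<^esub> m') \<oplus>\<^bsub>E\<^esub> (y \<oplus>\<^bsub>E\<^esub> ?my)"
      using c y my by (simp add: M.a_ac)
    also have "\<dots> = m \<oplus>\<^bsub>E\<^esub> m'" unfolding cancel using c by simp
    finally have "AE w in P. p (m \<oplus>\<^bsub>E\<^esub> m') w \<le> p (m \<oplus>\<^bsub>E\<^esub> y) w + p (m' \<oplus>\<^bsub>E\<^esub> ?my) w"
      using seminorm_funD(4)[OF p, of "m \<oplus>\<^bsub>E\<^esub> y" "m' \<oplus>\<^bsub>E\<^esub> ?my"] c y my by simp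
    with GD(6)[OF GD(4)[OF that]] show ?thesis by eventually_elim simp
  qed
  have h: "(\<lambda>w. p x0 w - p (x0 \<oplus>\<^bsub>E\<^esub> ?my) w) \<in> borel_measurable P"
    using pm my GD(1)[OF GD(3)] by simp
  have lower: "AE w in P. p x0 w - p (x0 \<oplus>\<^bsub>E\<^esub> ?my) w \<le> f w" if "f \<in> F" for f
    using that sep[OF _ GD(3)] unfolding F_def by blast
  obtain c s where c [measurable]: "c \<in> borel_measurable P" and cF: "\<And>f. f \<in> F \<Longrightarrow> AE w in P. c w \<le> f w"
      and s: "range s \<subseteq> F" "AE w in P. \<forall>e>0. \<exists>n::nat. s n w < c w + e"
    using essinf_exists[OF F h lower] by blast
  have c_le: "AE w in P. c w \<le> p (m \<oplus>\<^bsub>E\<^esub> y) w - f w" if "(m, f) \<in> G" for m f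
    by (rule cF) (use that in \<open>auto simp: F_def\<close>)
  have c_ge: "AE w in P. f w - p (m \<oplus>\<^bsub>E\<^esub> ?my) w \<le> c w" if mf: "(m, f) \<in> G" for m f
  proof (rule essinf_greatest[OF s(2)])
    fix n
    have "s n \<in> F" using s(1) by blast
    then obtain m' f' where m': "(m', f') \<in> G" "s n = (\<lambda>w. p (m' \<oplus>\<^bsub>E\<^esub> y) w - f' w)" unfolding F_def by blast
    show "AE w in P. f w - p (m \<oplus>\<^bsub>E\<^esub> ?my) w \<le> s n w"
      unfolding m'(2) by (rule sep[OF m'(1) mf])
  qed
  define H where "H = {(m \<oplus>\<^bsub>E\<^esub> ract r y, \<lambda>w. f w + r w * c w) | m f r. (m, f) \<in> G \<and> r \<in> borel_measurable P}"
  have HI: "(m \<oplus>\<^bsub>E\<^esub> ract r y, \<lambda>w. f w + r w * c w) \<in> H" if "(m, f) \<in> G" "r \<in> borel_measurable P" for m f r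
    using that unfolding H_def by blast
  have dom: "AE w in P. f w + r w * c w \<le> p (m \<oplus>\<^bsub>E\<^esub> ract r y) w"
    if mf: "(m, f) \<in> G" and r [measurable]: "r \<in> borel_measurable P" for m f r
  proof -
    have m: "m \<in> carrier E" using GD(1) mf by auto
    \<comment> \<open>Dividing by \<open>r\<close> is possible only on parts of the space:
      \<open>z1\<close> inverts \<open>r\<close> where it is positive, \<open>z2\<close> inverts
      \<open>-r\<close> where \<open>r\<close> is negative. The default \<open>1\<close> keeps both
      finite elsewhere; the resulting inequalities are read off only on the respective part.\<close>
    define z1 where "z1 w = (if 0 < r w then 1 / r w else 1)" for w
    define z2 where "z2 w = (if r w < 0 then - 1 / r w else 1)" for w
    have z1 [measurable]: "z1 \<in> borel_measurable P" unfolding z1_def by measurable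
    have z2 [measurable]: "z2 \<in> borel_measurable P" unfolding z2_def by measurable
    have 1: "AE w in P. c w \<le> p (ract z1 m \<oplus>\<^bsub>E\<^esub> y) w - z1 w * f w"
      by (rule c_le[OF GD(5)[OF z1 mf]])
    have 2: "AE w in P. z2 w * f w - p (ract z2 m \<oplus>\<^bsub>E\<^esub> ?my) w \<le> c w"
      by (rule c_ge[OF GD(5)[OF z2 mf]])
    have "AE w in P. p (ract z1 m \<oplus>\<^bsub>E\<^esub> ract (\<lambda>w. 1) y) w \<le> \<bar>z1 w\<bar> * p (m \<oplus>\<^bsub>E\<^esub> ract r y) w + \<bar>1 - z1 w * r w\<bar> * p y w"
      by (rule seminorm_fun_combine[OF p z1 r one(1) m y])
    then have 3: "AE w in P. p (ract z1 m \<oplus>\<^bsub>E\<^esub> y) w \<le> \<bar>z1 w\<bar> * p (m \<oplus>\<^bsub>E\<^esub> ract r y) w + \<bar>1 - z1 w * r w\<bar> * p y w"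
      using y by simp
    have 4: "AE w in P. p (ract z2 m \<oplus>\<^bsub>E\<^esub> ?my) w \<le> \<bar>z2 w\<bar> * p (m \<oplus>\<^bsub>E\<^esub> ract r y) w + \<bar>-1 - z2 w * r w\<bar> * p y w"
      by (rule seminorm_fun_combine[OF p z2 r one(2) m y])
    \<comment> \<open>This covers the part where \<open>r = 0\<close>: the correction
      \<open>\<bar>r\<bar> * p y\<close> vanishes there, and \<open>f \<le> p m\<close>
      suffices.\<close>
    have "AE w in P. p (ract (\<lambda>w. 1) m \<oplus>\<^bsub>E\<^esub> ract (\<lambda>w. 0) y) w \<le> \<bar>1\<bar> * p (m \<oplus>\<^bsub>E\<^esub> ract r y) w + \<bar>0 - 1 * r w\<bar> * p y w"
      by (rule seminorm_fun_combine[OF p one(1) r one(3) m y])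
    then have 5: "AE w in P. p m w \<le> p (m \<oplus>\<^bsub>E\<^esub> ract r y) w + \<bar>r w\<bar> * p y w"
      using y m by simp
    show ?thesis
      using 1 2 3 4 5 GD(6)[OF mf]
    proof eventually_elim
      case (elim w)
      consider "r w = 0" | "0 < r w" | "r w < 0" by linarith
      then show ?case
      proof cases
        case 1
        then show ?thesis using elim(5,6) by simp
      next
        case 2
        then have "c w \<le> (1 / r w) * p (m \<oplus>\<^bsub>E\<^esub> ract r y) w - (1 / r w) * f w"
          using elim(1,3) by (simp add: z1_def)
        then have "r w * c w \<le> r w * ((1 / r w) * p (m \<oplus>\<^bsub>E\<^esub> ract r y) w - (1 / r w) * f w)"
          using 2 by (intro mult_left_mono) auto
        then show ?thesis using 2 by (simp add: right_diff_distrib)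
      next
        case 3
        then have "(- 1 / r w) * f w - (- 1 / r w) * p (m \<oplus>\<^bsub>E\<^esub> ract r y) w \<le> c w"
          using elim(2,4) by (simp add: z2_def)
        then have "(- r w) * ((- 1 / r w) * f w - (- 1 / r w) * p (m \<oplus>\<^bsub>E\<^esub> ract r y) w) \<le> (- r w) * c w"
          using 3 by (intro mult_left_mono) auto
        then show ?thesis using 3 by (simp add: right_diff_distrib)
      qed
    qed
  qed
  have "H \<in> dominated_relations p x0"
    unfolding dominated_relations_def
  proof (intro CollectI conjI allI impI, goal_cases)
    case 1
    show ?case
    proof
      fix z assume "z \<in> H"
      then obtain m f r where mf: "(m, f) \<in> G" and [measurable]: "r \<in> borel_measurable P"
        and z: "z = (m \<oplus>\<^bsub>E\<^esub> ract r y, \<lambda>w. f w + r w * c w)" unfolding H_def by blast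
      note [measurable] = GD(2)[OF mf]
      show "z \<in> carrier E \<times> borel_measurable P"
        unfolding z using GD(1)[OF mf] y by simp
    qed
  next
    case 2
    show ?case using HI[OF GD(3) one(3)] GD(1)[OF GD(3)] y by simp
  next
    case (3 x f z g)
    then obtain m h r m' h' r' where G3: "(m, h) \<in> G" "(m', h') \<in> G"
      and [measurable]: "r \<in> borel_measurable P" "r' \<in> borel_measurable P"
      and eq: "x = m \<oplus>\<^bsub>E\<^esub> ract r y" "f = (\<lambda>w. h w + r w * c w)"
        "z = m' \<oplus>\<^bsub>E\<^esub> ract r' y" "g = (\<lambda>w. h' w + r' w * c w)" unfolding H_def by blast
    have c3: "m \<in> carrier E" "m' \<in> carrier E" using GD(1) G3 by auto
    have e1: "x \<oplus>\<^bsub>E\<^esub> z = (m \<oplus>\<^bsub>E\<^esub> m') \<oplus>\<^bsub>E\<^esub> ract (\<lambda>w. r w + r' w) y"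
      using c3 y by (simp add: eq act_add_left M.a_ac)
    have e2: "(\<lambda>w. f w + g w) = (\<lambda>w. (h w + h' w) + (r w + r' w) * c w)"
      by (simp add: eq algebra_simps)
    show ?case unfolding e1 e2 by (rule HI[OF GD(4)[OF G3]]) simp
  next
    case (4 s x f)
    then obtain m h r where G4: "(m, h) \<in> G"
      and s4: "s \<in> borel_measurable P" and [measurable]: "r \<in> borel_measurable P"
      and eq: "x = m \<oplus>\<^bsub>E\<^esub> ract r y" "f = (\<lambda>w. h w + r w * c w)" unfolding H_def by blast
    note [measurable] = s4
    have e1: "ract s x = ract s m \<oplus>\<^bsub>E\<^esub> ract (\<lambda>w. s w * r w) y"
      using GD(1)[OF G4] y by (simp add: eq act_add_right act_act)
    have e2: "(\<lambda>w. s w * f w) = (\<lambda>w. s w * h w + (s w * r w) * c w)"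
      by (simp add: eq algebra_simps)
    show ?case unfolding e1 e2 by (rule HI[OF GD(5)[OF s4 G4]]) simp
  next
    case (5 x f)
    then show ?case using dom unfolding H_def by blast
  qed
  moreover have "G \<subseteq> H"
  proof clarify
    fix m f assume mf: "(m, f) \<in> G"
    show "(m, f) \<in> H" using HI[OF mf one(3)] GD(1)[OF mf] y by simp
  qed
  \<comment> \<open>The zero multiple of \<open>x0\<close> provides the origin, from which
    \<open>y\<close> is reached with coefficient \<open>1\<close>.\<close>
  moreover have "(y, \<lambda>w. 0 * p x0 w + 1 * c w) \<in> H"
    using HI[OF GD(5)[OF one(3) GD(3)] one(1)] GD(1)[OF GD(3)] y by simp
  ultimately show thesis by (rule that)
qed

lemma real_hahn_banach:
  assumes p: "seminorm_fun p" and x0: "x0 \<in> carrier E"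
  obtains u where "real_linear_fun u" "\<And>x. x \<in> carrier E \<Longrightarrow> AE w in P. u x w \<le> p x w"
    "AE w in P. u x0 w = p x0 w"
proof -
  have "\<exists>G\<in>dominated_relations p x0. \<forall>H\<in>dominated_relations p x0. G \<subseteq> H \<longrightarrow> H = G"
  proof (rule subset_Zorn_nonempty)
    show "dominated_relations p x0 \<noteq> {}" using dominated_relations_init[OF p x0] by blast
  qed (rule dominated_relations_Union)
  then obtain G where G: "G \<in> dominated_relations p x0"
      and max: "\<And>H. H \<in> dominated_relations p x0 \<Longrightarrow> G \<subseteq> H \<Longrightarrow> H = G"
    by blast
  note GD = dominated_relationsD[OF G]
  have one: "(\<lambda>w. -1::real) \<in> borel_measurable P" by simp
  define u where "u x = (SOME f. (x, f) \<in> G)" for x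
  have u: "(x, u x) \<in> G" if x: "x \<in> carrier E" for x
  proof -
    obtain H c where "H \<in> dominated_relations p x0" "G \<subseteq> H" "(x, c) \<in> H"
      using dominated_relations_extend[OF p G x] by blast
    then show ?thesis unfolding u_def using max by (metis someI)
  qed
  \<comment> \<open>The difference of two values at \<open>x\<close> is a value at zero, where
    \<open>p\<close> vanishes.\<close>
  have le: "AE w in P. f w \<le> g w" if "(x, f) \<in> G" "(x, g) \<in> G" for x f g
  proof -
    have x: "x \<in> carrier E" using GD(1) that by blast
    have "x \<oplus>\<^bsub>E\<^esub> ract (\<lambda>w. -1) x = \<zero>\<^bsub>E\<^esub>"
      using act_add_left[of "\<lambda>w. 1" "\<lambda>w. -1" x] x by simp
    then have "AE w in P. f w + -1 * g w \<le> p \<zero>\<^bsub>E\<^esub> w"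
      using GD(6)[OF GD(4)[OF that(1) GD(5)[OF one that(2)]]] by simp
    with seminorm_fun_zero[OF p] show ?thesis by eventually_elim simp
  qed
  have unique: "AE w in P. f w = g w" if "(x, f) \<in> G" "(x, g) \<in> G" for x f g
    using le[OF that] le[OF that(2,1)] by eventually_elim simp
  show thesis
  proof
    show "real_linear_fun u"
      unfolding real_linear_fun_def
    proof (intro conjI ballI)
      fix x assume x: "x \<in> carrier E"
      then show "u x \<in> borel_measurable P" using u GD(2) by blast
      fix y assume y: "y \<in> carrier E"
      show "AE w in P. u (x \<oplus>\<^bsub>E\<^esub> y) w = u x w + u y w"
        by (rule unique[OF u GD(4)[OF u[OF x] u[OF y]]]) (use x y in simp)
    next
      fix x and r :: "'w \<Rightarrow> real" assume x: "x \<in> carrier E" and r: "r \<in> borel_measurable P"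
      show "AE w in P. u (ract r x) w = r w * u x w"
        by (rule unique[OF u GD(5)[OF r u[OF x]]]) (use x r in simp)
    qed
    show "AE w in P. u x0 w = p x0 w" by (rule unique[OF u[OF x0] GD(3)])
    show "AE w in P. u x w \<le> p x w" if "x \<in> carrier E" for x by (rule GD(6)[OF u[OF that]])
  qed
qed

text \<open>Real and complex scalars only differ in the proof of this property.\<close>
definition hahn_banach_property :: bool where
  "hahn_banach_property \<longleftrightarrow> (\<forall>p x0. seminorm_fun p \<longrightarrow> x0 \<in> carrier E \<longrightarrow>
     (\<exists>g. linear_fun g \<and> (\<forall>x\<in>carrier E. AE w in P. norm (g x w) \<le> p x w) \<and>
          (AE w in P. norm (g x0 w) = p x0 w)))"

end

text \<open>Domination at \<open>x\<close> and at \<open>-x\<close> bounds the absolute value. At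
  \<open>x0\<close>, nonnegativity of \<open>p\<close> turns the equality for \<open>u\<close> into
  one for its modulus.\<close>

lemma hahn_banach_property_real:
  fixes E :: "(('w \<Rightarrow> real) set, 'e) module"
  assumes "random_module P E"
  shows "random_module.hahn_banach_property P E"
proof -
  interpret random_module P E by fact
  show ?thesis
    unfolding hahn_banach_property_def
  proof (intro allI impI)
    fix p x0 assume p: "seminorm_fun p" and x0: "x0 \<in> carrier E"
    obtain u where u: "real_linear_fun u" and up: "\<And>x. x \<in> carrier E \<Longrightarrow> AE w in P. u x w \<le> p x w"
      and ux0: "AE w in P. u x0 w = p x0 w"
      using real_hahn_banach[OF p x0] by blast
    have lin: "linear_fun u" using u by (simp add: linear_fun_def real_linear_fun_def)
    have bound: "AE w in P. norm (u x w) \<le> p x w" if x: "x \<in> carrier E" for x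
    proof -
      have 1: "(\<lambda>w. -1::real) \<in> borel_measurable P" by simp
      show ?thesis
        using up[OF x] up[OF act_closed[OF 1 x]] linear_funD(2)[OF lin 1 x] seminorm_funD(3)[OF p 1 x]
        by eventually_elim simp
    qed
    have "AE w in P. norm (u x0 w) = p x0 w"
      using ux0 seminorm_funD(2)[OF p x0] by eventually_elim simp
    with lin bound show "\<exists>g. linear_fun g \<and> (\<forall>x\<in>carrier E. AE w in P. norm (g x w) \<le> p x w) \<and>
          (AE w in P. norm (g x0 w) = p x0 w)" by blast
  qed
qed

lemma hahn_banach_property_complex:
  fixes E :: "(('w \<Rightarrow> complex) set, 'e) module"
  assumes "random_module P E"
  shows "random_module.hahn_banach_property P E"
proof -
  interpret random_module P E by fact
  show ?thesis
    unfolding hahn_banach_property_def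
  proof (intro allI impI)
    fix p x0 assume p: "seminorm_fun p" and x0: "x0 \<in> carrier E"
    obtain u where u: "real_linear_fun u" and up: "\<And>x. x \<in> carrier E \<Longrightarrow> AE w in P. u x w \<le> p x w"
      and ux0: "AE w in P. u x0 w = p x0 w"
      using real_hahn_banach[OF p x0] by blast
    note uD = real_linear_funD[OF u]
    let ?i = "act (\<lambda>w. \<i>)"
    have i [simp]: "?i x \<in> carrier E" if "x \<in> carrier E" for x using that by simp
    \<comment> \<open>The complex functional \<open>u x - \<i> * u (\<i> x)\<close>, whose real part
      is \<open>u\<close>; compatibility with the factor \<open>\<i>\<close> is built into
      it.\<close>
    define g where "g x w = Complex (u x w) (- u (?i x) w)" for x w
    have g_meas: "g x \<in> borel_measurable P" if "x \<in> carrier E" for x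
    proof -
      note [measurable] = uD(1)[OF that] uD(1)[OF i[OF that]]
      show ?thesis unfolding g_def Complex_eq by measurable
    qed
    have g_add: "AE w in P. g (x \<oplus>\<^bsub>E\<^esub> y) w = g x w + g y w" if "x \<in> carrier E" "y \<in> carrier E" for x y
    proof -
      have "?i (x \<oplus>\<^bsub>E\<^esub> y) = ?i x \<oplus>\<^bsub>E\<^esub> ?i y" using that by (simp add: act_add_right)
      then show ?thesis
        using uD(3)[OF that] uD(3)[OF i[OF that(1)] i[OF that(2)]]
        by (auto elim!: eventually_elim2 simp: g_def complex_eq_iff)
    qed
    \<comment> \<open>Only real factors may be pulled out of \<open>u\<close>, so \<open>f\<close>
      is split into real and imaginary part and \<open>\<i>\<close> is moved onto the
      vector.\<close>
    have u_act: "AE w in P. u (act f x) w = Re (f w) * u x w + Im (f w) * u (?i x) w"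
      if f [measurable]: "f \<in> borel_measurable P" and x: "x \<in> carrier E" for f x
    proof -
      have re: "(\<lambda>w. Re (f w)) \<in> borel_measurable P" and im: "(\<lambda>w. Im (f w)) \<in> borel_measurable P"
        by measurable
      have cre: "(\<lambda>w. complex_of_real (Re (f w))) \<in> borel_measurable P"
        and cim: "(\<lambda>w. complex_of_real (Im (f w))) \<in> borel_measurable P" by measurable
      have "act f x = act (\<lambda>w. of_real (Re (f w)) + of_real (Im (f w)) * \<i>) x"
        using complex_eq by (intro arg_cong[where f="\<lambda>f. act f x"] ext) (simp add: mult.commute complex_eq_iff)
      also have "\<dots> = ract (\<lambda>w. Re (f w)) x \<oplus>\<^bsub>E\<^esub> ract (\<lambda>w. Im (f w)) (?i x)"
        using x cre cim by (simp add: act_add_left act_act)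
      finally have eq: "act f x = ract (\<lambda>w. Re (f w)) x \<oplus>\<^bsub>E\<^esub> ract (\<lambda>w. Im (f w)) (?i x)" .
      have "AE w in P. u (act f x) w = u (ract (\<lambda>w. Re (f w)) x) w + u (ract (\<lambda>w. Im (f w)) (?i x)) w"
        unfolding eq by (rule uD(3)) (use x cre cim in auto)
      with uD(2)[OF re x] uD(2)[OF im i[OF x]] show ?thesis by eventually_elim simp
    qed
    have g_act: "AE w in P. g (act f x) w = f w * g x w"
      if f [measurable]: "f \<in> borel_measurable P" and x: "x \<in> carrier E" for f x
    proof -
      have fi: "(\<lambda>w. \<i> * f w) \<in> borel_measurable P" by measurable
      have "?i (act f x) = act (\<lambda>w. \<i> * f w) x" using f x by (simp add: act_act)
      then have "AE w in P. u (?i (act f x)) w = - Im (f w) * u x w + Re (f w) * u (?i x) w"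
        using u_act[OF fi x] by simp
      with u_act[OF f x] show ?thesis
        by eventually_elim (simp add: g_def complex_eq_iff algebra_simps)
    qed
    have lin: "linear_fun g" using g_meas g_add g_act by (simp add: linear_fun_def)
    have bound: "AE w in P. norm (g x w) \<le> p x w" if x: "x \<in> carrier E" for x
    proof -
      note [measurable] = g_meas[OF x]
      \<comment> \<open>The rotation that turns \<open>g x\<close> into its modulus, so that the
        real bound on \<open>u\<close> applies to it. It vanishes where \<open>g x\<close> does; its
        norm is at most one everywhere.\<close>
      define f where "f w = cnj (sgn (g x w))" for w
      have [measurable]: "cnj \<in> borel_measurable borel"
        by (intro borel_measurable_continuous_onI continuous_intros)
      have f: "f \<in> borel_measurable P" unfolding f_def sgn_div_norm by measurable
      have fg: "f w * g x w = of_real (norm (g x w))" for w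
        by (simp add: f_def sgn_div_norm scaleR_conv_of_real complex_norm_square[symmetric] field_simps power2_eq_square
            mult.commute[of "cnj _"])
      have f1: "norm (f w) \<le> 1" for w by (simp add: f_def norm_sgn)
      show ?thesis
        using g_act[OF f x] up[OF act_closed[OF f x]] seminorm_funD(3)[OF p f x] seminorm_funD(2)[OF p x]
      proof eventually_elim
        case (elim w)
        have "norm (g x w) = Re (g (act f x) w)" using elim(1) fg[of w] by simp
        also have "\<dots> \<le> norm (f w) * p x w" using elim(2,3) by (simp add: g_def)
        also have "\<dots> \<le> p x w" using mult_right_mono[OF f1[of w] elim(4)] by simp
        finally show ?case .
      qed
    qed
    \<comment> \<open>At \<open>x0\<close> the real part of \<open>g\<close> is \<open>p x0\<close>,
      hence \<open>p x0\<close> lies below the modulus; the bound just shown gives the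
      converse.\<close>
    have "AE w in P. norm (g x0 w) = p x0 w"
      using ux0 bound[OF x0]
    proof eventually_elim
      case (elim w)
      have "u x0 w \<le> norm (g x0 w)" using complex_Re_le_cmod[of "g x0 w"] by (simp add: g_def)
      with elim show ?case by simp
    qed
    with lin bound show "\<exists>g. linear_fun g \<and> (\<forall>x\<in>carrier E. AE w in P. norm (g x w) \<le> p x w) \<and>
          (AE w in P. norm (g x0 w) = p x0 w)" by blast
  qed
qed


section \<open>Gauges of sets with the countable concatenation property\<close>

text \<open>Restricting to the tolerances \<open>1 / Suc k\<close> leaves countably many exceptional
  null sets.\<close>

lemma (in prob_space) AE_le_add_eps:
  assumes "\<And>e::real. 0 < e \<Longrightarrow> AE w in M. f w \<le> g w + e"
  shows "AE w in M. f w \<le> (g w :: real)"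
proof -
  have "AE w in M. \<forall>k::nat. f w \<le> g w + 1 / Suc k"
    using assms by (simp add: AE_all_countable)
  then show ?thesis
  proof eventually_elim
    case (elim w)
    show ?case
    proof (rule field_le_epsilon)
      fix e :: real assume "0 < e"
      then obtain k where "1 / Suc k < e" using nat_approx_posE by blast
      with elim[rule_format, of k] show "f w \<le> g w + e" by linarith
    qed
  qed
qed

context random_module
begin

text \<open>Multiplication by an indicator localizes: \<open>n (1_A y) = 1_A * n y\<close>, so the
  values on \<open>A\<close> depend only on the part of the vector over \<open>A\<close>.\<close>

lemma seminorm_fun_local:
  assumes n: "seminorm_fun n" and A: "A \<in> sets P" and y: "y \<in> carrier E" and z: "z \<in> carrier E"
    and eq: "act (indicator A) y = act (indicator A) z"
  shows "AE w in P. w \<in> A \<longrightarrow> n y w = n z w"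
proof -
  have i: "(indicator A :: 'w \<Rightarrow> 'k) \<in> borel_measurable P" using A by simp
  show ?thesis
    using seminorm_funD(3)[OF n i y] seminorm_funD(3)[OF n i z] unfolding eq
    by eventually_elim auto
qed

lemma linear_fun_local:
  assumes g: "linear_fun g" and A: "A \<in> sets P" and y: "y \<in> carrier E" and z: "z \<in> carrier E"
    and eq: "act (indicator A) y = act (indicator A) z"
  shows "AE w in P. w \<in> A \<longrightarrow> g y w = g z w"
proof -
  have i: "(indicator A :: 'w \<Rightarrow> 'k) \<in> borel_measurable P" using A by simp
  show ?thesis
    using linear_funD(2)[OF g i y] linear_funD(2)[OF g i z] unfolding eq
    by eventually_elim auto
qed

end

text \<open>The properties of a barrel on which the gauge construction draws, in terms of
  representatives. Countable partitions are given as level sets of a measurable index, the form in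
  which a pointwise selection produces them.\<close>

locale concatenable_disc = random_module P E
  for P :: "'w measure"
    and E :: "(('w \<Rightarrow> 'k::{real_normed_field, second_countable_topology}) set, 'e) module" +
  fixes B :: "'e set"
  assumes B_sub: "B \<subseteq> carrier E" and B_ne: "B \<noteq> {}"
    and B_balanced: "f \<in> borel_measurable P \<Longrightarrow> AE w in P. norm (f w) \<le> 1 \<Longrightarrow> x \<in> B \<Longrightarrow> act f x \<in> B"
    and B_convex: "r \<in> borel_measurable P \<Longrightarrow> AE w in P. 0 \<le> r w \<and> r w \<le> 1 \<Longrightarrow> x \<in> B \<Longrightarrow> y \<in> B \<Longrightarrow>
      ract r x \<oplus>\<^bsub>E\<^esub> ract (\<lambda>w. 1 - r w) y \<in> B"
    and B_concat: "range s \<subseteq> B \<Longrightarrow> k \<in> measurable P (count_space (UNIV :: nat set)) \<Longrightarrow>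
      \<exists>y\<in>B. \<forall>n. act (indicator {w\<in>space P. k w = n}) y = act (indicator {w\<in>space P. k w = n}) (s n)"
begin

definition gauge_term :: "('e \<Rightarrow> 'w \<Rightarrow> real) \<Rightarrow> 'e \<Rightarrow> ('w \<Rightarrow> real) \<Rightarrow> 'e \<Rightarrow> 'w \<Rightarrow> real" where
  "gauge_term n x l b w = l w + n (x \<oplus>\<^bsub>E\<^esub> ract (\<lambda>w. - l w) b) w"

definition admissible :: "('w \<Rightarrow> real) \<Rightarrow> 'e \<Rightarrow> bool" where
  "admissible l b \<longleftrightarrow> l \<in> borel_measurable P \<and> (\<forall>w. 0 \<le> l w) \<and> b \<in> B"

text \<open>The essential infimum of the terms over all admissible pairs is the gauge of the convex hull of
  \<open>B\<close> and the unit ball of \<open>n\<close>.\<close>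
definition is_gauge_at :: "('e \<Rightarrow> 'w \<Rightarrow> real) \<Rightarrow> 'e \<Rightarrow> ('w \<Rightarrow> real) \<Rightarrow> bool" where
  "is_gauge_at n x q \<longleftrightarrow> q \<in> borel_measurable P \<and> (AE w in P. 0 \<le> q w) \<and>
     (\<forall>l b. admissible l b \<longrightarrow> (AE w in P. q w \<le> gauge_term n x l b w)) \<and>
     (\<forall>d\<in>borel_measurable P. (\<forall>w. 0 < d w) \<longrightarrow>
        (\<exists>l b. admissible l b \<and> (AE w in P. gauge_term n x l b w \<le> q w + d w)))"

lemma admissibleD:
  assumes "admissible l b"
  shows "l \<in> borel_measurable P" "0 \<le> l w" "b \<in> B" "b \<in> carrier E"
    "ract (\<lambda>w. - l w) b \<in> carrier E"
proof -
  show *: "l \<in> borel_measurable P" "0 \<le> l w" "b \<in> B" "b \<in> carrier E"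
    using assms B_sub by (auto simp: admissible_def)
  note [measurable] = *(1)
  show "ract (\<lambda>w. - l w) b \<in> carrier E" using *(4) by (intro act_closed) measurable
qed

lemma gauge_term_measurable:
  assumes n: "seminorm_fun n" and x: "x \<in> carrier E" and lb: "admissible l b"
  shows "gauge_term n x l b \<in> borel_measurable P"
proof -
  have "x \<oplus>\<^bsub>E\<^esub> ract (\<lambda>w. - l w) b \<in> carrier E" using x admissibleD[OF lb] by blast
  from seminorm_funD(1)[OF n this] show ?thesis
    unfolding gauge_term_def[abs_def] using admissibleD(1)[OF lb] by (intro borel_measurable_add)
qed

lemma gauge_term_nonneg:
  assumes n: "seminorm_fun n" and x: "x \<in> carrier E" and lb: "admissible l b"
  shows "AE w in P. 0 \<le> gauge_term n x l b w"
proof -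
  have "x \<oplus>\<^bsub>E\<^esub> ract (\<lambda>w. - l w) b \<in> carrier E" using x admissibleD[OF lb] by blast
  from seminorm_funD(2)[OF n this] show ?thesis
    unfolding gauge_term_def by eventually_elim (use admissibleD(2)[OF lb] in simp)
qed

lemma gauge_exists:
  assumes n: "seminorm_fun n" and x: "x \<in> carrier E"
  shows "\<exists>q. is_gauge_at n x q"
proof -
  define F where "F = {gauge_term n x l b | l b. admissible l b}"
  obtain b0 where "b0 \<in> B" using B_ne by blast
  then have "admissible (\<lambda>w. 0) b0" by (simp add: admissible_def)
  then have F: "F \<subseteq> borel_measurable P" "F \<noteq> {}"
    using gauge_term_measurable[OF n x] unfolding F_def by blast+
  have lower: "AE w in P. 0 \<le> f w" if "f \<in> F" for f
    using that gauge_term_nonneg[OF n x] unfolding F_def by blast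
  have 0: "(\<lambda>w. 0::real) \<in> borel_measurable P" by simp
  obtain q s where q [measurable]: "q \<in> borel_measurable P" and qF: "\<And>f. f \<in> F \<Longrightarrow> AE w in P. q w \<le> f w"
      and s: "range s \<subseteq> F" "AE w in P. \<forall>e>0. \<exists>n::nat. s n w < q w + e"
    using essinf_exists[OF F 0 lower] by blast
  have sF: "s i \<in> F" for i using s(1) by blast
  have q0: "AE w in P. 0 \<le> q w" by (rule essinf_greatest[OF s(2) lower[OF sF]])
  have "\<forall>i. \<exists>l b. admissible l b \<and> s i = gauge_term n x l b" using sF unfolding F_def by blast
  then obtain L b where Lb: "\<And>i. admissible (L i) (b i)" and sLb: "\<And>i. s i = gauge_term n x (L i) (b i)"
    by metis
  have att: "\<exists>l b. admissible l b \<and> (AE w in P. gauge_term n x l b w \<le> q w + d w)"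
    if d [measurable]: "d \<in> borel_measurable P" and d0: "\<And>w. 0 < d w" for d
  proof -
    have [measurable]: "s i \<in> borel_measurable P" for i using F sF by blast
    have [measurable]: "L i \<in> borel_measurable P" for i using admissibleD(1)[OF Lb] .
    \<comment> \<open>The first index of a near minimizer at \<open>w\<close>, which exists for
      almost every \<open>w\<close>. Its level sets partition the space, and along them the pairs
      \<open>(L i, b i)\<close> are glued to a single pair \<open>(l, c)\<close>.\<close>
    define k where "k w = (LEAST i. s i w < q w + d w)" for w
    have k [measurable]: "k \<in> measurable P (count_space UNIV)" unfolding k_def by measurable
    define l where "l w = L (k w) w" for w
    have l: "l \<in> borel_measurable P" unfolding l_def by (rule measurable_compose_countable[OF _ k]) measurable
    note [measurable] = l
    define A where "A i = {w\<in>space P. k w = i}" for i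
    have A [measurable]: "A i \<in> sets P" for i unfolding A_def by measurable
    have "range b \<subseteq> B" using admissibleD(3)[OF Lb] by blast
    then obtain c where c: "c \<in> B" "\<And>i. act (indicator (A i)) c = act (indicator (A i)) (b i)"
      using B_concat[OF _ k] unfolding A_def by blast
    have lc: "admissible l c" using l c admissibleD(2)[OF Lb] by (simp add: admissible_def l_def)
    have cC: "c \<in> carrier E" using c B_sub by blast
    have loc: "AE w in P. w \<in> A i \<longrightarrow> n (x \<oplus>\<^bsub>E\<^esub> ract (\<lambda>w. - l w) c) w = n (x \<oplus>\<^bsub>E\<^esub> ract (\<lambda>w. - L i w) (b i)) w" for i
    proof (rule seminorm_fun_local[OF n A])
      show m1: "x \<oplus>\<^bsub>E\<^esub> ract (\<lambda>w. - l w) c \<in> carrier E"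
        using x admissibleD(5)[OF lc] by blast
      show m2: "x \<oplus>\<^bsub>E\<^esub> ract (\<lambda>w. - L i w) (b i) \<in> carrier E"
        using x admissibleD(5)[OF Lb] by blast
      have ind: "(indicator (A i) :: 'w \<Rightarrow> 'k) \<in> borel_measurable P" by simp
      have L1: "(\<lambda>w. of_real (- L i w) :: 'k) \<in> borel_measurable P"
        and l1: "(\<lambda>w. of_real (- l w) :: 'k) \<in> borel_measurable P" by measurable
      have bC: "b i \<in> carrier E" using admissibleD(4)[OF Lb] .
      \<comment> \<open>On \<open>A i\<close> the glued coefficient \<open>l\<close> equals
        \<open>L i\<close>; off it both sides vanish.\<close>
      have "(\<lambda>w. indicator (A i) w * of_real (- l w)) = (\<lambda>w. of_real (- L i w) * indicator (A i) w :: 'k)"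
        by (auto simp: A_def l_def indicator_def)
      then have "act (indicator (A i)) (ract (\<lambda>w. - l w) c) = ract (\<lambda>w. - L i w) (act (indicator (A i)) c)"
        by (simp only: act_act[OF ind l1 cC] act_act[OF L1 ind cC])
      also have "\<dots> = ract (\<lambda>w. - L i w) (act (indicator (A i)) (b i))" by (simp only: c(2))
      also have "\<dots> = act (indicator (A i)) (ract (\<lambda>w. - L i w) (b i))"
        by (simp only: act_act[OF ind L1 bC] act_act[OF L1 ind bC] mult.commute)
      finally show "act (indicator (A i)) (x \<oplus>\<^bsub>E\<^esub> ract (\<lambda>w. - l w) c) =
          act (indicator (A i)) (x \<oplus>\<^bsub>E\<^esub> ract (\<lambda>w. - L i w) (b i))"
        by (simp only: act_add_right[OF ind x act_closed[OF l1 cC]] act_add_right[OF ind x act_closed[OF L1 bC]])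
    qed
    have "AE w in P. \<forall>i. w \<in> A i \<longrightarrow> n (x \<oplus>\<^bsub>E\<^esub> ract (\<lambda>w. - l w) c) w = n (x \<oplus>\<^bsub>E\<^esub> ract (\<lambda>w. - L i w) (b i)) w"
      using loc by (simp add: AE_all_countable)
    then have "AE w in P. gauge_term n x l c w \<le> q w + d w"
      using s(2) AE_space
    proof eventually_elim
      case (elim w)
      have "\<exists>i. s i w < q w + d w" using elim(2) d0[of w] by blast
      then have "s (k w) w < q w + d w" unfolding k_def by (rule LeastI_ex)
      moreover have "w \<in> A (k w)" using elim(3) by (simp add: A_def)
      then have "gauge_term n x l c w = s (k w) w"
        using elim(1) by (simp add: sLb gauge_term_def l_def)
      ultimately show ?case by simp
    qed
    with lc show ?thesis by blast
  qed
  have "is_gauge_at n x q"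
    unfolding is_gauge_at_def using q q0 qF att unfolding F_def by blast
  then show ?thesis by blast
qed

section \<open>The gauge as a seminorm\<close>

definition gauge_fun :: "('e \<Rightarrow> 'w \<Rightarrow> real) \<Rightarrow> 'e \<Rightarrow> 'w \<Rightarrow> real" where
  "gauge_fun n x = (SOME q. is_gauge_at n x q)"

lemma gaugeD:
  assumes n: "seminorm_fun n" and x: "x \<in> carrier E"
  shows "gauge_fun n x \<in> borel_measurable P" "AE w in P. 0 \<le> gauge_fun n x w"
    "admissible l b \<Longrightarrow> AE w in P. gauge_fun n x w \<le> gauge_term n x l b w"
    "d \<in> borel_measurable P \<Longrightarrow> (\<And>w. 0 < d w) \<Longrightarrow>
      \<exists>l b. admissible l b \<and> (AE w in P. gauge_term n x l b w \<le> gauge_fun n x w + d w)"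
proof -
  have "is_gauge_at n x (gauge_fun n x)"
    unfolding gauge_fun_def by (rule someI_ex[OF gauge_exists[OF n x]])
  then show "gauge_fun n x \<in> borel_measurable P" "AE w in P. 0 \<le> gauge_fun n x w"
    "admissible l b \<Longrightarrow> AE w in P. gauge_fun n x w \<le> gauge_term n x l b w"
    "d \<in> borel_measurable P \<Longrightarrow> (\<And>w. 0 < d w) \<Longrightarrow>
      \<exists>l b. admissible l b \<and> (AE w in P. gauge_term n x l b w \<le> gauge_fun n x w + d w)"
    unfolding is_gauge_at_def by blast+
qed

text \<open>The coefficient \<open>l = 0\<close> is admissible. This bound is what later makes a
  functional dominated by the gauge continuous.\<close>

lemma gauge_le_seminorm:
  assumes n: "seminorm_fun n" and x: "x \<in> carrier E"
  shows "AE w in P. gauge_fun n x w \<le> n x w"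
proof -
  obtain b where b: "b \<in> B" using B_ne by blast
  then have "admissible (\<lambda>w. 0) b" by (simp add: admissible_def)
  from gaugeD(3)[OF n x this] show ?thesis
    using b B_sub x by (simp add: gauge_term_def subset_iff)
qed

text \<open>The pair \<open>(1, b)\<close> reaches \<open>b\<close> exactly. Functionals dominated
  by the gauge are therefore bounded by one on \<open>B\<close>.\<close>

lemma gauge_le_one:
  assumes n: "seminorm_fun n" and b: "b \<in> B"
  shows "AE w in P. gauge_fun n b w \<le> 1"
proof -
  have bC: "b \<in> carrier E" using b B_sub by blast
  have "b \<oplus>\<^bsub>E\<^esub> ract (\<lambda>w. - 1) b = \<zero>\<^bsub>E\<^esub>"
    using act_add_left[of "\<lambda>w. 1" "\<lambda>w. -1" b] bC by simp
  moreover have "admissible (\<lambda>w. 1) b" using b by (simp add: admissible_def)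
  ultimately have "AE w in P. gauge_fun n b w \<le> 1 + n \<zero>\<^bsub>E\<^esub> w"
    using gaugeD(3)[OF n bC, of "\<lambda>w. 1" b] by (simp add: gauge_term_def)
  with seminorm_fun_zero[OF n] show ?thesis by eventually_elim simp
qed

text \<open>Near optimal pairs \<open>(l, b)\<close> and \<open>(m, c)\<close> combine to
  \<open>(l + m, a)\<close>, where the convex combination \<open>a\<close> of \<open>b\<close> and
  \<open>c\<close> satisfies \<open>(l + m) a = l b + m c\<close>.\<close>

lemma gauge_triangle:
  assumes n: "seminorm_fun n" and x: "x \<in> carrier E" and y: "y \<in> carrier E"
  shows "AE w in P. gauge_fun n (x \<oplus>\<^bsub>E\<^esub> y) w \<le> gauge_fun n x w + gauge_fun n y w"
proof (rule AE_le_add_eps)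
  fix e :: real assume e: "0 < e"
  have d: "(\<lambda>w. e / 2) \<in> borel_measurable P" "\<And>w. 0 < e / 2" using e by auto
  obtain l b where lb: "admissible l b" and le1: "AE w in P. gauge_term n x l b w \<le> gauge_fun n x w + e / 2"
    using gaugeD(4)[OF n x d] by blast
  obtain m c where mc: "admissible m c" and le2: "AE w in P. gauge_term n y m c w \<le> gauge_fun n y w + e / 2"
    using gaugeD(4)[OF n y d] by blast
  note [measurable] = admissibleD(1)[OF lb] admissibleD(1)[OF mc]
  note C = admissibleD(4)[OF lb] admissibleD(4)[OF mc]
  \<comment> \<open>Where \<open>l + m = 0\<close>, division returns \<open>0\<close>; both
    coefficients vanish there, so the identities \<open>r1\<close> and \<open>r2\<close> below still
    hold.\<close>
  define r where "r w = l w / (l w + m w)" for w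
  have r [measurable]: "r \<in> borel_measurable P" unfolding r_def by measurable
  have lm: "0 \<le> l w" "0 \<le> m w" for w using admissibleD(2) lb mc by auto
  have r01: "0 \<le> r w \<and> r w \<le> 1" for w
    using lm[of w] by (auto simp: r_def divide_le_eq_1)
  define a where "a = ract r b \<oplus>\<^bsub>E\<^esub> ract (\<lambda>w. 1 - r w) c"
  have a: "a \<in> B" unfolding a_def
    by (rule B_convex) (use r r01 lb mc in \<open>auto simp: admissible_def\<close>)
  have adm: "admissible (\<lambda>w. l w + m w) a" using a lm by (simp add: admissible_def)
  have r1: "(l w + m w) * r w = l w" and r2: "(l w + m w) * (1 - r w) = m w" for w
  proof -
    have "l w = 0 \<and> m w = 0 \<or> l w + m w \<noteq> 0" using lm[of w] by linarith
    then show *: "(l w + m w) * r w = l w" by (auto simp: r_def)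
    then show "(l w + m w) * (1 - r w) = m w" by (simp add: right_diff_distrib)
  qed
  let ?R = "\<lambda>f w. of_real (f w) :: 'k"
  have m1: "?R (\<lambda>w. - (l w + m w)) \<in> borel_measurable P" and m2: "?R r \<in> borel_measurable P"
    and m3: "?R (\<lambda>w. 1 - r w) \<in> borel_measurable P" by measurable
  have "ract (\<lambda>w. - (l w + m w)) a = act (\<lambda>w. ?R (\<lambda>w. - (l w + m w)) w * ?R r w) b
      \<oplus>\<^bsub>E\<^esub> act (\<lambda>w. ?R (\<lambda>w. - (l w + m w)) w * ?R (\<lambda>w. 1 - r w) w) c"
    unfolding a_def
    by (simp only: act_add_right[OF m1 act_closed[OF m2 C(1)] act_closed[OF m3 C(2)]]
        act_act[OF m1 m2 C(1)] act_act[OF m1 m3 C(2)])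
  also have "\<dots> = ract (\<lambda>w. - l w) b \<oplus>\<^bsub>E\<^esub> ract (\<lambda>w. - m w) c"
    by (simp only: of_real_mult[symmetric] mult_minus_left r1 r2)
  finally have eq: "ract (\<lambda>w. - (l w + m w)) a = ract (\<lambda>w. - l w) b \<oplus>\<^bsub>E\<^esub> ract (\<lambda>w. - m w) c" .
  let ?u = "x \<oplus>\<^bsub>E\<^esub> ract (\<lambda>w. - l w) b" and ?v = "y \<oplus>\<^bsub>E\<^esub> ract (\<lambda>w. - m w) c"
  have uv: "?u \<in> carrier E" "?v \<in> carrier E" using x y admissibleD(5)[OF lb] admissibleD(5)[OF mc] by auto
  have "(x \<oplus>\<^bsub>E\<^esub> y) \<oplus>\<^bsub>E\<^esub> ract (\<lambda>w. - (l w + m w)) a = ?u \<oplus>\<^bsub>E\<^esub> ?v"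
    unfolding eq using x y admissibleD(5)[OF lb] admissibleD(5)[OF mc] by (simp only: M.a_ac M.a_closed)
  then have "AE w in P. gauge_term n (x \<oplus>\<^bsub>E\<^esub> y) (\<lambda>w. l w + m w) a w \<le> l w + m w + (n ?u w + n ?v w)"
    unfolding gauge_term_def using seminorm_funD(4)[OF n uv] by simp
  then show "AE w in P. gauge_fun n (x \<oplus>\<^bsub>E\<^esub> y) w \<le> gauge_fun n x w + gauge_fun n y w + e"
    using le1 le2 gaugeD(3)[OF n M.a_closed[OF x y] adm]
  proof eventually_elim
    case (elim w)
    then show ?case unfolding gauge_term_def by linarith
  qed
qed

lemma gauge_act_le:
  assumes n: "seminorm_fun n" and x: "x \<in> carrier E" and f [measurable]: "f \<in> borel_measurable P"
  shows "AE w in P. gauge_fun n (act f x) w \<le> norm (f w) * gauge_fun n x w"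
proof (rule AE_le_add_eps)
  fix e :: real assume e: "0 < e"
  \<comment> \<open>The tolerance is divided by \<open>1 + norm (f w)\<close> since the estimate is
    multiplied by \<open>norm (f w)\<close> in the end; the summand \<open>1\<close> keeps the
    divisor positive.\<close>
  have d: "(\<lambda>w. e / (1 + norm (f w))) \<in> borel_measurable P" by measurable
  have d0: "0 < e / (1 + norm (f w))" for w using e by (intro divide_pos_pos) (auto intro: add_pos_nonneg)
  obtain l b where lb: "admissible l b"
    and le: "AE w in P. gauge_term n x l b w \<le> gauge_fun n x w + e / (1 + norm (f w))"
    using gaugeD(4)[OF n x d d0] by blast
  note [measurable] = admissibleD(1)[OF lb]
  have sg: "(\<lambda>w. sgn (f w)) \<in> borel_measurable P" unfolding sgn_div_norm by measurable
  \<comment> \<open>The modulus of \<open>f\<close> goes into the coefficient and its phase into the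
    balanced set \<open>B\<close>, so that their product with \<open>l\<close> and \<open>b\<close>
    is again \<open>f * l * b\<close>.\<close>
  have adm: "admissible (\<lambda>w. norm (f w) * l w) (act (\<lambda>w. sgn (f w)) b)"
    unfolding admissible_def
    using admissibleD(2,3)[OF lb] B_balanced[OF sg _ admissibleD(3)[OF lb]] by (simp add: norm_sgn)
  have C: "b \<in> carrier E" "ract (\<lambda>w. - l w) b \<in> carrier E" using admissibleD[OF lb] by auto
  have ml: "(\<lambda>w. of_real (- l w) :: 'k) \<in> borel_measurable P"
    and mn: "(\<lambda>w. of_real (- (norm (f w) * l w)) :: 'k) \<in> borel_measurable P" by measurable
  have fe: "(\<lambda>w. of_real (- (norm (f w) * l w)) * sgn (f w)) = (\<lambda>w. f w * of_real (- l w))"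
  proof
    fix w
    have "f w = norm (f w) *\<^sub>R sgn (f w)"
      by (cases "f w = 0") (simp_all add: sgn_div_norm)
    then have "f w = of_real (norm (f w)) * sgn (f w)" by (simp add: scaleR_conv_of_real)
    then show "of_real (- (norm (f w) * l w)) * sgn (f w) = f w * of_real (- l w)"
      by (metis (no_types, opaque_lifting) mult.assoc mult.commute mult_minus_left of_real_minus of_real_mult)
  qed
  have "ract (\<lambda>w. - (norm (f w) * l w)) (act (\<lambda>w. sgn (f w)) b) = act f (ract (\<lambda>w. - l w) b)"
    by (simp only: act_act[OF mn sg C(1)] act_act[OF f ml C(1)] fe)
  then have eq: "act f x \<oplus>\<^bsub>E\<^esub> ract (\<lambda>w. - (norm (f w) * l w)) (act (\<lambda>w. sgn (f w)) b) = act f (x \<oplus>\<^bsub>E\<^esub> ract (\<lambda>w. - l w) b)"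
    using x f C by (simp only: act_add_right)
  have "AE w in P. n (act f (x \<oplus>\<^bsub>E\<^esub> ract (\<lambda>w. - l w) b)) w = norm (f w) * n (x \<oplus>\<^bsub>E\<^esub> ract (\<lambda>w. - l w) b) w"
    by (rule seminorm_funD(3)[OF n f]) (use x C in blast)
  with gaugeD(3)[OF n act_closed[OF f x] adm] le
  show "AE w in P. gauge_fun n (act f x) w \<le> norm (f w) * gauge_fun n x w + e"
  proof eventually_elim
    case (elim w)
    have "gauge_fun n (act f x) w \<le> norm (f w) * gauge_term n x l b w"
      using elim(1,3) unfolding gauge_term_def eq by (simp add: distrib_left)
    also have "\<dots> \<le> norm (f w) * (gauge_fun n x w + e / (1 + norm (f w)))"
      using elim(2) by (intro mult_left_mono) auto
    also have "\<dots> = norm (f w) * gauge_fun n x w + e * (norm (f w) / (1 + norm (f w)))"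
      by (simp add: distrib_left)
    also have "\<dots> \<le> norm (f w) * gauge_fun n x w + e * 1"
      using e by (intro add_left_mono mult_left_mono) (auto simp: divide_le_eq_1 intro: add_pos_nonneg)
    finally show ?case by simp
  qed
qed

text \<open>The missing inequality comes from \<open>gauge_act_le\<close> for the inverse of
  \<open>f\<close>, which undoes \<open>f\<close> where it is nonzero; the indicator
  \<open>i\<close> of the zero set restores the rest of \<open>x\<close>.\<close>

lemma gauge_act:
  assumes n: "seminorm_fun n" and x: "x \<in> carrier E" and f [measurable]: "f \<in> borel_measurable P"
  shows "AE w in P. gauge_fun n (act f x) w = norm (f w) * gauge_fun n x w"
proof -
  define z where "z w = inverse (f w)" for w
  define i where "i w = (if f w = 0 then 1 else 0 :: 'k)" for w
  have z [measurable]: "z \<in> borel_measurable P" unfolding z_def by measurable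
  have i [measurable]: "i \<in> borel_measurable P" unfolding i_def by measurable
  have zf: "(\<lambda>w. z w * f w + i w) = (\<lambda>w. 1)" by (auto simp: z_def i_def)
  have "act z (act f x) \<oplus>\<^bsub>E\<^esub> act i x = act (\<lambda>w. z w * f w + i w) x"
    using x by (simp add: act_act act_add_left)
  also have "\<dots> = x" unfolding zf using x by simp
  finally have "AE w in P. gauge_fun n x w \<le> gauge_fun n (act z (act f x)) w + gauge_fun n (act i x) w"
    using gauge_triangle[OF n act_closed[OF z act_closed[OF f x]] act_closed[OF i x]] by simp
  with gauge_act_le[OF n act_closed[OF f x] z] gauge_act_le[OF n x i] gauge_act_le[OF n x f]
    gaugeD(2)[OF n act_closed[OF f x]]
  show ?thesis
  proof eventually_elim
    case (elim w)
    show ?case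
    proof (cases "f w = 0")
      case True
      then show ?thesis using elim(3,4) by simp
    next
      case False
      then have "gauge_fun n x w \<le> gauge_fun n (act f x) w / norm (f w)"
        using elim(1,2,5) by (simp add: z_def i_def norm_inverse divide_inverse mult.commute)
      then have "norm (f w) * gauge_fun n x w \<le> gauge_fun n (act f x) w"
        using False by (simp add: field_simps)
      with elim(3) show ?thesis by simp
    qed
  qed
qed

lemma seminorm_fun_gauge: "seminorm_fun n \<Longrightarrow> seminorm_fun (gauge_fun n)"
  unfolding seminorm_fun_def[of "gauge_fun n"]
  by (intro conjI ballI gaugeD(1,2) gauge_act gauge_triangle; assumption)

text \<open>With \<open>z = 1 / (1 + d)\<close> and \<open>r = z l\<close> one has
  \<open>x - r b = z (x - l b) + (1 - z) x\<close>. The coefficient \<open>r\<close> is at most one,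
  so \<open>r b\<close> stays in \<open>B\<close>, and each of the two summands contributes at most
  \<open>1\<close>.\<close>

lemma gauge_le_one_approx:
  assumes n: "seminorm_fun n" and x: "x \<in> carrier E" and le: "AE w in P. gauge_fun n x w \<le> 1"
  obtains b where "b \<in> B" "AE w in P. n (x \<oplus>\<^bsub>E\<^esub> ract (\<lambda>w. - 1) b) w \<le> 2"
proof -
  note nx [measurable] = seminorm_funD(1)[OF n x]
  \<comment> \<open>Chosen so that \<open>d * n x \<le> 1\<close>, which bounds the second summand.
    The tolerance has to be random because \<open>n x\<close> need not be bounded.\<close>
  define d where "d w = 1 / (1 + \<bar>n x w\<bar>)" for w
  have d [measurable]: "d \<in> borel_measurable P" unfolding d_def by measurable
  have d0: "0 < d w" for w by (simp add: d_def add_pos_nonneg)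
  obtain l b where lb: "admissible l b" and le1: "AE w in P. gauge_term n x l b w \<le> gauge_fun n x w + d w"
    using gaugeD(4)[OF n x d d0] by blast
  note [measurable] = admissibleD(1)[OF lb]
  \<comment> \<open>The minimum is inactive almost surely, since \<open>l \<le> 1 + d\<close> there;
    it places \<open>r\<close> in the unit interval at every point.\<close>
  define r where "r w = min 1 (l w / (1 + d w))" for w
  have r [measurable]: "r \<in> borel_measurable P" unfolding r_def by measurable
  have r01: "0 \<le> r w" "r w \<le> 1" for w
    using admissibleD(2)[OF lb, of w] d0[of w] by (auto simp: r_def)
  have C: "b \<in> carrier E" "ract (\<lambda>w. - l w) b \<in> carrier E" using admissibleD[OF lb] by auto
  define z where "z w = 1 / (1 + d w)" for w
  have z [measurable]: "z \<in> borel_measurable P" unfolding z_def by measurable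
  have xl: "x \<oplus>\<^bsub>E\<^esub> ract (\<lambda>w. - l w) b \<in> carrier E" using x C by blast
  have rB: "ract r b \<in> B"
    by (rule B_balanced) (use r01 admissibleD(3)[OF lb] in auto)
  have l_le: "AE w in P. l w \<le> 1 + d w"
    using le le1 seminorm_funD(2)[OF n xl]
  proof eventually_elim
    case (elim w) then show ?case unfolding gauge_term_def by linarith
  qed
  have rz: "AE w in P. (of_real (- r w) :: 'k) = of_real (z w * - l w)"
    using l_le
  proof eventually_elim
    case (elim w)
    have "l w / (1 + d w) \<le> 1" using elim d0[of w] by (simp add: divide_le_eq_1)
    then have "r w = l w / (1 + d w)" by (simp add: r_def)
    then show ?case by (simp add: z_def)
  qed
  have "ract (\<lambda>w. - 1) (ract r b) = ract (\<lambda>w. - r w) b"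
    using C by (simp add: act_act)
  also have "\<dots> = ract (\<lambda>w. z w * - l w) b" by (rule act_cong[OF _ _ rz]) measurable
  also have "\<dots> = ract z (ract (\<lambda>w. - l w) b)" using C by (simp add: act_act)
  finally have e1: "ract (\<lambda>w. - 1) (ract r b) = ract z (ract (\<lambda>w. - l w) b)" .
  have zz: "(\<lambda>w. of_real (z w) + of_real (1 - z w) :: 'k) = (\<lambda>w. 1)" by simp
  have m1: "(\<lambda>w. of_real (z w) :: 'k) \<in> borel_measurable P" "(\<lambda>w. of_real (1 - z w) :: 'k) \<in> borel_measurable P"
    by measurable
  have "x = ract z x \<oplus>\<^bsub>E\<^esub> ract (\<lambda>w. 1 - z w) x"
    using act_add_left[OF m1 x] unfolding zz using x by simp
  then have "x \<oplus>\<^bsub>E\<^esub> ract (\<lambda>w. - 1) (ract r b)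
      = (ract z x \<oplus>\<^bsub>E\<^esub> ract (\<lambda>w. 1 - z w) x) \<oplus>\<^bsub>E\<^esub> ract z (ract (\<lambda>w. - l w) b)"
    unfolding e1 by simp
  also have "\<dots> = ract z (x \<oplus>\<^bsub>E\<^esub> ract (\<lambda>w. - l w) b) \<oplus>\<^bsub>E\<^esub> ract (\<lambda>w. 1 - z w) x"
    unfolding act_add_right[OF m1(1) x C(2)]
    using act_closed[OF m1(1) x] act_closed[OF m1(2) x] act_closed[OF m1(1) C(2)]
    by (simp only: M.a_ac M.a_closed)
  finally have e2: "x \<oplus>\<^bsub>E\<^esub> ract (\<lambda>w. - 1) (ract r b)
      = ract z (x \<oplus>\<^bsub>E\<^esub> ract (\<lambda>w. - l w) b) \<oplus>\<^bsub>E\<^esub> ract (\<lambda>w. 1 - z w) x" .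
  have "AE w in P. n (x \<oplus>\<^bsub>E\<^esub> ract (\<lambda>w. - 1) (ract r b)) w \<le> 2"
    unfolding e2
    using seminorm_funD(4)[OF n act_closed[OF m1(1) xl] act_closed[OF m1(2) x]]
      seminorm_funD(3)[OF n m1(1) xl] seminorm_funD(3)[OF n m1(2) x] le le1 seminorm_funD(2)[OF n x]
      seminorm_funD(2)[OF n xl]
  proof eventually_elim
    case (elim w)
    let ?u = "n (x \<oplus>\<^bsub>E\<^esub> ract (\<lambda>w. - l w) b) w"
    have z01: "0 \<le> z w" "z w \<le> 1" using d0[of w] by (auto simp: z_def divide_le_eq_1)
    have "?u \<le> 1 + d w" using elim(4,5) admissibleD(2)[OF lb, of w] unfolding gauge_term_def by linarith
    then have 1: "z w * ?u \<le> 1" using d0[of w] by (simp add: z_def divide_le_eq_1)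
    have "1 - z w \<le> d w" using d0[of w] by (simp add: z_def field_simps)
    then have "(1 - z w) * n x w \<le> d w * n x w" using elim(6) by (intro mult_right_mono)
    also have "\<dots> \<le> 1" using elim(6) by (simp add: d_def divide_le_eq_1)
    finally have 2: "(1 - z w) * n x w \<le> 1" .
    have "\<bar>1 - z w\<bar> = 1 - z w" "\<bar>z w\<bar> = z w" using z01 by auto
    then show ?case using elim(1-3) 1 2 by (simp only: norm_of_real)
  qed
  with rB show thesis by (rule that)
qed

end


section \<open>The dual module\<close>

lemma
  fixes X Y :: "('w \<Rightarrow> 'k::{real_normed_field, second_countable_topology}) set"
  assumes X: "X \<in> carrier (L0 P)" and Y: "Y \<in> carrier (L0 P)"
  shows rep_add: "AE w in P. rep (X \<oplus>\<^bsub>L0 P\<^esub> Y) w = rep X w + rep Y w"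
    and rep_mult: "AE w in P. rep (X \<otimes>\<^bsub>L0 P\<^esub> Y) w = rep X w * rep Y w"
    and rep_abs: "AE w in P. rep (L0_abs P X) w = norm (rep X w)"
    and add_L0_closed: "X \<oplus>\<^bsub>L0 P\<^esub> Y \<in> carrier (L0 P)"
    and mult_L0_closed: "X \<otimes>\<^bsub>L0 P\<^esub> Y \<in> carrier (L0 P)"
proof -
  note [measurable] = rep_measurable[OF X] rep_measurable[OF Y]
  have 1: "X \<oplus>\<^bsub>L0 P\<^esub> Y = ae_class P (\<lambda>w. rep X w + rep Y w)"
    using ae_class_add[OF rep_measurable[OF X] rep_measurable[OF Y]] X Y by simp
  have 2: "X \<otimes>\<^bsub>L0 P\<^esub> Y = ae_class P (\<lambda>w. rep X w * rep Y w)"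
    using ae_class_mult[OF rep_measurable[OF X] rep_measurable[OF Y]] X Y by simp
  show "AE w in P. rep (X \<oplus>\<^bsub>L0 P\<^esub> Y) w = rep X w + rep Y w"
    "AE w in P. rep (X \<otimes>\<^bsub>L0 P\<^esub> Y) w = rep X w * rep Y w"
    unfolding 1 2 by (rule rep_ae_class, measurable)+
  show "AE w in P. rep (L0_abs P X) w = norm (rep X w)"
    unfolding L0_abs_def by (rule rep_ae_class) measurable
  show "X \<oplus>\<^bsub>L0 P\<^esub> Y \<in> carrier (L0 P)" "X \<otimes>\<^bsub>L0 P\<^esub> Y \<in> carrier (L0 P)"
    unfolding 1 2 by auto
qed

lemma (in prob_space) seminorm_topology_abs:
  "seminorm_topology M (L0 M :: (('a \<Rightarrow> 'k::{real_normed_field, second_countable_topology}) set, _) module) {L0_abs M}"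
proof
  interpret G: abelian_group "L0 M :: (('a \<Rightarrow> 'k) set, _) module" by (rule abelian_group_L0)
  fix X Y :: "('a \<Rightarrow> 'k) set" and N :: "('a \<Rightarrow> 'k) set \<Rightarrow> ('a \<Rightarrow> real) set"
  show "\<zero>\<^bsub>L0 M\<^esub> \<in> carrier (L0 M :: (('a \<Rightarrow> 'k) set, _) module)" by simp
  show "AE w in M. rep (N \<zero>\<^bsub>L0 M\<^esub>) w \<le> 0" if "N \<in> {L0_abs M}"
  proof -
    have "AE w in M. rep (\<zero>\<^bsub>L0 M\<^esub> :: ('a \<Rightarrow> 'k) set) w = 0" unfolding zero_L0 by (rule rep_ae_class) simp
    with rep_abs[OF G.zero_closed G.zero_closed] show ?thesis using that by auto
  qed
  assume X: "X \<in> carrier (L0 M)"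
  then show "\<zero>\<^bsub>L0 M\<^esub> \<oplus>\<^bsub>L0 M\<^esub> X = X" by simp
  show "N X \<in> carrier (L0_plus M)" if "N \<in> {L0_abs M}" using L0_abs_closed[OF X] that by simp
  assume Y: "Y \<in> carrier (L0 M)"
  show "X \<oplus>\<^bsub>L0 M\<^esub> Y \<in> carrier (L0 M)" using X Y by simp
  show "AE w in M. rep (N (X \<oplus>\<^bsub>L0 M\<^esub> Y)) w \<le> rep (N X) w + rep (N Y) w" if "N \<in> {L0_abs M}"
  proof -
    have N: "N = L0_abs M" using that by simp
    show ?thesis
      unfolding N using rep_add[OF X Y] rep_abs[OF X X] rep_abs[OF Y Y] rep_abs[OF G.add.m_closed[OF X Y] X]
      by eventually_elim (simp add: norm_triangle_ineq)
  qed
qed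

locale random_lc_module = random_module P E
  for P :: "'w measure"
    and E :: "(('w \<Rightarrow> 'k::{real_normed_field, second_countable_topology}) set, 'e) module" +
  fixes \<N> :: "('e \<Rightarrow> ('w \<Rightarrow> real) set) set"
  assumes seminorms: "N \<in> \<N> \<Longrightarrow> L0_seminorm P E N"
begin

lemma seminorm_fun_rep:
  assumes N: "N \<in> \<N>"
  shows "seminorm_fun (\<lambda>x. rep (N x))"
proof -
  have sub: "L0_le P (N (x \<oplus>\<^bsub>E\<^esub> y)) (N x \<oplus>\<^bsub>L0 P\<^esub> N y)" if "x \<in> carrier E" "y \<in> carrier E" for x y
    using seminorms[OF N] that by (auto simp: L0_seminorm_def)
  have hom: "N (\<xi> \<odot>\<^bsub>E\<^esub> x) = L0_abs P \<xi> \<otimes>\<^bsub>L0 P\<^esub> N x" if "\<xi> \<in> carrier (L0 P)" "x \<in> carrier E" for \<xi> x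
    using seminorms[OF N] that by (auto simp: L0_seminorm_def)
  have "N x \<in> carrier (L0_plus P)" if "x \<in> carrier E" for x
    using seminorms[OF N] that by (auto simp: L0_seminorm_def)
  then have c: "N x \<in> carrier (L0 P)" and pos: "AE w in P. 0 \<le> rep (N x) w" if "x \<in> carrier E" for x
    using that by (auto simp: carrier_L0_plus)
  show ?thesis
    unfolding seminorm_fun_def
  proof (intro conjI ballI)
    fix x assume x: "x \<in> carrier E"
    show "rep (N x) \<in> borel_measurable P" using c[OF x] by blast
    show "AE w in P. 0 \<le> rep (N x) w" by (rule pos[OF x])
    fix y assume y: "y \<in> carrier E"
    show "AE w in P. rep (N (x \<oplus>\<^bsub>E\<^esub> y)) w \<le> rep (N x) w + rep (N y) w"
      using sub[OF x y] rep_add[OF c[OF x] c[OF y]] unfolding L0_le_def by eventually_elim simp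
  next
    fix f :: "'w \<Rightarrow> 'k" and x assume f [measurable]: "f \<in> borel_measurable P" and x: "x \<in> carrier E"
    have a: "ae_class P (\<lambda>w. norm (f w)) \<in> carrier (L0 P)" by simp
    have "N (act f x) = ae_class P (\<lambda>w. norm (f w)) \<otimes>\<^bsub>L0 P\<^esub> N x"
      unfolding act_def using hom[OF _ x] f by (simp add: ae_class_abs)
    moreover have "AE w in P. rep (ae_class P (\<lambda>w. norm (f w))) w = norm (f w)" by (rule rep_ae_class) simp
    ultimately show "AE w in P. rep (N (act f x)) w = norm (f w) * rep (N x) w"
      using rep_mult[OF a c[OF x]] by (auto elim: eventually_elim2)
  qed
qed

sublocale top: seminorm_topology P E \<N>
proof
  fix N x assume N: "N \<in> \<N>"
  show "AE w in P. rep (N \<zero>\<^bsub>E\<^esub>) w \<le> 0"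
    using seminorm_fun_zero[OF seminorm_fun_rep[OF N]] by eventually_elim simp
  assume x: "x \<in> carrier E"
  then show "N x \<in> carrier (L0_plus P)" using seminorms[OF N] by (auto simp: L0_seminorm_def)
  fix y assume y: "y \<in> carrier E"
  show "AE w in P. rep (N (x \<oplus>\<^bsub>E\<^esub> y)) w \<le> rep (N x) w + rep (N y) w"
    by (rule seminorm_funD(4)[OF seminorm_fun_rep[OF N] x y])
qed auto

sublocale abs: seminorm_topology P "L0 P :: (('w \<Rightarrow> 'k) set, ('w \<Rightarrow> 'k) set) module" "{L0_abs P}"
  by (rule seminorm_topology_abs)

section \<open>Continuity of functionals as boundedness near zero\<close>

abbreviation "D \<equiv> dual_module P E \<N>"

definition bounded_fun :: "('e \<Rightarrow> 'w \<Rightarrow> 'k) \<Rightarrow> bool" where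
  "bounded_fun g \<longleftrightarrow> (\<exists>Q e. finite Q \<and> Q \<subseteq> \<N> \<and> e \<in> borel_measurable P \<and> (\<forall>w. 0 < e w) \<and>
     (\<forall>y\<in>carrier E. (\<forall>N\<in>Q. AE w in P. rep (N y) w \<le> e w) \<longrightarrow> (AE w in P. norm (g y w) \<le> 1)))"

text \<open>The homogeneous form of \<open>bounded_fun\<close>: the target radius is any positive
  random variable \<open>h\<close> instead of \<open>1\<close>, and the radius at the source scales
  with it. Continuity for these topologies has to answer random radii.\<close>

definition controlled :: "('e \<Rightarrow> ('w \<Rightarrow> real) set) set \<Rightarrow> ('w \<Rightarrow> real) \<Rightarrow> ('e \<Rightarrow> 'w \<Rightarrow> 'k) \<Rightarrow> bool" where
  "controlled Q e g \<longleftrightarrow> finite Q \<and> Q \<subseteq> \<N> \<and> e \<in> borel_measurable P \<and> (\<forall>w. 0 < e w) \<and>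
     (\<forall>y\<in>carrier E. \<forall>h\<in>borel_measurable P. (\<forall>w. 0 < h w) \<longrightarrow>
       (\<forall>N\<in>Q. AE w in P. rep (N y) w \<le> e w * h w) \<longrightarrow> (AE w in P. norm (g y w) \<le> h w))"

lemma controlledD:
  assumes "controlled Q e g"
  shows "finite Q" "Q \<subseteq> \<N>" "e \<in> borel_measurable P" "0 < e w"
    "y \<in> carrier E \<Longrightarrow> h \<in> borel_measurable P \<Longrightarrow> (\<And>w. 0 < h w) \<Longrightarrow>
      (\<And>N. N \<in> Q \<Longrightarrow> AE w in P. rep (N y) w \<le> e w * h w) \<Longrightarrow> AE w in P. norm (g y w) \<le> h w"
  using assms by (simp_all add: controlled_def)

text \<open>Dividing \<open>y\<close> by \<open>h\<close> reduces the target radius \<open>h\<close>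
  to one; this is possible because the reciprocal of \<open>h\<close> is itself a scalar.\<close>

lemma bounded_fun_controlled:
  assumes g: "linear_fun g" "bounded_fun g"
  obtains Q e where "controlled Q e g"
proof -
  obtain Q e where Q: "finite Q" "Q \<subseteq> \<N>" and e: "e \<in> borel_measurable P" "\<And>w. 0 < e w"
    and le: "\<forall>y\<in>carrier E. (\<forall>N\<in>Q. AE w in P. rep (N y) w \<le> e w) \<longrightarrow> (AE w in P. norm (g y w) \<le> 1)"
    using g(2) unfolding bounded_fun_def by blast
  have "controlled Q e g"
    unfolding controlled_def
  proof (intro conjI ballI allI impI Q e)
    fix y h assume y: "y \<in> carrier E" and h [measurable]: "h \<in> borel_measurable P" and h0: "\<forall>w. 0 < h w"
      and N: "\<forall>N\<in>Q. AE w in P. rep (N y) w \<le> e w * h w"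
    have m: "(\<lambda>w. of_real (1 / h w) :: 'k) \<in> borel_measurable P" by measurable
    have "AE w in P. norm (g (ract (\<lambda>w. 1 / h w) y) w) \<le> 1"
    proof (rule le[rule_format, OF act_closed[OF m y]])
      fix N' assume N': "N' \<in> Q"
      then have "seminorm_fun (\<lambda>x. rep (N' x))" using Q seminorm_fun_rep by blast
      from seminorm_funD(3)[OF this m y] N[rule_format, OF N']
      show "AE w in P. rep (N' (ract (\<lambda>w. 1 / h w) y)) w \<le> e w"
      proof eventually_elim
        case (elim w)
        have "norm (of_real (1 / h w) :: 'k) = 1 / h w" using h0[rule_format, of w] by (simp only: norm_of_real) simp
        then show ?case using elim h0[rule_format, of w] by (simp add: divide_le_eq)
      qed
    qed
    with linear_funD(2)[OF g(1) m y] show "AE w in P. norm (g y w) \<le> h w"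
    proof eventually_elim
      case (elim w)
      have "norm (of_real (1 / h w) :: 'k) = 1 / h w" using h0[rule_format, of w] by (simp only: norm_of_real) simp
      then show ?case using elim h0[rule_format, of w] by (simp add: norm_mult norm_divide divide_le_eq)
    qed
  qed
  then show thesis by (rule that)
qed

lemma linear_iff:
  assumes G: "G \<in> carrier E \<rightarrow> carrier (L0 P)"
  shows "((\<forall>x\<in>carrier E. \<forall>y\<in>carrier E. G (x \<oplus>\<^bsub>E\<^esub> y) = G x \<oplus>\<^bsub>L0 P\<^esub> G y) \<and>
     (\<forall>\<xi>\<in>carrier (L0 P). \<forall>x\<in>carrier E. G (\<xi> \<odot>\<^bsub>E\<^esub> x) = \<xi> \<otimes>\<^bsub>L0 P\<^esub> G x))
     \<longleftrightarrow> linear_fun (\<lambda>x. rep (G x))" (is "?L \<longleftrightarrow> ?R")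
proof
  have c: "G x \<in> carrier (L0 P)" if "x \<in> carrier E" for x using G that by blast
  {
    assume ?L
    then have add: "\<And>x y. x \<in> carrier E \<Longrightarrow> y \<in> carrier E \<Longrightarrow> G (x \<oplus>\<^bsub>E\<^esub> y) = G x \<oplus>\<^bsub>L0 P\<^esub> G y"
      and smult: "\<And>\<xi> x. \<xi> \<in> carrier (L0 P) \<Longrightarrow> x \<in> carrier E \<Longrightarrow> G (\<xi> \<odot>\<^bsub>E\<^esub> x) = \<xi> \<otimes>\<^bsub>L0 P\<^esub> G x" by auto
    show ?R
      unfolding linear_fun_def
    proof (intro conjI ballI)
      fix x assume x: "x \<in> carrier E"
      show "rep (G x) \<in> borel_measurable P" using c[OF x] by blast
      fix y assume y: "y \<in> carrier E"
      show "AE w in P. rep (G (x \<oplus>\<^bsub>E\<^esub> y)) w = rep (G x) w + rep (G y) w"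
        unfolding add[OF x y] by (rule rep_add[OF c[OF x] c[OF y]])
    next
      fix f :: "'w \<Rightarrow> 'k" and x assume f: "f \<in> borel_measurable P" and x: "x \<in> carrier E"
      show "AE w in P. rep (G (act f x)) w = f w * rep (G x) w"
        unfolding act_def smult[OF ae_class_closed[OF f] x]
        using rep_mult[OF ae_class_closed[OF f] c[OF x]] rep_ae_class[OF f] by eventually_elim simp
    qed
  }
  {
    assume R: ?R
    show ?L
    proof (intro conjI ballI)
      fix x y assume x: "x \<in> carrier E" and y: "y \<in> carrier E"
      show "G (x \<oplus>\<^bsub>E\<^esub> y) = G x \<oplus>\<^bsub>L0 P\<^esub> G y"
      proof (rule L0_eqI)
        show "AE w in P. rep (G (x \<oplus>\<^bsub>E\<^esub> y)) w = rep (G x \<oplus>\<^bsub>L0 P\<^esub> G y) w"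
          using linear_funD(3)[OF R x y] rep_add[OF c[OF x] c[OF y]] by eventually_elim simp
      qed (use c x y add_L0_closed in auto)
    next
      fix \<xi> :: "('w \<Rightarrow> 'k) set" and x assume \<xi>: "\<xi> \<in> carrier (L0 P)" and x: "x \<in> carrier E"
      have eq: "act (rep \<xi>) x = \<xi> \<odot>\<^bsub>E\<^esub> x" using \<xi> by (simp add: act_def)
      show "G (\<xi> \<odot>\<^bsub>E\<^esub> x) = \<xi> \<otimes>\<^bsub>L0 P\<^esub> G x"
      proof (rule L0_eqI)
        show "AE w in P. rep (G (\<xi> \<odot>\<^bsub>E\<^esub> x)) w = rep (\<xi> \<otimes>\<^bsub>L0 P\<^esub> G x) w"
          using linear_funD(2)[OF R rep_measurable[OF \<xi>] x] rep_mult[OF \<xi> c[OF x]]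
          unfolding eq by eventually_elim simp
      qed (use c x \<xi> mult_L0_closed in auto)
    qed
  }
qed

text \<open>Continuity gives boundedness through the preimage of the unit ball. Conversely,
  additivity reduces every point to zero, where the controlled form answers a radius
  \<open>h\<close> by \<open>e * h\<close>.\<close>

lemma continuous_iff:
  assumes G: "G \<in> carrier E \<rightarrow> carrier (L0 P)" and lin: "linear_fun (\<lambda>x. rep (G x))"
  shows "continuous_map top.\<T> abs.\<T> G \<longleftrightarrow> bounded_fun (\<lambda>x. rep (G x))"
proof
  have c: "G x \<in> carrier (L0 P)" if "x \<in> carrier E" for x using G that by blast
  have add: "G (x \<oplus>\<^bsub>E\<^esub> y) = G x \<oplus>\<^bsub>L0 P\<^esub> G y" if "x \<in> carrier E" "y \<in> carrier E" for x y
    using linear_iff[OF G] lin that by blast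
  {
    assume cont: "continuous_map top.\<T> abs.\<T> G"
    define U where "U = {X \<in> carrier (L0 P). AE w in P. norm (rep X w :: 'k) \<le> 1}"
    have U1: "AE w in P. norm (rep X w :: 'k) \<le> 1"
      if "X \<in> carrier (L0 P)" "AE w in P. rep (L0_abs P X) w \<le> 1" for X
      using that(2) rep_abs[OF that(1) that(1)] by eventually_elim simp
    have "nbhd_zero (L0 P :: (('w \<Rightarrow> 'k) set, ('w \<Rightarrow> 'k) set) module) abs.\<T> U"
      unfolding abs.nbhd_zero_iff using U1
      by (intro conjI exI[of _ "{L0_abs P}"] exI[of _ "\<lambda>w. 1"]) (auto simp: U_def)
    then obtain V where V: "openin abs.\<T> V" "\<zero>\<^bsub>L0 P\<^esub> \<in> V" "V \<subseteq> U"
      unfolding nbhd_zero_def by blast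
    have "G \<zero>\<^bsub>E\<^esub> = \<zero>\<^bsub>L0 P\<^esub>"
    proof -
      have 0: "(\<lambda>w. 0 :: 'k) \<in> borel_measurable P" by simp
      have "AE w in P. rep (G \<zero>\<^bsub>E\<^esub>) w = 0"
        using linear_funD(2)[OF lin 0 M.zero_closed] by simp
      moreover have "AE w in P. rep (\<zero>\<^bsub>L0 P\<^esub> :: ('w \<Rightarrow> 'k) set) w = 0"
        unfolding zero_L0 by (rule rep_ae_class) simp
      ultimately have "AE w in P. rep (G \<zero>\<^bsub>E\<^esub>) w = rep (\<zero>\<^bsub>L0 P\<^esub> :: ('w \<Rightarrow> 'k) set) w"
        by eventually_elim simp
      then show ?thesis by (rule L0_eqI[OF c[OF M.zero_closed] R.zero_closed])
    qed
    then have "nbhd_zero E top.\<T> {x \<in> carrier E. G x \<in> V}"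
      using cont V(1,2) unfolding nbhd_zero_def continuous_map_def top.topspace_eq
      by (intro conjI exI[of _ "{x \<in> carrier E. G x \<in> V}"]) auto
    then obtain Q e where Q: "finite Q \<and> Q \<subseteq> \<N> \<and> e \<in> borel_measurable P \<and> (\<forall>w. 0 < e w)"
      and le: "\<forall>y\<in>carrier E. (\<forall>N\<in>Q. AE w in P. rep (N y) w \<le> e w) \<longrightarrow> y \<in> {x \<in> carrier E. G x \<in> V}"
      unfolding top.nbhd_zero_iff by auto
    have "AE w in P. norm (rep X w) \<le> 1" if "X \<in> V" for X using V(3) that by (auto simp: U_def)
    with Q le show "bounded_fun (\<lambda>x. rep (G x))"
      unfolding bounded_fun_def by (intro exI[of _ Q] exI[of _ e]) simp
  }
  {
    assume bd: "bounded_fun (\<lambda>x. rep (G x))"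
    obtain Q e where "controlled Q e (\<lambda>x. rep (G x))"
      using bounded_fun_controlled[OF lin bd] by blast
    note ctl = controlledD[OF this]
    note Q = ctl(1,2) and e [measurable] = ctl(3) and e0 = ctl(4) and le = ctl(5)
    show "continuous_map top.\<T> abs.\<T> G"
      unfolding continuous_map_def top.topspace_eq abs.topspace_eq
    proof (intro conjI allI impI G)
      fix U assume "openin abs.\<T> U"
      note U = this[unfolded abs.openin_iff]
      show "openin top.\<T> {x \<in> carrier E. G x \<in> U}"
        unfolding top.openin_iff
      proof (intro conjI ballI)
        fix x assume "x \<in> {x \<in> carrier E. G x \<in> U}"
        then have x: "x \<in> carrier E" and Gx: "G x \<in> U" by auto
        obtain Q' h where Q': "Q' \<subseteq> {L0_abs P}" and h [measurable]: "h \<in> borel_measurable P" and h0: "\<And>w. 0 < h w"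
          and hU: "\<forall>Y\<in>carrier (L0 P). (\<forall>N\<in>Q'. AE w in P. rep (N Y) w \<le> h w) \<longrightarrow> G x \<oplus>\<^bsub>L0 P\<^esub> Y \<in> U"
          using U[THEN conjunct2, THEN bspec, OF Gx] by auto
        have "x \<oplus>\<^bsub>E\<^esub> y \<in> {x \<in> carrier E. G x \<in> U}"
          if y: "y \<in> carrier E" "\<forall>N\<in>Q. AE w in P. rep (N y) w \<le> e w * h w" for y
        proof -
          have "AE w in P. norm (rep (G y) w) \<le> h w" using le[OF y(1) h h0] y(2) by blast
          then have "AE w in P. rep (L0_abs P (G y)) w \<le> h w"
            using rep_abs[OF c[OF y(1)] c[OF y(1)]] by eventually_elim simp
          then have "\<forall>N\<in>Q'. AE w in P. rep (N (G y)) w \<le> h w" using Q' by auto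
          then have "G x \<oplus>\<^bsub>L0 P\<^esub> G y \<in> U" by (rule hU[THEN bspec, OF c[OF y(1)], THEN mp])
          then show ?thesis using add[OF x y(1)] x y(1) by simp
        qed
        moreover have "(\<lambda>w. e w * h w) \<in> borel_measurable P" "\<forall>w. 0 < e w * h w" using e0 h0 by auto
        ultimately show "\<exists>Q e. finite Q \<and> Q \<subseteq> \<N> \<and> e \<in> borel_measurable P \<and> (\<forall>w. 0 < e w) \<and>
            (\<forall>y\<in>carrier E. (\<forall>N\<in>Q. AE w in P. rep (N y) w \<le> e w) \<longrightarrow> x \<oplus>\<^bsub>E\<^esub> y \<in> {x \<in> carrier E. G x \<in> U})"
          using Q by blast
      qed auto
    qed
  }
qed

lemma dual_iff:
  "G \<in> carrier D \<longleftrightarrow> G \<in> carrier E \<rightarrow>\<^sub>E carrier (L0 P) \<and> linear_fun (\<lambda>x. rep (G x)) \<and> bounded_fun (\<lambda>x. rep (G x))"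
proof (cases "G \<in> carrier E \<rightarrow>\<^sub>E carrier (L0 P)")
  case True
  then have G: "G \<in> carrier E \<rightarrow> carrier (L0 P)" by blast
  show ?thesis
    using True linear_iff[OF G] continuous_iff[OF G] by (auto simp: dual_module_def)
qed (simp add: dual_module_def)

lemma dualD:
  assumes "G \<in> carrier D"
  shows "x \<in> carrier E \<Longrightarrow> G x \<in> carrier (L0 P)" "linear_fun (\<lambda>x. rep (G x))" "bounded_fun (\<lambda>x. rep (G x))"
    "G \<in> extensional (carrier E)"
  using assms unfolding dual_iff by (auto simp: PiE_def)

text \<open>The way back into the dual: Hahn--Banach yields a functional with function values, while
  polars and dual norms speak of members of \<open>D\<close>. Restriction to the carrier makes the
  result extensional.\<close>

lemma dual_of_fun:
  assumes g: "linear_fun g" "bounded_fun g"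
  shows "(\<lambda>x\<in>carrier E. ae_class P (g x)) \<in> carrier D" (is "?G \<in> _")
    and "x \<in> carrier E \<Longrightarrow> AE w in P. rep ((\<lambda>x\<in>carrier E. ae_class P (g x)) x) w = g x w"
proof -
  have r: "AE w in P. rep (?G x) w = g x w" if "x \<in> carrier E" for x
    using rep_ae_class[OF linear_funD(1)[OF g(1) that]] that by simp
  then show "x \<in> carrier E \<Longrightarrow> AE w in P. rep (?G x) w = g x w" .
  have c: "?G \<in> carrier E \<rightarrow>\<^sub>E carrier (L0 P)" using linear_funD(1)[OF g(1)] by simp
  have lin: "linear_fun (\<lambda>x. rep (?G x))"
    unfolding linear_fun_def
  proof (intro conjI ballI)
    fix x assume x: "x \<in> carrier E"
    show "rep (?G x) \<in> borel_measurable P" using c x by blast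
    fix y assume y: "y \<in> carrier E"
    show "AE w in P. rep (?G (x \<oplus>\<^bsub>E\<^esub> y)) w = rep (?G x) w + rep (?G y) w"
      using r[OF x] r[OF y] r[OF M.a_closed[OF x y]] linear_funD(3)[OF g(1) x y]
      by eventually_elim simp
  next
    fix f :: "'w \<Rightarrow> 'k" and x assume f: "f \<in> borel_measurable P" and x: "x \<in> carrier E"
    show "AE w in P. rep (?G (act f x)) w = f w * rep (?G x) w"
      using r[OF x] r[OF act_closed[OF f x]] linear_funD(2)[OF g(1) f x]
      by eventually_elim simp
  qed
  have "bounded_fun (\<lambda>x. rep (?G x))"
  proof -
    have "AE w in P. norm (rep (?G y) w) \<le> 1" if "y \<in> carrier E" "AE w in P. norm (g y w) \<le> 1" for y
      using that(2) r[OF that(1)] by eventually_elim simp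
    then show ?thesis using g(2) unfolding bounded_fun_def by blast
  qed
  with c lin show "?G \<in> carrier D" unfolding dual_iff by blast
qed

section \<open>Module operations on the dual\<close>

lemma bounded_fun_add:
  assumes g: "linear_fun g" "bounded_fun g" and h: "linear_fun h" "bounded_fun h"
  shows "bounded_fun (\<lambda>x w. g x w + h x w)"
proof -
  obtain Q e where "controlled Q e g"
    using bounded_fun_controlled[OF g] by blast
  note ctlQ = controlledD[OF this]
  note Q = ctlQ(1,2) and e [measurable] = ctlQ(3) and e0 = ctlQ(4) and gl = ctlQ(5)
  obtain Q' e' where "controlled Q' e' h"
    using bounded_fun_controlled[OF h] by blast
  note ctlQ' = controlledD[OF this]
  note Q' = ctlQ'(1,2) and e' [measurable] = ctlQ'(3) and e0' = ctlQ'(4) and hl = ctlQ'(5)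
  \<comment> \<open>Each summand is to be at most \<open>1/2\<close>, so the smaller of the two
    radii is halved.\<close>
  define d where "d w = min (e w) (e' w) * (1/2)" for w
  have d: "d \<in> borel_measurable P" "\<forall>w. 0 < d w" using e0 e0' unfolding d_def by auto
  have half: "(\<lambda>w. 1/2::real) \<in> borel_measurable P" "0 < (1/2::real)" by auto
  have "AE w in P. norm (g y w + h y w) \<le> 1"
    if y: "y \<in> carrier E" and N: "\<forall>N\<in>Q \<union> Q'. AE w in P. rep (N y) w \<le> d w" for y
  proof -
    have "AE w in P. norm (g y w) \<le> 1/2"
    proof (rule gl[OF y half])
      fix N' assume "N' \<in> Q"
      then have "AE w in P. rep (N' y) w \<le> d w" using N by blast
      then show "AE w in P. rep (N' y) w \<le> e w * (1/2)"
        by eventually_elim (simp add: d_def min_def split: if_splits)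
    qed
    moreover have "AE w in P. norm (h y w) \<le> 1/2"
    proof (rule hl[OF y half])
      fix N' assume "N' \<in> Q'"
      then have "AE w in P. rep (N' y) w \<le> d w" using N by blast
      then show "AE w in P. rep (N' y) w \<le> e' w * (1/2)"
        by eventually_elim (simp add: d_def min_def split: if_splits)
    qed
    ultimately show ?thesis
    proof eventually_elim
      case (elim w)
      then show ?case using norm_triangle_ineq[of "g y w" "h y w"] by linarith
    qed
  qed
  then show ?thesis
    unfolding bounded_fun_def using d Q Q' by (intro exI[of _ "Q \<union> Q'"] exI[of _ d]) auto
qed

lemma linear_fun_add:
  assumes g: "linear_fun g" and h: "linear_fun h"
  shows "linear_fun (\<lambda>x w. g x w + h x w)"
  unfolding linear_fun_def
proof (intro conjI ballI)
  fix x assume x: "x \<in> carrier E"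
  show "(\<lambda>w. g x w + h x w) \<in> borel_measurable P"
    using linear_funD(1)[OF g x] linear_funD(1)[OF h x] by simp
  fix y assume y: "y \<in> carrier E"
  show "AE w in P. g (x \<oplus>\<^bsub>E\<^esub> y) w + h (x \<oplus>\<^bsub>E\<^esub> y) w = g x w + h x w + (g y w + h y w)"
    using linear_funD(3)[OF g x y] linear_funD(3)[OF h x y] by eventually_elim simp
next
  fix f :: "'w \<Rightarrow> 'k" and x assume f: "f \<in> borel_measurable P" and x: "x \<in> carrier E"
  show "AE w in P. g (act f x) w + h (act f x) w = f w * (g x w + h x w)"
    using linear_funD(2)[OF g f x] linear_funD(2)[OF h f x] by eventually_elim (simp add: distrib_left)
qed

lemma bounded_fun_mult:
  assumes g: "linear_fun g" "bounded_fun g" and [measurable]: "f \<in> borel_measurable P"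
  shows "bounded_fun (\<lambda>x w. f w * g x w)"
proof -
  obtain Q e where "controlled Q e g"
    using bounded_fun_controlled[OF g] by blast
  note ctlQ = controlledD[OF this]
  note Q = ctlQ(1,2) and e [measurable] = ctlQ(3) and e0 = ctlQ(4) and gl = ctlQ(5)
  \<comment> \<open>Positive even where \<open>f\<close> vanishes, while
    \<open>norm (f w) * k w \<le> 1\<close> throughout.\<close>
  define k where "k w = 1 / (1 + norm (f w))" for w
  have k [measurable]: "k \<in> borel_measurable P" unfolding k_def by measurable
  have k0: "0 < k w" for w by (simp add: k_def add_pos_nonneg)
  have "AE w in P. norm (f w * g y w) \<le> 1"
    if y: "y \<in> carrier E" and N: "\<forall>N\<in>Q. AE w in P. rep (N y) w \<le> e w * k w" for y
  proof -
    have "AE w in P. norm (g y w) \<le> k w" using gl[OF y k k0] N by blast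
    then show ?thesis
    proof eventually_elim
      case (elim w)
      then have "norm (f w) * norm (g y w) \<le> norm (f w) * k w" by (intro mult_left_mono) auto
      also have "\<dots> \<le> 1" by (simp add: k_def divide_le_eq_1 add_pos_nonneg)
      finally show ?case by (simp add: norm_mult)
    qed
  qed
  moreover have "(\<lambda>w. e w * k w) \<in> borel_measurable P" "\<forall>w. 0 < e w * k w" using e0 k0 by auto
  ultimately show ?thesis unfolding bounded_fun_def using Q by blast
qed

lemma linear_fun_mult:
  assumes g: "linear_fun g" and k [measurable]: "k \<in> borel_measurable P"
  shows "linear_fun (\<lambda>x w. k w * g x w)"
  unfolding linear_fun_def
proof (intro conjI ballI)
  fix x assume x: "x \<in> carrier E"
  show "(\<lambda>w. k w * g x w) \<in> borel_measurable P"
    using linear_funD(1)[OF g x] by simp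
  fix y assume y: "y \<in> carrier E"
  show "AE w in P. k w * g (x \<oplus>\<^bsub>E\<^esub> y) w = k w * g x w + k w * g y w"
    using linear_funD(3)[OF g x y] by eventually_elim (simp add: distrib_left)
next
  fix f :: "'w \<Rightarrow> 'k" and x assume f: "f \<in> borel_measurable P" and x: "x \<in> carrier E"
  show "AE w in P. k w * g (act f x) w = f w * (k w * g x w)"
    using linear_funD(2)[OF g f x] by eventually_elim simp
qed

lemma dual_smult:
  assumes G: "G \<in> carrier D" and f: "f \<in> borel_measurable P"
  shows "ae_class P f \<odot>\<^bsub>D\<^esub> G \<in> carrier D"
    and "x \<in> carrier E \<Longrightarrow> AE w in P. rep ((ae_class P f \<odot>\<^bsub>D\<^esub> G) x) w = f w * rep (G x) w"
proof -
  have "ae_class P f \<odot>\<^bsub>D\<^esub> G = (\<lambda>x\<in>carrier E. ae_class P (\<lambda>w. f w * rep (G x) w))" (is "?l = ?r")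
  proof
    fix x
    show "?l x = ?r x"
      using ae_class_mult[OF f rep_measurable[OF dualD(1)[OF G]], of x] dualD(1)[OF G, of x]
      by (simp add: dual_module_def restrict_def)
  qed
  then show "ae_class P f \<odot>\<^bsub>D\<^esub> G \<in> carrier D"
    "x \<in> carrier E \<Longrightarrow> AE w in P. rep ((ae_class P f \<odot>\<^bsub>D\<^esub> G) x) w = f w * rep (G x) w"
    using dual_of_fun[OF linear_fun_mult[OF dualD(2)[OF G] f] bounded_fun_mult[OF dualD(2,3)[OF G] f]]
    by simp_all
qed

lemma dual_add:
  assumes G: "G \<in> carrier D" and H: "H \<in> carrier D"
  shows "G \<oplus>\<^bsub>D\<^esub> H \<in> carrier D"
    and "x \<in> carrier E \<Longrightarrow> AE w in P. rep ((G \<oplus>\<^bsub>D\<^esub> H) x) w = rep (G x) w + rep (H x) w"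
proof -
  have "G \<oplus>\<^bsub>D\<^esub> H = (\<lambda>x\<in>carrier E. ae_class P (\<lambda>w. rep (G x) w + rep (H x) w))" (is "?l = ?r")
  proof
    fix x
    show "?l x = ?r x"
      using ae_class_add[OF rep_measurable[OF dualD(1)[OF G]] rep_measurable[OF dualD(1)[OF H]], of x x]
        dualD(1)[OF G, of x] dualD(1)[OF H, of x]
      by (simp add: dual_module_def restrict_def)
  qed
  then show "G \<oplus>\<^bsub>D\<^esub> H \<in> carrier D"
    "x \<in> carrier E \<Longrightarrow> AE w in P. rep ((G \<oplus>\<^bsub>D\<^esub> H) x) w = rep (G x) w + rep (H x) w"
    using dual_of_fun[OF linear_fun_add[OF dualD(2)[OF G] dualD(2)[OF H]]
        bounded_fun_add[OF dualD(2,3)[OF G] dualD(2,3)[OF H]]]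
    by simp_all
qed

lemma dual_zero:
  shows "\<zero>\<^bsub>D\<^esub> \<in> carrier D"
    and "x \<in> carrier E \<Longrightarrow> AE w in P. rep (\<zero>\<^bsub>D\<^esub> x) w = 0"
proof -
  have lin: "linear_fun (\<lambda>x w. 0)" by (simp add: linear_fun_def)
  have bd: "bounded_fun (\<lambda>x w. 0)"
    unfolding bounded_fun_def by (intro exI[of _ "{}"] exI[of _ "\<lambda>w. 1"]) simp
  have "\<zero>\<^bsub>D\<^esub> = (\<lambda>x\<in>carrier E. ae_class P (\<lambda>w. 0))"
    by (simp add: dual_module_def zero_L0)
  then show "\<zero>\<^bsub>D\<^esub> \<in> carrier D" "x \<in> carrier E \<Longrightarrow> AE w in P. rep (\<zero>\<^bsub>D\<^esub> x) w = 0"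
    using dual_of_fun[OF lin bd] by simp_all
qed

sublocale weak: seminorm_topology P D "{\<lambda>g. L0_abs P (g x) | x. x \<in> carrier E}"
proof
  fix G H N
  show "\<zero>\<^bsub>D\<^esub> \<in> carrier D" by (rule dual_zero)
  show "AE w in P. rep (N \<zero>\<^bsub>D\<^esub>) w \<le> 0" if N: "N \<in> {\<lambda>g. L0_abs P (g x) | x. x \<in> carrier E}"
  proof -
    obtain x where x: "x \<in> carrier E" "N = (\<lambda>g. L0_abs P (g x))" using N by blast
    have z: "\<zero>\<^bsub>D\<^esub> x \<in> carrier (L0 P)" using dualD(1)[OF dual_zero(1) x(1)] .
    show ?thesis
      unfolding x(2) using rep_abs[OF z z] dual_zero(2)[OF x(1)] by eventually_elim simp
  qed
  assume G: "G \<in> carrier D"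
  show "\<zero>\<^bsub>D\<^esub> \<oplus>\<^bsub>D\<^esub> G = G"
  proof (rule extensionalityI[of _ "carrier E"])
    show "\<zero>\<^bsub>D\<^esub> \<oplus>\<^bsub>D\<^esub> G \<in> extensional (carrier E)" by (rule dualD(4)[OF dual_add(1)[OF dual_zero(1) G]])
    show "G \<in> extensional (carrier E)" by (rule dualD(4)[OF G])
    fix x assume x: "x \<in> carrier E"
    show "(\<zero>\<^bsub>D\<^esub> \<oplus>\<^bsub>D\<^esub> G) x = G x"
    proof (rule L0_eqI)
      show "AE w in P. rep ((\<zero>\<^bsub>D\<^esub> \<oplus>\<^bsub>D\<^esub> G) x) w = rep (G x) w"
        using dual_add(2)[OF dual_zero(1) G x] dual_zero(2)[OF x] by eventually_elim simp
      show "(\<zero>\<^bsub>D\<^esub> \<oplus>\<^bsub>D\<^esub> G) x \<in> carrier (L0 P)" by (rule dualD(1)[OF dual_add(1)[OF dual_zero(1) G] x])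
      show "G x \<in> carrier (L0 P)" by (rule dualD(1)[OF G x])
    qed
  qed
  show "N G \<in> carrier (L0_plus P)" if "N \<in> {\<lambda>g. L0_abs P (g x) | x. x \<in> carrier E}"
    using that L0_abs_closed[OF dualD(1)[OF G]] by auto
  assume H: "H \<in> carrier D"
  show "G \<oplus>\<^bsub>D\<^esub> H \<in> carrier D" by (rule dual_add(1)[OF G H])
  show "AE w in P. rep (N (G \<oplus>\<^bsub>D\<^esub> H)) w \<le> rep (N G) w + rep (N H) w"
    if N: "N \<in> {\<lambda>g. L0_abs P (g x) | x. x \<in> carrier E}"
  proof -
    obtain x where x: "x \<in> carrier E" "N = (\<lambda>g. L0_abs P (g x))" using N by blast
    note c = dualD(1)[OF G x(1)] dualD(1)[OF H x(1)] dualD(1)[OF dual_add(1)[OF G H] x(1)]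
    show ?thesis
      unfolding x(2) using rep_abs[OF c(1,1)] rep_abs[OF c(2,2)] rep_abs[OF c(3,3)] dual_add(2)[OF G H x(1)]
      by eventually_elim (simp add: norm_triangle_ineq)
  qed
qed

section \<open>Weakly bounded sets of functionals\<close>

definition pointwise_bounded :: "('e \<Rightarrow> ('w \<Rightarrow> 'k) set) set \<Rightarrow> bool" where
  "pointwise_bounded A \<longleftrightarrow> A \<subseteq> carrier D \<and> (\<forall>x\<in>carrier E. \<exists>b\<in>borel_measurable P.
     (\<forall>w. 0 \<le> b w) \<and> (\<forall>G\<in>A. AE w in P. norm (rep (G x) w) \<le> b w))"

text \<open>Absorption by the neighborhood belonging to a single \<open>x\<close> yields the bound
  at \<open>x\<close>. Conversely a neighborhood involves finitely many points, and the sum of their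
  bounds determines one absorbing factor.\<close>

lemma L0_bounded_iff:
  "L0_bounded P D (weak_star_topology P E \<N>) A \<longleftrightarrow> pointwise_bounded A" (is "?L \<longleftrightarrow> ?R")
proof
  assume ?L
  then have A: "A \<subseteq> carrier D" and abs: "\<And>U. nbhd_zero D weak.\<T> U \<Longrightarrow> L0_absorbed P D A U"
    by (auto simp: L0_bounded_def weak_star_topology_def)
  have "\<exists>b\<in>borel_measurable P. (\<forall>w. 0 \<le> b w) \<and> (\<forall>G\<in>A. AE w in P. norm (rep (G x) w) \<le> b w)"
    if x: "x \<in> carrier E" for x
  proof -
    define U where "U = {G \<in> carrier D. AE w in P. norm (rep (G x) w) \<le> 1}"
    have U1: "AE w in P. norm (rep (G x) w) \<le> 1"
      if "G \<in> carrier D" "AE w in P. rep (L0_abs P (G x)) w \<le> 1" for G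
      using that(2) rep_abs[OF dualD(1)[OF that(1) x] dualD(1)[OF that(1) x]] by eventually_elim simp
    have "nbhd_zero D weak.\<T> U"
      unfolding weak.nbhd_zero_iff using x U1
      by (intro conjI exI[of _ "{\<lambda>g. L0_abs P (g x)}"] exI[of _ "\<lambda>w. 1"]) (auto simp: U_def)
    from abs[OF this] obtain \<xi> where \<xi>: "\<xi> \<in> L0_pos P"
      and U2: "\<And>\<eta>. \<eta> \<in> carrier (L0 P) \<Longrightarrow> L0_le P (L0_abs P \<eta>) \<xi> \<Longrightarrow> (\<lambda>x. \<eta> \<odot>\<^bsub>D\<^esub> x) ` A \<subseteq> U"
      unfolding L0_absorbed_def by blast
    obtain z where z [measurable]: "z \<in> borel_measurable P" and z0: "\<And>w. 0 < z w" and \<xi>z: "\<xi> = ae_class P z"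
      using L0_pos_obtain[OF \<xi>] by blast
    \<comment> \<open>The positive class that absorbs \<open>A\<close> is itself used as a scalar:
      it has the largest modulus permitted, and its reciprocal bounds the values at
      \<open>x\<close>.\<close>
    define f where "f w = (of_real (z w) :: 'k)" for w
    have f: "f \<in> borel_measurable P" unfolding f_def by measurable
    have fz: "norm (f w) = z w" for w using z0[of w] by (simp add: f_def)
    have "L0_le P (L0_abs P (ae_class P f)) \<xi>"
      unfolding \<xi>z ae_class_abs[OF f] fz by (simp add: L0_le_def)
    from U2[OF ae_class_closed[OF f] this] have U3: "ae_class P f \<odot>\<^bsub>D\<^esub> G \<in> U" if "G \<in> A" for G using that by blast
    have "AE w in P. norm (rep (G x) w) \<le> 1 / z w" if G: "G \<in> A" for G
    proof -
      have "AE w in P. norm (rep ((ae_class P f \<odot>\<^bsub>D\<^esub> G) x) w) \<le> 1" using U3[OF G] by (simp add: U_def)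
      moreover have "AE w in P. rep ((ae_class P f \<odot>\<^bsub>D\<^esub> G) x) w = f w * rep (G x) w"
        by (rule dual_smult(2)[OF _ f x]) (use G A in blast)
      ultimately show ?thesis
        by eventually_elim (use z0 in \<open>simp add: norm_mult fz field_simps\<close>)
    qed
    then show ?thesis using z0 by (intro bexI[of _ "\<lambda>w. 1 / z w"]) (auto simp: less_imp_le)
  qed
  with A show ?R by (simp add: pointwise_bounded_def)
next
  assume R: ?R
  then have A: "A \<subseteq> carrier D" by (simp add: pointwise_bounded_def)
  have "L0_absorbed P D A U" if U: "nbhd_zero D weak.\<T> U" for U
  proof -
    obtain Q e where Q: "finite Q" "Q \<subseteq> {\<lambda>g. L0_abs P (g x) | x. x \<in> carrier E}"
      and e [measurable]: "e \<in> borel_measurable P" and e0: "\<And>w. 0 < e w"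
      and QU: "\<And>G. G \<in> carrier D \<Longrightarrow> (\<forall>N\<in>Q. AE w in P. rep (N G) w \<le> e w) \<Longrightarrow> G \<in> U"
      using U unfolding weak.nbhd_zero_iff by blast
    have "\<forall>N\<in>Q. \<exists>b\<in>borel_measurable P. (\<forall>w. 0 \<le> b w) \<and> (\<forall>G\<in>A. AE w in P. rep (N G) w \<le> b w)"
    proof
      fix N assume "N \<in> Q"
      then obtain x where x: "x \<in> carrier E" "N = (\<lambda>g. L0_abs P (g x))" using Q by blast
      obtain b where b: "b \<in> borel_measurable P" "\<forall>w. 0 \<le> b w" "\<And>G. G \<in> A \<Longrightarrow> AE w in P. norm (rep (G x) w) \<le> b w"
        using R x(1) unfolding pointwise_bounded_def by blast
      have "AE w in P. rep (N G) w \<le> b w" if G: "G \<in> A" for G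
      proof -
        have c: "G x \<in> carrier (L0 P)" using G A dualD(1) x(1) by blast
        show ?thesis unfolding x(2) using rep_abs[OF c c] b(3)[OF G] by eventually_elim simp
      qed
      with b show "\<exists>b\<in>borel_measurable P. (\<forall>w. 0 \<le> b w) \<and> (\<forall>G\<in>A. AE w in P. rep (N G) w \<le> b w)" by blast
    qed
    then obtain b where b: "\<And>N. N \<in> Q \<Longrightarrow> b N \<in> borel_measurable P" "\<And>N w. N \<in> Q \<Longrightarrow> 0 \<le> b N w"
      "\<And>N G. N \<in> Q \<Longrightarrow> G \<in> A \<Longrightarrow> AE w in P. rep (N G) w \<le> b N w" by metis
    \<comment> \<open>The sum dominates every single bound, and the added \<open>1\<close> keeps the
      divisor of \<open>e\<close> positive.\<close>
    define s where "s w = 1 + (\<Sum>N\<in>Q. b N w)" for w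
    have s [measurable]: "s \<in> borel_measurable P" unfolding s_def using b(1) by simp
    have s0: "0 < s w" for w unfolding s_def using b(2) by (intro add_pos_nonneg sum_nonneg) auto
    have bs: "b N w \<le> s w" if "N \<in> Q" for N w
    proof -
      have "b N w \<le> (\<Sum>N\<in>Q. b N w)" using that Q(1) b(2) by (intro member_le_sum) auto
      then show ?thesis by (simp add: s_def)
    qed
    define z where "z w = e w / s w" for w
    have z [measurable]: "z \<in> borel_measurable P" unfolding z_def by measurable
    have z0: "0 < z w" for w using e0 s0 by (simp add: z_def)
    have "(\<lambda>G. \<eta> \<odot>\<^bsub>D\<^esub> G) ` A \<subseteq> U" if \<eta>: "\<eta> \<in> carrier (L0 P)" "L0_le P (L0_abs P \<eta>) (ae_class P z)" for \<eta>
    proof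
      fix H assume "H \<in> (\<lambda>G. \<eta> \<odot>\<^bsub>D\<^esub> G) ` A"
      then obtain G where G: "G \<in> A" "H = \<eta> \<odot>\<^bsub>D\<^esub> G" by blast
      have GD: "G \<in> carrier D" using G A by blast
      define f where "f = rep \<eta>"
      have f [measurable]: "f \<in> borel_measurable P" and \<eta>f: "\<eta> = ae_class P f" using \<eta>(1) by (auto simp: f_def)
      have fz: "AE w in P. norm (f w) \<le> z w"
        using \<eta>(2) unfolding \<eta>f by (simp add: ae_class_abs L0_le_class)
      have HD: "H \<in> carrier D" unfolding G(2) \<eta>f by (rule dual_smult(1)[OF GD f])
      show "H \<in> U"
      proof (rule QU[OF HD], rule ballI)
        fix N assume N: "N \<in> Q"
        then obtain x where x: "x \<in> carrier E" "N = (\<lambda>g. L0_abs P (g x))" using Q by blast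
        note c = dualD(1)[OF HD x(1)] dualD(1)[OF GD x(1)]
        have "AE w in P. rep (H x) w = f w * rep (G x) w"
          unfolding G(2) \<eta>f by (rule dual_smult(2)[OF GD f x(1)])
        with rep_abs[OF c(1,1)] rep_abs[OF c(2,2)] b(3)[OF N G(1)] fz
        show "AE w in P. rep (N H) w \<le> e w"
          unfolding x(2)
        proof eventually_elim
          case (elim w)
          have "norm (f w) * norm (rep (G x) w) \<le> z w * s w"
            using elim bs[OF N, of w] z0[of w] unfolding x(2) by (intro mult_mono) auto
          also have "\<dots> = e w" using s0[of w] by (simp add: z_def)
          finally show ?case using elim by (simp add: norm_mult)
        qed
      qed
    qed
    moreover have "ae_class P z \<in> L0_pos P" using z0 by (simp add: L0_pos_class)
    ultimately show ?thesis unfolding L0_absorbed_def by blast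
  qed
  with A show ?L by (simp add: L0_bounded_def weak_star_topology_def)
qed

section \<open>The strong topology\<close>

abbreviation dual_norm :: "('e \<Rightarrow> ('w \<Rightarrow> 'k) set) set \<Rightarrow> 'e \<Rightarrow> ('w \<Rightarrow> real) set" where
  "dual_norm A \<equiv> \<lambda>x. \<Squnion>\<^bsub>L0_plus P\<^esub> {L0_abs P (g x) | g. g \<in> A}"

text \<open>Pointwise boundedness provides the upper bound under which the supremum over
  \<open>A\<close> is genuine. It is compared with nonnegative \<open>e\<close> because suprema are
  formed inside the cone; for empty \<open>A\<close> it is zero.\<close>

lemma dual_norm:
  assumes A: "pointwise_bounded A" and x: "x \<in> carrier E"
  shows "dual_norm A x \<in> carrier (L0_plus P)"
    and "e \<in> borel_measurable P \<Longrightarrow> AE w in P. 0 \<le> e w \<Longrightarrow>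
      (AE w in P. rep (dual_norm A x) w \<le> e w) \<longleftrightarrow> (\<forall>G\<in>A. AE w in P. norm (rep (G x) w) \<le> e w)"
proof -
  have c: "G x \<in> carrier (L0 P)" if "G \<in> A" for G
    using A that dualD(1) x unfolding pointwise_bounded_def by blast
  have le: "L0_le P (L0_abs P (G x)) (ae_class P e) \<longleftrightarrow> (AE w in P. norm (rep (G x) w) \<le> e w)"
    if "G \<in> A" "e \<in> borel_measurable P" for G e
    unfolding L0_le_def using rep_abs[OF c[OF that(1)] c[OF that(1)]] rep_ae_class[OF that(2)]
    by (intro eventually_subst, eventually_elim) simp
  obtain b where b: "b \<in> borel_measurable P" "\<forall>w. 0 \<le> b w" "\<And>G. G \<in> A \<Longrightarrow> AE w in P. norm (rep (G x) w) \<le> b w"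
    using A x unfolding pointwise_bounded_def by blast
  have S: "{L0_abs P (g x) | g. g \<in> A} \<subseteq> carrier (L0_plus P)" using L0_abs_closed[OF c] by blast
  have U: "ae_class P b \<in> carrier (L0_plus P)" using b by (simp add: L0_plus_class)
  have bound: "L0_le P X (ae_class P b)" if "X \<in> {L0_abs P (g x) | g. g \<in> A}" for X
    using that le[OF _ b(1)] b(3) by blast
  show N: "dual_norm A x \<in> carrier (L0_plus P)" by (rule L0_plus_sup(1)[OF S U bound])
  show "(AE w in P. rep (dual_norm A x) w \<le> e w) \<longleftrightarrow> (\<forall>G\<in>A. AE w in P. norm (rep (G x) w) \<le> e w)"
    if e: "e \<in> borel_measurable P" "AE w in P. 0 \<le> e w"
  proof -
    have ec: "ae_class P e \<in> carrier (L0_plus P)" using e by (simp add: L0_plus_class)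
    have "(AE w in P. rep (dual_norm A x) w \<le> e w) \<longleftrightarrow> L0_le P (dual_norm A x) (ae_class P e)"
      unfolding L0_le_def using rep_ae_class[OF e(1)] by (intro eventually_subst, eventually_elim) simp
    also have "\<dots> \<longleftrightarrow> (\<forall>X\<in>{L0_abs P (g x) | g. g \<in> A}. L0_le P X (ae_class P e))"
      by (rule L0_plus_sup(2)[OF S U bound ec])
    also have "\<dots> \<longleftrightarrow> (\<forall>G\<in>A. AE w in P. norm (rep (G x) w) \<le> e w)" using le[OF _ e(1)] by blast
    finally show ?thesis .
  qed
qed

abbreviation "strong_norms \<equiv> {dual_norm A | A. L0_bounded P D (weak_star_topology P E \<N>) A}"

sublocale strong: seminorm_topology P E strong_norms
proof
  fix N x assume "N \<in> strong_norms"
  then obtain A where A: "pointwise_bounded A" and N: "N = dual_norm A" unfolding L0_bounded_iff by blast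
  have AD: "G \<in> carrier D" if "G \<in> A" for G using A that by (auto simp: pointwise_bounded_def)
  show "AE w in P. rep (N \<zero>\<^bsub>E\<^esub>) w \<le> 0"
  proof -
    have 0: "(\<lambda>w. 0 :: 'k) \<in> borel_measurable P" by simp
    have "AE w in P. norm (rep (G \<zero>\<^bsub>E\<^esub>) w) \<le> 0" if "G \<in> A" for G
      using linear_funD(2)[OF dualD(2)[OF AD[OF that]] 0 M.zero_closed] by simp
    then show ?thesis unfolding N using dual_norm(2)[OF A M.zero_closed, of "\<lambda>w. 0"] by simp
  qed
  assume x: "x \<in> carrier E"
  show "N x \<in> carrier (L0_plus P)" unfolding N by (rule dual_norm(1)[OF A x])
  fix y assume y: "y \<in> carrier E"
  have nn: "rep (N z) \<in> borel_measurable P" "AE w in P. 0 \<le> rep (N z) w"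
    "\<forall>G\<in>A. AE w in P. norm (rep (G z) w) \<le> rep (N z) w" if z: "z \<in> carrier E" for z
  proof -
    have "N z \<in> carrier (L0_plus P)" unfolding N by (rule dual_norm(1)[OF A z])
    then show *: "rep (N z) \<in> borel_measurable P" "AE w in P. 0 \<le> rep (N z) w"
      by (auto simp: carrier_L0_plus)
    \<comment> \<open>Taking the norm itself as the comparison function shows that it dominates
      every member of \<open>A\<close>.\<close>
    show "\<forall>G\<in>A. AE w in P. norm (rep (G z) w) \<le> rep (N z) w"
      using dual_norm(2)[OF A z *] unfolding N by simp
  qed
  note [measurable] = nn(1)[OF x] nn(1)[OF y]
  have m: "(\<lambda>w. rep (N x) w + rep (N y) w) \<in> borel_measurable P" by measurable
  have p: "AE w in P. 0 \<le> rep (N x) w + rep (N y) w"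
    using nn(2)[OF x] nn(2)[OF y] by eventually_elim simp
  have "\<forall>G\<in>A. AE w in P. norm (rep (G (x \<oplus>\<^bsub>E\<^esub> y)) w) \<le> rep (N x) w + rep (N y) w"
  proof
    fix G assume G: "G \<in> A"
    show "AE w in P. norm (rep (G (x \<oplus>\<^bsub>E\<^esub> y)) w) \<le> rep (N x) w + rep (N y) w"
      using linear_funD(3)[OF dualD(2)[OF AD[OF G]] x y] nn(3)[OF x, rule_format, OF G] nn(3)[OF y, rule_format, OF G]
    proof eventually_elim
      case (elim w)
      then show ?case using norm_triangle_ineq[of "rep (G x) w" "rep (G y) w"] by simp
    qed
  qed
  then show "AE w in P. rep (N (x \<oplus>\<^bsub>E\<^esub> y)) w \<le> rep (N x) w + rep (N y) w"
    using dual_norm(2)[OF A M.a_closed[OF x y] m p] unfolding N by simp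
qed auto

lemma strong_topology_eq: "strong_topology P E \<N> = strong.\<T>"
  by (simp add: strong_topology_def)

end


section \<open>Barrels and the main theorem\<close>

context random_lc_module
begin

text \<open>The polar of \<open>A\<close> with a random radius \<open>e\<close> in place of
  \<open>1\<close>. A basic strong neighborhood of zero with radius \<open>e\<close> has this form,
  \<open>A\<close> being the union of the bounded sets behind its norms.\<close>

definition polar_of :: "('e \<Rightarrow> ('w \<Rightarrow> 'k) set) set \<Rightarrow> ('w \<Rightarrow> real) \<Rightarrow> 'e set" where
  "polar_of A e = {y \<in> carrier E. \<forall>G\<in>A. AE w in P. norm (rep (G y) w) \<le> e w}"

context
  fixes A :: "('e \<Rightarrow> ('w \<Rightarrow> 'k) set) set" and e :: "'w \<Rightarrow> real"
  assumes A: "pointwise_bounded A" and e [measurable]: "e \<in> borel_measurable P" and e0: "\<And>w. 0 < e w"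
begin

lemma polar_dual: "G \<in> A \<Longrightarrow> G \<in> carrier D"
  using A by (auto simp: pointwise_bounded_def)

lemma polar_balanced: "L0_balanced P E (polar_of A e)"
  unfolding L0_balanced_def
proof (intro ballI impI subsetI)
  fix \<eta> :: "('w \<Rightarrow> 'k) set" and z
  assume \<eta>: "\<eta> \<in> carrier (L0 P)" "L0_le P (L0_abs P \<eta>) \<one>\<^bsub>L0 P\<^esub>" and z: "z \<in> (\<lambda>x. \<eta> \<odot>\<^bsub>E\<^esub> x) ` polar_of A e"
  define f where "f = rep \<eta>"
  have f [measurable]: "f \<in> borel_measurable P" and \<eta>f: "\<eta> = ae_class P f" using \<eta>(1) by (auto simp: f_def)
  have f1: "AE w in P. norm (f w) \<le> 1"
    using \<eta>(2) unfolding \<eta>f one_L0 by (simp add: ae_class_abs L0_le_class)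
  obtain x where x: "x \<in> polar_of A e" and zx: "z = act f x" using z by (auto simp: act_def \<eta>f)
  have xE: "x \<in> carrier E" using x by (simp add: polar_of_def)
  have "AE w in P. norm (rep (G (act f x)) w) \<le> e w" if G: "G \<in> A" for G
  proof -
    have "AE w in P. norm (rep (G x) w) \<le> e w" using x G by (simp add: polar_of_def)
    with linear_funD(2)[OF dualD(2)[OF polar_dual[OF G]] f xE] f1
    show ?thesis
    proof eventually_elim
      case (elim w)
      have "norm (f w) * norm (rep (G x) w) \<le> 1 * e w" using elim by (intro mult_mono) auto
      then show ?case using elim(1) by (simp add: norm_mult)
    qed
  qed
  then show "z \<in> polar_of A e" unfolding zx polar_of_def using xE f by simp
qed

text \<open>The bound \<open>b\<close> of \<open>A\<close> at \<open>x\<close> yields the absorbing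
  factor \<open>e / (1 + b)\<close>.\<close>

lemma polar_absorbent: "L0_absorbent P E (polar_of A e)"
  unfolding L0_absorbent_def
proof
  fix x assume x: "x \<in> carrier E"
  obtain b where b [measurable]: "b \<in> borel_measurable P" and b0: "\<forall>w. 0 \<le> b w"
    and bA: "\<forall>G\<in>A. AE w in P. norm (rep (G x) w) \<le> b w"
    using A x unfolding pointwise_bounded_def by blast
  define z where "z w = e w / (1 + b w)" for w
  have z [measurable]: "z \<in> borel_measurable P" unfolding z_def by measurable
  have b1: "0 < 1 + b w" for w using b0[rule_format, of w] by linarith
  have z0: "0 < z w" for w unfolding z_def using e0 b1 by simp
  have "ae_class P z \<in> L0_pos P" using z0 by (simp add: L0_pos_class)
  moreover have "(\<lambda>y. \<eta> \<odot>\<^bsub>E\<^esub> y) ` {x} \<subseteq> polar_of A e"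
    if \<eta>: "\<eta> \<in> carrier (L0 P)" "L0_le P (L0_abs P \<eta>) (ae_class P z)" for \<eta> :: "('w \<Rightarrow> 'k) set"
  proof -
    define f where "f = rep \<eta>"
    have f [measurable]: "f \<in> borel_measurable P" and \<eta>f: "\<eta> = ae_class P f" using \<eta>(1) by (auto simp: f_def)
    have fz: "AE w in P. norm (f w) \<le> z w"
      using \<eta>(2) unfolding \<eta>f by (simp add: ae_class_abs L0_le_class)
    have "AE w in P. norm (rep (G (act f x)) w) \<le> e w" if G: "G \<in> A" for G
      using linear_funD(2)[OF dualD(2)[OF polar_dual[OF G]] f x] fz bA[rule_format, OF G]
    proof eventually_elim
      case (elim w)
      have "norm (f w) * norm (rep (G x) w) \<le> z w * (1 + b w)"
        using elim z0[of w] by (intro mult_mono) auto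
      also have "\<dots> = e w" using b1[of w] by (simp add: z_def)
      finally show ?case using elim(1) by (simp add: norm_mult)
    qed
    then show ?thesis using f x by (simp add: polar_of_def \<eta>f act_def[symmetric])
  qed
  ultimately show "L0_absorbed P E {x} (polar_of A e)" unfolding L0_absorbed_def by blast
qed

lemma polar_convex: "L0_convex P E (polar_of A e)"
  unfolding L0_convex_def
proof (intro ballI impI)
  fix x y \<xi> assume x: "x \<in> polar_of A e" and y: "y \<in> polar_of A e"
    and \<xi>: "\<xi> \<in> carrier (L0_plus P)" "L0_le P \<xi> \<one>\<^bsub>L0 P\<^esub>"
  have xE: "x \<in> carrier E" "y \<in> carrier E" using x y by (auto simp: polar_of_def)
  have \<xi>c: "\<xi> \<in> carrier (L0 P)" using \<xi> by (simp add: carrier_L0_plus)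
  define r where "r = rep \<xi>"
  have r [measurable]: "r \<in> borel_measurable P" and \<xi>r: "\<xi> = ae_class P r" using \<xi>c by (auto simp: r_def)
  have r01: "AE w in P. 0 \<le> r w" "AE w in P. r w \<le> 1"
    using \<xi> unfolding \<xi>r one_L0 by (simp_all add: L0_plus_class L0_le_class)
  have eq: "L0_of_real P \<xi> \<odot>\<^bsub>E\<^esub> x \<oplus>\<^bsub>E\<^esub> L0_of_real P (\<one>\<^bsub>L0 P\<^esub> \<ominus>\<^bsub>L0 P\<^esub> \<xi>) \<odot>\<^bsub>E\<^esub> y
      = ract r x \<oplus>\<^bsub>E\<^esub> ract (\<lambda>w. 1 - r w) y"
    unfolding \<xi>r one_L0 act_def by (simp add: ae_class_minus ae_class_of_real)
  have m: "(\<lambda>w. of_real (r w) :: 'k) \<in> borel_measurable P" "(\<lambda>w. of_real (1 - r w) :: 'k) \<in> borel_measurable P"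
    by measurable
  have "AE w in P. norm (rep (G (ract r x \<oplus>\<^bsub>E\<^esub> ract (\<lambda>w. 1 - r w) y)) w) \<le> e w" if G: "G \<in> A" for G
  proof -
    note lin = dualD(2)[OF polar_dual[OF G]]
    have "AE w in P. norm (rep (G x) w) \<le> e w" "AE w in P. norm (rep (G y) w) \<le> e w"
      using x y G by (auto simp: polar_of_def)
    with linear_funD(3)[OF lin act_closed[OF m(1) xE(1)] act_closed[OF m(2) xE(2)]]
      linear_funD(2)[OF lin m(1) xE(1)] linear_funD(2)[OF lin m(2) xE(2)] r01
    show ?thesis
    proof eventually_elim
      case (elim w)
      have "norm (rep (G (ract r x \<oplus>\<^bsub>E\<^esub> ract (\<lambda>w. 1 - r w) y)) w)
          \<le> norm (of_real (r w) * rep (G x) w) + norm (of_real (1 - r w) * rep (G y) w)"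
        unfolding elim(1-3) by (rule norm_triangle_ineq)
      also have "\<dots> = r w * norm (rep (G x) w) + (1 - r w) * norm (rep (G y) w)"
        using elim(4,5) by (simp only: norm_mult norm_of_real)
      also have "\<dots> \<le> r w * e w + (1 - r w) * e w"
        using elim by (intro add_mono mult_left_mono) auto
      finally show ?case by (simp add: algebra_simps)
    qed
  qed
  then show "L0_of_real P \<xi> \<odot>\<^bsub>E\<^esub> x \<oplus>\<^bsub>E\<^esub> L0_of_real P (\<one>\<^bsub>L0 P\<^esub> \<ominus>\<^bsub>L0 P\<^esub> \<xi>) \<odot>\<^bsub>E\<^esub> y \<in> polar_of A e"
    unfolding eq polar_of_def using xE m by simp
qed

text \<open>Lying outside means that some \<open>G\<close> in \<open>A\<close> exceeds
  \<open>e\<close> at \<open>x\<close> on a set of positive measure. A perturbation of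
  \<open>G x\<close> by at most half of the excess cannot remove it.\<close>

lemma polar_closed: "closedin top.\<T> (polar_of A e)"
  unfolding closedin_def top.topspace_eq
proof
  show "polar_of A e \<subseteq> carrier E" by (auto simp: polar_of_def)
  show "openin top.\<T> (carrier E - polar_of A e)"
    unfolding top.openin_iff
  proof (intro conjI ballI)
    fix x assume "x \<in> carrier E - polar_of A e"
    then have x: "x \<in> carrier E" and "\<exists>G\<in>A. \<not> (AE w in P. norm (rep (G x) w) \<le> e w)"
      by (auto simp: polar_of_def)
    then obtain G where G: "G \<in> A" and nG: "\<not> (AE w in P. norm (rep (G x) w) \<le> e w)" by blast
    note lin = dualD(2)[OF polar_dual[OF G]]
    note [measurable] = linear_funD(1)[OF lin x]
    obtain Q d where "controlled Q d (\<lambda>x. rep (G x))"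
      using bounded_fun_controlled[OF lin dualD(3)[OF polar_dual[OF G]]] by blast
    note ctl = controlledD[OF this]
    \<comment> \<open>Half of the excess over \<open>e\<close> where there is one; the value
      \<open>1\<close> elsewhere keeps the radius positive.\<close>
    define h where "h w = (if e w < norm (rep (G x) w) then (norm (rep (G x) w) - e w) / 2 else 1)" for w
    have h: "h \<in> borel_measurable P" unfolding h_def by measurable
    have h0: "0 < h w" for w by (simp add: h_def)
    have "x \<oplus>\<^bsub>E\<^esub> y \<in> carrier E - polar_of A e"
      if y: "y \<in> carrier E" and N: "\<forall>N\<in>Q. AE w in P. rep (N y) w \<le> d w * h w" for y
    proof -
      have small: "AE w in P. norm (rep (G y) w) \<le> h w" using ctl(5)[OF y h h0] N by simp
      have "\<not> (AE w in P. norm (rep (G (x \<oplus>\<^bsub>E\<^esub> y)) w) \<le> e w)"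
      proof
        assume "AE w in P. norm (rep (G (x \<oplus>\<^bsub>E\<^esub> y)) w) \<le> e w"
        with small linear_funD(3)[OF lin x y] have "AE w in P. norm (rep (G x) w) \<le> e w"
        proof eventually_elim
          case (elim w)
          have "norm (rep (G x) w) \<le> norm (rep (G x) w + rep (G y) w) + norm (rep (G y) w)"
            using norm_triangle_ineq4[of "rep (G x) w + rep (G y) w" "rep (G y) w"] by simp
          then have "norm (rep (G x) w) \<le> e w + h w" using elim by simp
          then show ?case by (cases "e w < norm (rep (G x) w)") (simp_all add: h_def field_simps)
        qed
        with nG show False by blast
      qed
      then show ?thesis using G x y unfolding polar_of_def by blast
    qed
    moreover have "(\<lambda>w. d w * h w) \<in> borel_measurable P" "\<forall>w. 0 < d w * h w"
      using ctl(3,4) h h0 by auto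
    ultimately show "\<exists>Q e'. finite Q \<and> Q \<subseteq> \<N> \<and> e' \<in> borel_measurable P \<and> (\<forall>w. 0 < e' w) \<and>
        (\<forall>y\<in>carrier E. (\<forall>N\<in>Q. AE w in P. rep (N y) w \<le> e' w) \<longrightarrow> x \<oplus>\<^bsub>E\<^esub> y \<in> carrier E - polar_of A e)"
      using ctl(1,2) by (intro exI[of _ Q] exI[of _ "\<lambda>w. d w * h w"]) simp
  qed auto
qed

lemma polar_barrel: "L0_barrel P E top.\<T> (polar_of A e)"
  unfolding L0_barrel_def
  using polar_balanced polar_absorbent polar_convex polar_closed by (auto simp: polar_of_def)

text \<open>Concatenation in \<open>E\<close> supplies the glued vector, and locality of the
  functionals carries the bounds of the pieces over to it; countably many pieces leave one null
  set.\<close>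

lemma polar_concatenation:
  assumes E: "countable_concatenation P E (carrier E)"
  shows "countable_concatenation P E (polar_of A e)"
  unfolding countable_concatenation_def
proof (intro allI impI)
  fix s :: "nat \<Rightarrow> 'e" and S :: "nat \<Rightarrow> 'w set"
  assume *: "range s \<subseteq> polar_of A e \<and> range S \<subseteq> sets P \<and> disjoint_family S \<and> (\<Union>n. S n) = space P"
  then have sB: "s n \<in> polar_of A e" and S: "S n \<in> sets P" for n by auto
  have sE: "s n \<in> carrier E" for n using sB by (simp add: polar_of_def)
  have "range s \<subseteq> carrier E" using sE by blast
  then obtain y where y: "y \<in> carrier E" "\<And>n. L0_ind P (S n) \<odot>\<^bsub>E\<^esub> y = L0_ind P (S n) \<odot>\<^bsub>E\<^esub> s n"
    using E * unfolding countable_concatenation_def by meson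
  have "AE w in P. norm (rep (G y) w) \<le> e w" if G: "G \<in> A" for G
  proof -
    have "AE w in P. w \<in> S n \<longrightarrow> norm (rep (G y) w) \<le> e w" for n
    proof -
      have "AE w in P. w \<in> S n \<longrightarrow> rep (G y) w = rep (G (s n)) w"
        by (rule linear_fun_local[OF dualD(2)[OF polar_dual[OF G]] S y(1) sE])
          (use y(2) in \<open>simp add: act_def L0_ind_def\<close>)
      moreover have "AE w in P. norm (rep (G (s n)) w) \<le> e w" using sB[of n] G by (simp add: polar_of_def)
      ultimately show ?thesis by eventually_elim simp
    qed
    then have "AE w in P. \<forall>n. w \<in> S n \<longrightarrow> norm (rep (G y) w) \<le> e w" unfolding AE_all_countable by blast
    then show ?thesis using AE_space
    proof eventually_elim
      case (elim w)
      then show ?case using * by blast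
    qed
  qed
  then have "y \<in> polar_of A e" using y(1) by (simp add: polar_of_def)
  with y(2) show "\<exists>y\<in>polar_of A e. \<forall>n. L0_ind P (S n) \<odot>\<^bsub>E\<^esub> y = L0_ind P (S n) \<odot>\<^bsub>E\<^esub> s n" by blast
qed

end

text \<open>Bounds at a point add up. This lets a single polar account for the finitely many norms
  of a basic strong neighborhood.\<close>

lemma pointwise_bounded_Union:
  assumes "finite \<A>" "\<And>A. A \<in> \<A> \<Longrightarrow> pointwise_bounded A"
  shows "pointwise_bounded (\<Union>\<A>)"
  using assms
proof (induction rule: finite_induct)
  case empty
  then show ?case by (auto simp: pointwise_bounded_def intro!: bexI[of _ "\<lambda>w. 0"])
next
  case (insert A \<A>)
  have 1: "pointwise_bounded A" and 2: "pointwise_bounded (\<Union>\<A>)" using insert by auto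
  have "\<exists>b\<in>borel_measurable P. (\<forall>w. 0 \<le> b w) \<and> (\<forall>G\<in>\<Union>(insert A \<A>). AE w in P. norm (rep (G x) w) \<le> b w)"
    if x: "x \<in> carrier E" for x
  proof -
    obtain b where b: "b \<in> borel_measurable P" "\<forall>w. 0 \<le> b w" "\<forall>G\<in>A. AE w in P. norm (rep (G x) w) \<le> b w"
      using 1 x unfolding pointwise_bounded_def by blast
    obtain c where c: "c \<in> borel_measurable P" "\<forall>w. 0 \<le> c w" "\<forall>G\<in>\<Union>\<A>. AE w in P. norm (rep (G x) w) \<le> c w"
      using 2 x unfolding pointwise_bounded_def by blast
    have bound: "AE w in P. norm (rep (G x) w) \<le> b w + c w" if G: "G \<in> \<Union>(insert A \<A>)" for G
    proof (cases "G \<in> A")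
      case True
      show ?thesis using b(3)[rule_format, OF True]
      proof eventually_elim
        case (elim w) then show ?case using c(2)[rule_format, of w] by linarith
      qed
    next
      case False
      then have "G \<in> \<Union>\<A>" using G by blast
      show ?thesis using c(3)[rule_format, OF \<open>G \<in> \<Union>\<A>\<close>]
      proof eventually_elim
        case (elim w) then show ?case using b(2)[rule_format, of w] by linarith
      qed
    qed
    have m: "(\<lambda>w. b w + c w) \<in> borel_measurable P" "\<forall>w. 0 \<le> b w + c w" using b c by auto
    show ?thesis by (intro bexI[where x="\<lambda>w. b w + c w"] conjI ballI m bound)
  qed
  moreover have "\<Union>(insert A \<A>) \<subseteq> carrier D" using 1 2 by (auto simp: pointwise_bounded_def)
  ultimately show ?case unfolding pointwise_bounded_def by blast
qed

section \<open>Comparison of the two topologies\<close>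

lemma openin_strong_imp_openin:
  assumes E: "countable_concatenation P E (carrier E)" and pre: "L0_pre_barreled P E top.\<T>"
    and U: "openin strong.\<T> U"
  shows "openin top.\<T> U"
  unfolding top.openin_iff
proof (intro conjI ballI)
  show "U \<subseteq> carrier E" using U unfolding strong.openin_iff by blast
  fix x assume "x \<in> U"
  obtain Q e where Q: "finite Q" "Q \<subseteq> strong_norms" and e: "e \<in> borel_measurable P" "\<forall>w. 0 < e w"
    and QU: "\<forall>y\<in>carrier E. (\<forall>N\<in>Q. AE w in P. rep (N y) w \<le> e w) \<longrightarrow> x \<oplus>\<^bsub>E\<^esub> y \<in> U"
    using U[unfolded strong.openin_iff, THEN conjunct2, THEN bspec, OF \<open>x \<in> U\<close>] by auto
  have "\<forall>N\<in>Q. \<exists>A. pointwise_bounded A \<and> N = dual_norm A" using Q(2) unfolding L0_bounded_iff by blast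
  from bchoice[OF this] obtain F where F: "\<forall>N\<in>Q. pointwise_bounded (F N) \<and> N = dual_norm (F N)" ..
  define A where "A = \<Union>(F ` Q)"
  have A: "pointwise_bounded A" unfolding A_def using Q(1) F by (intro pointwise_bounded_Union) auto
  have e0: "AE w in P. 0 \<le> e w" using e(2) by (simp add: less_imp_le)
  \<comment> \<open>The barrel is the polar of the union of all sets behind the norms in
    \<open>Q\<close>, with the radius \<open>e\<close> of the given strong neighborhood.\<close>
  have "nbhd_zero E top.\<T> (polar_of A e)"
    using pre polar_barrel[OF A e(1)] polar_concatenation[OF A e(1) _ E] e(2)
    unfolding L0_pre_barreled_def by blast
  then obtain Q' d where Q': "finite Q'" "Q' \<subseteq> \<N>" "d \<in> borel_measurable P" "\<forall>w. 0 < d w"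
    and dU: "\<forall>y\<in>carrier E. (\<forall>N\<in>Q'. AE w in P. rep (N y) w \<le> d w) \<longrightarrow> y \<in> polar_of A e"
    unfolding top.nbhd_zero_iff by auto
  have "x \<oplus>\<^bsub>E\<^esub> y \<in> U" if y: "y \<in> carrier E" and N: "\<forall>N\<in>Q'. AE w in P. rep (N y) w \<le> d w" for y
  proof -
    have yA: "y \<in> polar_of A e" using dU y N by simp
    have "AE w in P. rep (N y) w \<le> e w" if N: "N \<in> Q" for N
    proof -
      have FN: "pointwise_bounded (F N)" and Neq: "N = dual_norm (F N)" using F N by auto
      have "\<forall>G\<in>F N. AE w in P. norm (rep (G y) w) \<le> e w" using yA N by (auto simp: polar_of_def A_def)
      then have "AE w in P. rep (dual_norm (F N) y) w \<le> e w" using dual_norm(2)[OF FN y e(1) e0] by simp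
      then show ?thesis by (subst Neq)
    qed
    then show ?thesis using QU y by simp
  qed
  then show "\<exists>Q e. finite Q \<and> Q \<subseteq> \<N> \<and> e \<in> borel_measurable P \<and> (\<forall>w. 0 < e w) \<and>
      (\<forall>y\<in>carrier E. (\<forall>N\<in>Q. AE w in P. rep (N y) w \<le> e w) \<longrightarrow> x \<oplus>\<^bsub>E\<^esub> y \<in> U)"
    using Q' by (intro exI[of _ Q'] exI[of _ d]) simp
qed

lemma bounded_fun_of_seminorm:
  assumes Q: "finite Q" "Q \<subseteq> \<N>" and c [measurable]: "c \<in> borel_measurable P" and c0: "\<And>w. 0 < c w"
    and le: "\<And>x. x \<in> carrier E \<Longrightarrow> AE w in P. norm (g x w) \<le> c w * (\<Sum>N\<in>Q. rep (N x) w)"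
  shows "bounded_fun g"
proof -
  \<comment> \<open>\<open>card Q\<close> seminorms of size at most \<open>d\<close> sum to at most
    \<open>1 / c\<close>; the summand \<open>1\<close> keeps the divisor positive for empty
    \<open>Q\<close>.\<close>
  define d where "d w = 1 / (c w * (1 + real (card Q)))" for w
  have d [measurable]: "d \<in> borel_measurable P" unfolding d_def by measurable
  have d0: "0 < d w" for w using c0[of w] by (simp add: d_def add_pos_nonneg)
  have "AE w in P. norm (g y w) \<le> 1" if y: "y \<in> carrier E" and N: "\<forall>N\<in>Q. AE w in P. rep (N y) w \<le> d w" for y
  proof -
    have "AE w in P. \<forall>N\<in>Q. rep (N y) w \<le> d w" using N by (intro AE_finite_allI[OF Q(1)]) blast
    with le[OF y] show ?thesis
    proof eventually_elim
      case (elim w)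
      have "(\<Sum>N\<in>Q. rep (N y) w) \<le> real (card Q) * d w" using elim(2) by (intro sum_bounded_above) auto
      also have "\<dots> \<le> (1 + real (card Q)) * d w" using d0[of w] by (intro mult_right_mono) auto
      finally have "c w * (\<Sum>N\<in>Q. rep (N y) w) \<le> c w * ((1 + real (card Q)) * d w)"
        using c0[of w] by (intro mult_left_mono) auto
      also have "\<dots> = 1"
      proof -
        have "1 + real (card Q) \<noteq> 0" by linarith
        then show ?thesis using c0[of w] by (simp add: d_def)
      qed
      finally show ?case using elim(1) by linarith
    qed
  qed
  then show ?thesis unfolding bounded_fun_def using Q d d0 by (intro exI[of _ Q] exI[of _ d]) simp
qed

lemma openin_imp_openin_strong:
  assumes HB: "hahn_banach_property" and U: "openin top.\<T> U"
  shows "openin strong.\<T> U"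
  unfolding strong.openin_iff
proof (intro conjI ballI)
  show "U \<subseteq> carrier E" using U unfolding top.openin_iff by blast
  fix x assume "x \<in> U"
  obtain Q e where Q: "finite Q" "Q \<subseteq> \<N>" and e: "e \<in> borel_measurable P" "\<forall>w. 0 < e w"
    and QU: "\<forall>y\<in>carrier E. (\<forall>N\<in>Q. AE w in P. rep (N y) w \<le> e w) \<longrightarrow> x \<oplus>\<^bsub>E\<^esub> y \<in> U"
    using U[unfolded top.openin_iff, THEN conjunct2, THEN bspec, OF \<open>x \<in> U\<close>] by auto
  have e0: "AE w in P. 0 \<le> e w" using e(2) by (simp add: less_imp_le)
  define F where "F N = {G \<in> carrier D. \<forall>x\<in>carrier E. AE w in P. norm (rep (G x) w) \<le> rep (N x) w}" for N
  have F: "pointwise_bounded (F N)" if N: "N \<in> Q" for N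
  proof -
    have sn: "seminorm_fun (\<lambda>x. rep (N x))" using seminorm_fun_rep N Q by blast
    have "\<exists>b\<in>borel_measurable P. (\<forall>w. 0 \<le> b w) \<and> (\<forall>G\<in>F N. AE w in P. norm (rep (G x) w) \<le> b w)"
      if x: "x \<in> carrier E" for x
    proof (intro bexI conjI ballI)
      \<comment> \<open>The modulus makes the bound nonnegative at every point; almost surely it is
        the seminorm itself.\<close>
      show "(\<lambda>w. \<bar>rep (N x) w\<bar>) \<in> borel_measurable P" using seminorm_funD(1)[OF sn x] by simp
      fix G assume "G \<in> F N"
      then have "AE w in P. norm (rep (G x) w) \<le> rep (N x) w" using x by (simp add: F_def)
      then show "AE w in P. norm (rep (G x) w) \<le> \<bar>rep (N x) w\<bar>" by eventually_elim simp
    qed simp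
    then show ?thesis unfolding pointwise_bounded_def by (auto simp: F_def)
  qed
  have HBN: "AE w in P. rep (N y) w \<le> e w"
    if N: "N \<in> Q" and y: "y \<in> carrier E" and le: "AE w in P. rep (dual_norm (F N) y) w \<le> e w" for N y
  proof -
    have NN: "N \<in> \<N>" using N Q by blast
    obtain g where g: "linear_fun g" and gN: "\<forall>x\<in>carrier E. AE w in P. norm (g x w) \<le> rep (N x) w"
      and gy: "AE w in P. norm (g y w) = rep (N y) w"
      using HB[unfolded hahn_banach_property_def, rule_format, OF seminorm_fun_rep[OF NN] y] by blast
    have bd: "bounded_fun g"
      by (rule bounded_fun_of_seminorm[of "{N}" "\<lambda>w. 1"]) (use NN gN in auto)
    let ?G = "\<lambda>x\<in>carrier E. ae_class P (g x)"
    have "AE w in P. norm (rep (?G x) w) \<le> rep (N x) w" if x: "x \<in> carrier E" for x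
      using dual_of_fun(2)[OF g bd x] gN[rule_format, OF x] by eventually_elim simp
    then have "?G \<in> F N" using dual_of_fun(1)[OF g bd] by (simp add: F_def)
    then have "AE w in P. norm (rep (?G y) w) \<le> e w"
      using le dual_norm(2)[OF F[OF N] y e(1) e0] by blast
    with dual_of_fun(2)[OF g bd y] gy show ?thesis by eventually_elim simp
  qed
  have "x \<oplus>\<^bsub>E\<^esub> y \<in> U"
    if y: "y \<in> carrier E" and N: "\<forall>S\<in>(\<lambda>N. dual_norm (F N)) ` Q. AE w in P. rep (S y) w \<le> e w" for y
  proof -
    have "\<forall>N\<in>Q. AE w in P. rep (N y) w \<le> e w" using HBN[OF _ y] N by simp
    then show ?thesis using QU y by simp
  qed
  moreover have "finite ((\<lambda>N. dual_norm (F N)) ` Q)" using Q by simp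
  moreover have "(\<lambda>N. dual_norm (F N)) ` Q \<subseteq> strong_norms" using F unfolding L0_bounded_iff by blast
  ultimately show "\<exists>Q e. finite Q \<and> Q \<subseteq> strong_norms \<and> e \<in> borel_measurable P \<and> (\<forall>w. 0 < e w) \<and>
      (\<forall>y\<in>carrier E. (\<forall>N\<in>Q. AE w in P. rep (N y) w \<le> e w) \<longrightarrow> x \<oplus>\<^bsub>E\<^esub> y \<in> U)"
    using e by (intro exI[of _ "(\<lambda>N. dual_norm (F N)) ` Q"] exI[of _ e]) simp
qed

text \<open>Merges the finitely many seminorms of a basic neighborhood and, through the weight
  \<open>c\<close>, its random radius into one seminorm to which the gauge applies.\<close>

lemma seminorm_fun_sum:
  assumes Q: "finite Q" "Q \<subseteq> \<N>" and c [measurable]: "c \<in> borel_measurable P" and c0: "\<And>w. 0 < c w"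
  shows "seminorm_fun (\<lambda>x w. c w * (\<Sum>N\<in>Q. rep (N x) w))"
proof -
  have sn: "seminorm_fun (\<lambda>x. rep (N x))" if "N \<in> Q" for N using that Q seminorm_fun_rep by blast
  show ?thesis
    unfolding seminorm_fun_def
  proof (intro conjI ballI)
    fix x assume x: "x \<in> carrier E"
    have [measurable]: "rep (N x) \<in> borel_measurable P" if "N \<in> Q" for N
      using seminorm_funD(1)[OF sn[OF that] x] .
    show "(\<lambda>w. c w * (\<Sum>N\<in>Q. rep (N x) w)) \<in> borel_measurable P" by measurable
    have "AE w in P. \<forall>N\<in>Q. 0 \<le> rep (N x) w"
      by (rule AE_finite_allI[OF Q(1)]) (rule seminorm_funD(2)[OF sn x])
    then show "AE w in P. 0 \<le> c w * (\<Sum>N\<in>Q. rep (N x) w)"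
    proof eventually_elim
      case (elim w) then show ?case using c0[of w] by (intro mult_nonneg_nonneg sum_nonneg) auto
    qed
    fix y assume y: "y \<in> carrier E"
    have "AE w in P. \<forall>N\<in>Q. rep (N (x \<oplus>\<^bsub>E\<^esub> y)) w \<le> rep (N x) w + rep (N y) w"
      by (rule AE_finite_allI[OF Q(1)]) (rule seminorm_funD(4)[OF sn x y])
    then show "AE w in P. c w * (\<Sum>N\<in>Q. rep (N (x \<oplus>\<^bsub>E\<^esub> y)) w) \<le> c w * (\<Sum>N\<in>Q. rep (N x) w) + c w * (\<Sum>N\<in>Q. rep (N y) w)"
    proof eventually_elim
      case (elim w)
      have "(\<Sum>N\<in>Q. rep (N (x \<oplus>\<^bsub>E\<^esub> y)) w) \<le> (\<Sum>N\<in>Q. rep (N x) w) + (\<Sum>N\<in>Q. rep (N y) w)"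
        unfolding sum.distrib[symmetric] using elim by (intro sum_mono) auto
      then show ?case unfolding distrib_left[symmetric] using c0[of w] by (intro mult_left_mono) auto
    qed
  next
    fix f :: "'w \<Rightarrow> 'k" and x assume f: "f \<in> borel_measurable P" and x: "x \<in> carrier E"
    have "AE w in P. \<forall>N\<in>Q. rep (N (act f x)) w = norm (f w) * rep (N x) w"
      by (rule AE_finite_allI[OF Q(1)]) (rule seminorm_funD(3)[OF sn f x])
    then show "AE w in P. c w * (\<Sum>N\<in>Q. rep (N (act f x)) w) = norm (f w) * (c w * (\<Sum>N\<in>Q. rep (N x) w))"
      by eventually_elim (simp add: sum_distrib_left mult.left_commute)
  qed
qed

section \<open>Barrels and their bipolars\<close>

context
  fixes B :: "'e set"
  assumes barrel: "L0_barrel P E top.\<T> B" and concat: "countable_concatenation P E B"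
begin

lemma barrel_absorbs:
  assumes x: "x \<in> carrier E"
  obtains z where "z \<in> borel_measurable P" "\<And>w. 0 < z w"
    "\<And>f. f \<in> borel_measurable P \<Longrightarrow> AE w in P. norm (f w) \<le> z w \<Longrightarrow> act f x \<in> B"
proof -
  have "L0_absorbed P E {x} B" using barrel x by (simp add: L0_barrel_def L0_absorbent_def)
  then obtain \<xi> where \<xi>: "\<xi> \<in> L0_pos P"
    and B: "\<forall>\<eta>\<in>carrier (L0 P). L0_le P (L0_abs P \<eta>) \<xi> \<longrightarrow> (\<lambda>x. \<eta> \<odot>\<^bsub>E\<^esub> x) ` {x} \<subseteq> B"
    unfolding L0_absorbed_def by blast
  obtain z where z: "z \<in> borel_measurable P" and z0: "\<And>w. 0 < z w" and \<xi>z: "\<xi> = ae_class P z"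
    using L0_pos_obtain[OF \<xi>] by blast
  have "act f x \<in> B" if f: "f \<in> borel_measurable P" and fz: "AE w in P. norm (f w) \<le> z w" for f
  proof -
    have "L0_le P (L0_abs P (ae_class P f)) \<xi>"
      unfolding \<xi>z using f z fz by (simp add: ae_class_abs L0_le_class)
    then show ?thesis using B f by (simp add: act_def)
  qed
  with z z0 show thesis by (rule that)
qed

lemma barrel_disc: "concatenable_disc P E B"
proof
  show "B \<subseteq> carrier E" using barrel by (simp add: L0_barrel_def)
  show "B \<noteq> {}"
  proof -
    obtain z where "\<And>w. 0 < z w"
      "\<And>f. f \<in> borel_measurable P \<Longrightarrow> AE w in P. norm (f w) \<le> z w \<Longrightarrow> act f \<zero>\<^bsub>E\<^esub> \<in> B"
      using barrel_absorbs[OF M.zero_closed] by metis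
    from this(2)[of "\<lambda>w. 0"] this(1) have "act (\<lambda>w. 0) \<zero>\<^bsub>E\<^esub> \<in> B" by (simp add: less_imp_le)
    then show ?thesis by blast
  qed
  show "act f x \<in> B" if f: "f \<in> borel_measurable P" and f1: "AE w in P. norm (f w) \<le> 1" and x: "x \<in> B" for f x
  proof -
    have "L0_balanced P E B" using barrel by (simp add: L0_barrel_def)
    moreover have "L0_le P (L0_abs P (ae_class P f)) \<one>\<^bsub>L0 P\<^esub>"
      unfolding one_L0 using f f1 by (simp add: ae_class_abs L0_le_class)
    ultimately show ?thesis using f x unfolding L0_balanced_def act_def by blast
  qed
  show "ract r x \<oplus>\<^bsub>E\<^esub> ract (\<lambda>w. 1 - r w) y \<in> B"
    if r [measurable]: "r \<in> borel_measurable P" and r01: "AE w in P. 0 \<le> r w \<and> r w \<le> 1" and xy: "x \<in> B" "y \<in> B" for r x y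
  proof -
    have c: "L0_convex P E B" using barrel by (simp add: L0_barrel_def)
    have "AE w in P. 0 \<le> r w" "AE w in P. r w \<le> 1" using r01 by simp_all
    then have "ae_class P r \<in> carrier (L0_plus P)" "L0_le P (ae_class P r) \<one>\<^bsub>L0 P\<^esub>"
      by (simp_all add: L0_plus_class L0_le_class one_L0)
    then have "L0_of_real P (ae_class P r) \<odot>\<^bsub>E\<^esub> x \<oplus>\<^bsub>E\<^esub> L0_of_real P (\<one>\<^bsub>L0 P\<^esub> \<ominus>\<^bsub>L0 P\<^esub> ae_class P r) \<odot>\<^bsub>E\<^esub> y \<in> B"
      using c xy unfolding L0_convex_def by blast
    then show ?thesis unfolding act_def one_L0 by (simp add: ae_class_minus ae_class_of_real)
  qed
  show "\<exists>y\<in>B. \<forall>n. act (indicator {w\<in>space P. k w = n}) y = act (indicator {w\<in>space P. k w = n}) (s n)"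
    if s: "range s \<subseteq> B" and k [measurable]: "k \<in> measurable P (count_space (UNIV :: nat set))" for s k
  proof -
    let ?S = "\<lambda>n. {w\<in>space P. k w = n}"
    have "range ?S \<subseteq> sets P" by auto
    moreover have "disjoint_family ?S" by (auto simp: disjoint_family_on_def)
    moreover have "(\<Union>n. ?S n) = space P" by auto
    ultimately have "\<exists>y\<in>B. \<forall>n. L0_ind P (?S n) \<odot>\<^bsub>E\<^esub> y = L0_ind P (?S n) \<odot>\<^bsub>E\<^esub> s n"
      using concat[unfolded countable_concatenation_def, rule_format, of s ?S] s by blast
    then show ?thesis by (simp add: act_def L0_ind_def)
  qed
qed

definition barrel_polar :: "('e \<Rightarrow> ('w \<Rightarrow> 'k) set) set" where
  "barrel_polar = {G \<in> carrier D. \<forall>b\<in>B. AE w in P. norm (rep (G b) w) \<le> 1}"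

text \<open>Absorbency puts \<open>z x\<close> into \<open>B\<close> for some positive
  \<open>z\<close>. Every \<open>G\<close> in the polar then satisfies
  \<open>\<bar>G (z x)\<bar> \<le> 1\<close>, so \<open>1 / z\<close> bounds all values at
  \<open>x\<close>.\<close>

lemma pointwise_bounded_barrel_polar: "pointwise_bounded barrel_polar"
proof -
  have "\<exists>b\<in>borel_measurable P. (\<forall>w. 0 \<le> b w) \<and> (\<forall>G\<in>barrel_polar. AE w in P. norm (rep (G x) w) \<le> b w)"
    if x: "x \<in> carrier E" for x
  proof -
    obtain z where z [measurable]: "z \<in> borel_measurable P" and z0: "\<And>w. 0 < z w"
      and zB: "\<And>f. f \<in> borel_measurable P \<Longrightarrow> AE w in P. norm (f w) \<le> z w \<Longrightarrow> act f x \<in> B"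
      using barrel_absorbs[OF x] by metis
    have m: "(\<lambda>w. of_real (z w) :: 'k) \<in> borel_measurable P" by measurable
    have zn: "norm (of_real (z w) :: 'k) = z w" for w using z0[of w] by simp
    have zx: "ract z x \<in> B" by (rule zB[OF m]) (simp only: zn order_refl, simp)
    have bound: "AE w in P. norm (rep (G x) w) \<le> 1 / z w" if G: "G \<in> barrel_polar" for G
    proof -
      have "G \<in> carrier D" and "AE w in P. norm (rep (G (ract z x)) w) \<le> 1"
        using G zx by (auto simp: barrel_polar_def)
      from this(2) linear_funD(2)[OF dualD(2)[OF this(1)] m x] show ?thesis
      proof eventually_elim
        case (elim w)
        then have "z w * norm (rep (G x) w) \<le> 1" by (simp only: norm_mult zn)
        then show ?case using z0[of w] by (simp add: field_simps)
      qed
    qed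
    have m: "(\<lambda>w. 1 / z w) \<in> borel_measurable P" "\<forall>w. 0 \<le> 1 / z w" using z0 by (auto simp: less_imp_le)
    show ?thesis by (intro bexI[where x="\<lambda>w. 1 / z w"] conjI ballI m bound)
  qed
  then show ?thesis unfolding pointwise_bounded_def by (auto simp: barrel_polar_def)
qed

lemma bipolar:
  assumes HB: "hahn_banach_property" and x: "x \<in> carrier E"
    and le: "\<forall>G\<in>barrel_polar. AE w in P. norm (rep (G x) w) \<le> 1"
  shows "x \<in> B"
proof (rule ccontr)
  assume "x \<notin> B"
  interpret disc: concatenable_disc P E B by (rule barrel_disc)
  have "openin top.\<T> (carrier E - B)"
    using barrel by (simp add: L0_barrel_def closedin_def top.topspace_eq)
  moreover have "x \<in> carrier E - B" using x \<open>x \<notin> B\<close> by simp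
  ultimately obtain Q e where Q: "finite Q" "Q \<subseteq> \<N>" and e [measurable]: "e \<in> borel_measurable P" and e0: "\<forall>w. 0 < e w"
    and QU: "\<forall>y\<in>carrier E. (\<forall>N\<in>Q. AE w in P. rep (N y) w \<le> e w) \<longrightarrow> x \<oplus>\<^bsub>E\<^esub> y \<in> carrier E - B"
    by (auto simp: top.openin_iff dest!: bspec[of "carrier E - B" _ x])
  \<comment> \<open>With this weight the ball \<open>n \<le> 2\<close> lies in the basic
    neighborhood given by \<open>Q\<close> and \<open>e\<close>; the \<open>2\<close> is the bound
    delivered by \<open>gauge_le_one_approx\<close>.\<close>
  define c where "c w = 2 / e w" for w
  have c [measurable]: "c \<in> borel_measurable P" unfolding c_def by measurable
  have c0: "0 < c w" for w using e0 by (simp add: c_def)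
  define n where "n x w = c w * (\<Sum>N\<in>Q. rep (N x) w)" for x w
  have n: "seminorm_fun n" unfolding n_def using seminorm_fun_sum[OF Q c c0] .
  obtain g where g: "linear_fun g" and gp: "\<forall>x\<in>carrier E. AE w in P. norm (g x w) \<le> disc.gauge_fun n x w"
    and gx: "AE w in P. norm (g x w) = disc.gauge_fun n x w"
    using HB[unfolded hahn_banach_property_def, rule_format, OF disc.seminorm_fun_gauge[OF n] x] by blast
  have "AE w in P. norm (g y w) \<le> c w * (\<Sum>N\<in>Q. rep (N y) w)" if y: "y \<in> carrier E" for y
    using gp[rule_format, OF y] disc.gauge_le_seminorm[OF n y] unfolding n_def by eventually_elim simp
  then have bd: "bounded_fun g" by (rule bounded_fun_of_seminorm[OF Q c c0])
  let ?G = "\<lambda>x\<in>carrier E. ae_class P (g x)"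
  have "AE w in P. norm (rep (?G b) w) \<le> 1" if b: "b \<in> B" for b
  proof -
    have bE: "b \<in> carrier E" using b disc.B_sub by blast
    show ?thesis
      using dual_of_fun(2)[OF g bd bE] gp[rule_format, OF bE] disc.gauge_le_one[OF n b] by eventually_elim simp
  qed
  then have "?G \<in> barrel_polar" using dual_of_fun(1)[OF g bd] by (simp add: barrel_polar_def)
  then have "AE w in P. norm (rep (?G x) w) \<le> 1" using le by blast
  with dual_of_fun(2)[OF g bd x] gx have "AE w in P. disc.gauge_fun n x w \<le> 1" by eventually_elim simp
  then obtain b where b: "b \<in> B" and nb: "AE w in P. n (x \<oplus>\<^bsub>E\<^esub> ract (\<lambda>w. - 1) b) w \<le> 2"
    using disc.gauge_le_one_approx[OF n x] by metis
  have bE: "b \<in> carrier E" using b disc.B_sub by blast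
  have m1: "(\<lambda>w. - 1 :: 'k) \<in> borel_measurable P" and one: "(\<lambda>w. 1 :: 'k) \<in> borel_measurable P" by auto
  \<comment> \<open>This is \<open>b - x\<close>, so that \<open>x + ?y = b\<close>: the
    neighborhood of \<open>x\<close> outside \<open>B\<close> would contain a point of
    \<open>B\<close>.\<close>
  let ?y = "act (\<lambda>w. - 1) (x \<oplus>\<^bsub>E\<^esub> act (\<lambda>w. - 1) b)"
  have y0: "x \<oplus>\<^bsub>E\<^esub> act (\<lambda>w. - 1) b \<in> carrier E" using x bE m1 by simp
  have y: "?y \<in> carrier E" using y0 m1 by simp
  have "x \<oplus>\<^bsub>E\<^esub> act (\<lambda>w. - 1) x = \<zero>\<^bsub>E\<^esub>"
    using act_add_left[OF one m1 x] x by simp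
  then have "x \<oplus>\<^bsub>E\<^esub> ?y = b"
    using x bE m1 by (simp add: act_add_right act_act M.a_assoc[symmetric])
  moreover have "AE w in P. rep (N ?y) w \<le> e w" if N: "N \<in> Q" for N
  proof -
    have sn: "seminorm_fun (\<lambda>x. rep (N x))" if "N \<in> Q" for N using that Q seminorm_fun_rep by blast
    have "AE w in P. \<forall>N\<in>Q. 0 \<le> rep (N (x \<oplus>\<^bsub>E\<^esub> act (\<lambda>w. - 1) b)) w"
      by (rule AE_finite_allI[OF Q(1)]) (rule seminorm_funD(2)[OF sn y0])
    with nb seminorm_funD(3)[OF sn[OF N] m1 y0] show ?thesis
    proof eventually_elim
      case (elim w)
      let ?S = "\<Sum>N\<in>Q. rep (N (x \<oplus>\<^bsub>E\<^esub> act (\<lambda>w. - 1) b)) w"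
      have "rep (N ?y) w \<le> ?S"
        using elim(2,3) N Q(1) by (simp, intro member_le_sum) auto
      moreover have "2 / e w * ?S \<le> 2" using elim(1) by (simp add: n_def c_def)
      then have "?S \<le> e w" using e0[rule_format, of w] by (simp add: field_simps)
      ultimately show ?case by linarith
    qed
  qed
  ultimately have "b \<in> carrier E - B" using QU y by metis
  with b show False by blast
qed

lemma barrel_strong_nbhd:
  assumes HB: "hahn_banach_property"
  shows "nbhd_zero E strong.\<T> B"
  unfolding strong.nbhd_zero_iff
proof (intro conjI exI[of _ "{dual_norm barrel_polar}"] exI[of _ "\<lambda>w. 1"] ballI impI)
  show "B \<subseteq> carrier E" using barrel by (simp add: L0_barrel_def)
  show "{dual_norm barrel_polar} \<subseteq> strong_norms"
    using pointwise_bounded_barrel_polar unfolding L0_bounded_iff by blast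
  fix y assume y: "y \<in> carrier E" and le: "\<forall>N\<in>{dual_norm barrel_polar}. AE w in P. rep (N y) w \<le> 1"
  have "AE w in P. rep (dual_norm barrel_polar y) w \<le> 1" using le by simp
  then have "\<forall>G\<in>barrel_polar. AE w in P. norm (rep (G y) w) \<le> 1"
    using dual_norm(2)[OF pointwise_bounded_barrel_polar y, of "\<lambda>w. 1"] by simp
  then show "y \<in> B" by (rule bipolar[OF HB y])
qed auto

end

text \<open>In the converse, closedness of a barrel refers to the original topology, which is the
  one in which the bipolar argument separates. The assumed equality then transports the resulting
  strong neighborhood of zero back to that topology.\<close>

theorem pre_barreled_iff_strong:
  assumes HB: "hahn_banach_property" and E: "countable_concatenation P E (carrier E)"
  shows "L0_pre_barreled P E (locally_L0_convex_topology P E \<N>) \<longleftrightarrow>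
    locally_L0_convex_topology P E \<N> = strong_topology P E \<N>"
proof
  assume "L0_pre_barreled P E top.\<T>"
  then show "top.\<T> = strong_topology P E \<N>"
    unfolding strong_topology_eq topology_eq
    using openin_strong_imp_openin[OF E] openin_imp_openin_strong[OF HB] by blast
next
  assume "top.\<T> = strong_topology P E \<N>"
  then have eq: "top.\<T> = strong.\<T>" unfolding strong_topology_eq .
  show "L0_pre_barreled P E top.\<T>"
    unfolding L0_pre_barreled_def
  proof (intro allI impI)
    fix B assume "L0_barrel P E top.\<T> B \<and> countable_concatenation P E B"
    then have "nbhd_zero E strong.\<T> B" using barrel_strong_nbhd HB by blast
    then show "nbhd_zero E top.\<T> B" unfolding eq .
  qed
qed

end

lemma random_lc_moduleI:
  fixes E :: "(('w \<Rightarrow> 'k::{real_normed_field, second_countable_topology}) set, 'e) module"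
  assumes "prob_space P" "random_locally_convex_module P E \<N>"
  shows "random_lc_module P E \<N>"
  using assms
  by (simp add: random_locally_convex_module_def random_lc_module_def random_lc_module_axioms_def random_module_def)

theorem theorem3p40:
  fixes P :: "'w measure"
  assumes "prob_space P"
  shows
   "(\<forall>(E :: (('w \<Rightarrow> real) set, 'e) module) \<N>.
       random_locally_convex_module P E \<N> \<longrightarrow> countable_concatenation P E (carrier E) \<longrightarrow>
       (L0_pre_barreled P E (locally_L0_convex_topology P E \<N>) \<longleftrightarrow>
        locally_L0_convex_topology P E \<N> = strong_topology P E \<N>)) \<and>
    (\<forall>(E :: (('w \<Rightarrow> complex) set, 'e) module) \<N>.
       random_locally_convex_module P E \<N> \<longrightarrow> countable_concatenation P E (carrier E) \<longrightarrow>
       (L0_pre_barreled P E (locally_L0_convex_topology P E \<N>) \<longleftrightarrow>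
        locally_L0_convex_topology P E \<N> = strong_topology P E \<N>))"
proof (intro conjI allI impI)
  fix E :: "(('w \<Rightarrow> real) set, 'e) module" and \<N>
  assume E: "random_locally_convex_module P E \<N>" "countable_concatenation P E (carrier E)"
  interpret random_lc_module P E \<N> by (rule random_lc_moduleI[OF assms E(1)])
  show "L0_pre_barreled P E (locally_L0_convex_topology P E \<N>) \<longleftrightarrow>
        locally_L0_convex_topology P E \<N> = strong_topology P E \<N>"
    by (rule pre_barreled_iff_strong[OF hahn_banach_property_real[OF random_module_axioms] E(2)])
next
  fix E :: "(('w \<Rightarrow> complex) set, 'e) module" and \<N>
  assume E: "random_locally_convex_module P E \<N>" "countable_concatenation P E (carrier E)"
  interpret random_lc_module P E \<N> by (rule random_lc_moduleI[OF assms E(1)])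
  show "L0_pre_barreled P E (locally_L0_convex_topology P E \<N>) \<longleftrightarrow>
        locally_L0_convex_topology P E \<N> = strong_topology P E \<N>"
    by (rule pre_barreled_iff_strong[OF hahn_banach_property_complex[OF random_module_axioms] E(2)])
qed

end
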